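(* Let $\kappa<0$ and $\alpha>0$ be constants independent of $n$, let $m=\alpha n$, and let $H$ be an $m\times n$ random matrix with i.i.d. standard normal entries. For $c>0$ set $$\widehat{\gamma}(c)=\frac{2c+\sqrt{4c^2+16}}{8},\qquad I_{sph}(c)=\widehat{\gamma}(c)-\frac{1}{2c}\log\left(1-\frac{c}{2\widehat{\gamma}(c)}\right).$$ For $c>0$ and $\gamma>0$ set $$p=1+\frac{c}{2\gamma},\quad q=\frac{c\kappa}{2\gamma},\quad r=\frac{c\kappa^2}{4\gamma},\quad s=-\kappa\sqrt{p}+\frac{q}{\sqrt{p}},\quad C=\frac{\exp\left(\frac{q^2}{2p}-r\right)}{\sqrt{p}},$$ $$I_{per}^{(1)}(c,\gamma,\kappa)=\frac12\,\mathrm{erfc}\left(\frac{\kappa}{\sqrt2}\right)+\frac{C}{2}\,\mathrm{erfc}\left(\frac{s}{\sqrt2}\right),$$ and set $$I_{per}(c,\alpha,\kappa)=\sup_{\gamma>0}\left(-\gamma+\frac{\alpha}{c}\log I_{per}^{(1)}(c,\gamma,\kappa)\right).$$ If $\alpha$ is such that $$\inf_{c>0}\left(-\frac{c}{2}+I_{sph}(c)+I_{per}(c,\alpha,\kappa)\right)<0,$$ then, with overwhelming probability as $n\to\infty$, the system $$H\mathbf{x}\geq\kappa\mathbf{1},\qquad \|\mathbf{x}\|_2=1$$ is infeasible, i.e. there is no $\mathbf{x}\in\mathbb{R}^n$ with $\|\mathbf{x}\|_2=1$ all of whose $m$ constraints $(H\mathbf{x})_i\geq\kappa$, $1\leq i\leq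 m$, hold.
   Context: Asymptotic (linear) regime: $n\to\infty$ with $m=\alpha n$ and $\alpha,\kappa$ fixed. An event (depending on $n$) holds with overwhelming probability if its probability differs from $1$ by at most a quantity that decays exponentially in $n$. $\mathbf{1}$ is the $m$-dimensional vector of all ones, and vector inequalities are componentwise. $\mathrm{erfc}(x)=\frac{2}{\sqrt{\pi}}\int_x^\infty e^{-t^2}\,dt$, and $\log$ is the natural logarithm. *)

theory Defs
  imports "HOL-Probability.Probability"
begin

definition erfc :: "real \<Rightarrow> real" where
  "erfc x = 2 / sqrt pi * (LINT t:{x..}|lborel. exp (- t\<^sup>2))"

definition gamma_hat :: "real \<Rightarrow> real" where
  "gamma_hat c = (2 * c + sqrt (4 * c\<^sup>2 + 16)) / 8"

definition I_sph :: "real \<Rightarrow> real" where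
  "I_sph c = gamma_hat c - 1 / (2 * c) * ln (1 - c / (2 * gamma_hat c))"

definition I_per1 :: "real \<Rightarrow> real \<Rightarrow> real \<Rightarrow> real" where
  "I_per1 c \<gamma> \<kappa> =
    (let p = 1 + c / (2 * \<gamma>);
         q = c * \<kappa> / (2 * \<gamma>);
         r = c * \<kappa>\<^sup>2 / (4 * \<gamma>);
         s = - \<kappa> * sqrt p + q / sqrt p;
         C = exp (q\<^sup>2 / (2 * p) - r) / sqrt p
     in 1 / 2 * erfc (\<kappa> / sqrt 2) + C / 2 * erfc (s / sqrt 2))"

text \<open>The supremum is taken in the extended reals, so that no boundedness has to be established
  for it to be meaningful.\<close>

definition I_per :: "real \<Rightarrow> real \<Rightarrow> real \<Rightarrow> ereal" where
  "I_per c \<alpha> \<kappa> = (SUP \<gamma>\<in>{0<..}. ereal (- \<gamma> + \<alpha> / c * ln (I_per1 c \<gamma> \<kappa>)))"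

text \<open>An \<open>m \<times> n\<close> matrix is a function of which only the entries with row index below \<open>m\<close>
  and column index below \<open>n\<close> matter; likewise for vectors.\<close>

definition std_normal_matrix ::
  "'a measure \<Rightarrow> nat \<Rightarrow> nat \<Rightarrow> (nat \<Rightarrow> nat \<Rightarrow> 'a \<Rightarrow> real) \<Rightarrow> bool" where
  "std_normal_matrix M m n H \<longleftrightarrow>
    prob_space M \<and>
    prob_space.indep_vars M (\<lambda>_. borel) (\<lambda>(i, j). H i j) ({..<m} \<times> {..<n}) \<and>
    (\<forall>i<m. \<forall>j<n. distributed M lborel (H i j) (\<lambda>x. ennreal (std_normal_density x)))"

definition spherical_feasible :: "nat \<Rightarrow> nat \<Rightarrow> real \<Rightarrow> (nat \<Rightarrow> nat \<Rightarrow> real) \<Rightarrow> bool" where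
  "spherical_feasible m n \<kappa> A \<longleftrightarrow>
    (\<exists>x :: nat \<Rightarrow> real. L2_set x {..<n} = 1 \<and> (\<forall>i<m. (\<Sum>j<n. A i j * x j) \<ge> \<kappa>))"

definition with_overwhelming_probability :: "(nat \<Rightarrow> 'a measure) \<Rightarrow> (nat \<Rightarrow> 'a \<Rightarrow> bool) \<Rightarrow> bool" where
  "with_overwhelming_probability M E \<longleftrightarrow>
    (\<forall>n. {\<omega> \<in> space (M n). E n \<omega>} \<in> sets (M n)) \<and>
    (\<exists>K>0. \<exists>\<epsilon>>0. \<forall>\<^sub>F n in sequentially.
        \<bar>1 - measure (M n) {\<omega> \<in> space (M n). E n \<omega>}\<bar> \<le> K * exp (- \<epsilon> * real n))"

end

theory Submission
  imports Defs "HOL-Real_Asymp.Real_Asymp"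
begin

text \<open>
  For a unit vector \<open>x\<close> let \<open>w (H x)\<close> be a smoothed Euclidean norm of the positive part of \<open>\<kappa> + H x\<close>;
  after replacing \<open>x\<close> by \<open>- x\<close>, feasibility makes it small for some \<open>x\<close>. As \<open>w\<close> is 1-Lipschitz,
  Gordon's Gaussian comparison, applied to a smooth version of \<open>max\<^sub>x exp (- c w)\<close> on finite sets of
  \<open>x\<close>, gives
  \<open>exp (c\<^sup>2 / 2) E max\<^sub>x exp (- c w (H x)) \<le> E exp (- c w g) E exp (c \<parallel>h\<parallel>)\<close>
  with independent standard normal vectors \<open>g\<close> and \<open>h\<close>. The constant does not depend on the finite set,
  so the bound passes to the whole sphere. With \<open>c\<close> replaced by \<open>c sqrt n\<close>, the inequality
  \<open>sqrt n \<parallel>h\<parallel> \<le> \<gamma> n + \<parallel>h\<parallel>\<^sup>2 / (4 \<gamma>)\<close> bounds the last factor through \<open>I_sph\<close>, and its equality case on a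
  finite grid of \<open>\<gamma>\<close> bounds the other one through \<open>I_per\<close>. Markov's inequality concludes.
\<close>

section \<open>Gaussian product measures and integration by parts\<close>

text \<open>The norm of a positive part is a maximum over nonnegative vectors of the unit ball, so
  feasibility is a min-max question with two index sets. Here the inner maximum stays a single
  function: all that the comparison needs of it is that its gradients at any two points have inner
  product at most 1, so only the sphere has to be made finite. The price is that the interpolation
  differentiates twice, which the norm of a positive part does not allow. Hence two smoothing
  parameters, \<open>d\<close> for the positive part and the norm, \<open>a\<close> for the maximum
  over the finite set. The decoupled side is bounded by an expression free of \<open>d\<close> and
  of the finite set, up to a factor \<open>card X powr a\<close>; so \<open>a\<close> goes to 0
  first, then the finite sets grow, and \<open>d\<close> goes to 0 last. Exponential moments are
  compared instead of expectations. The factor \<open>exp (c^2 / 2)\<close>, produced by the scalar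
  that equalises the variances, drives the decay, and no separate concentration estimate is
  needed.\<close>

definition gauss :: "real measure" where
  "gauss = density lborel (\<lambda>x. ennreal (std_normal_density x))"

text \<open>The index set is arbitrary because the random matrix, both decoupled vectors and the
  scalar are later disjoint blocks of coordinates of one sample.\<close>

definition gaussian :: "'k set \<Rightarrow> ('k \<Rightarrow> real) measure" where
  "gaussian I = PiM I (\<lambda>_. gauss)"

lemma sets_gauss [simp, measurable_cong]: "sets gauss = sets borel"
  by (simp add: gauss_def)

lemma space_gauss [simp]: "space gauss = UNIV"
  by (simp add: gauss_def)

lemma prob_space_gauss: "prob_space gauss"
  unfolding gauss_def by (rule prob_space_normal_density) simp

interpretation gauss: prob_space gauss
  by (rule prob_space_gauss)

interpretation gauss_prod: product_sigma_finite "\<lambda>_. gauss"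
  by standard

lemma prob_space_gaussian: "prob_space (gaussian I)"
  unfolding gaussian_def by (rule prob_space_PiM) (rule prob_space_gauss)

lemma sets_gaussian [simp, measurable_cong]: "sets (gaussian I) = sets (PiM I (\<lambda>_. borel))"
  unfolding gaussian_def by (rule sets_PiM_cong) auto

lemma space_gaussian [simp]: "space (gaussian I) = PiE I (\<lambda>_. UNIV)"
  by (simp add: gaussian_def space_PiM)

lemma integral_gauss:
  assumes [measurable]: "g \<in> borel_measurable borel"
  shows "(\<integral>x. g x \<partial>gauss) = (\<integral>x. std_normal_density x * g x \<partial>lborel)"
  unfolding gauss_def by (subst integral_density) auto

lemma integrable_gauss_iff:
  fixes g :: "real \<Rightarrow> real"
  assumes [measurable]: "g \<in> borel_measurable borel"
  shows "integrable gauss g \<longleftrightarrow> integrable lborel (\<lambda>x. std_normal_density x * g x)"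
  unfolding gauss_def by (subst integrable_density) auto

text \<open>Completing the square: tilting by \<open>exp (L * x)\<close> moves the mean to
  \<open>L\<close>. The exponential moments and their finiteness are then read off a normal
  density.\<close>

lemma std_normal_density_exp:
  "std_normal_density x * exp (L * x) = exp (L\<^sup>2 / 2) * normal_density L 1 x"
proof -
  have "- x\<^sup>2 / 2 + L * x = L\<^sup>2 / 2 - (x - L)\<^sup>2 / 2"
    by (simp add: power2_eq_square field_simps)
  then have "exp (- x\<^sup>2 / 2) * exp (L * x) = exp (L\<^sup>2 / 2) * exp (- (x - L)\<^sup>2 / 2)"
    by (simp flip: exp_add)
  then show ?thesis
    by (simp add: std_normal_density_def normal_density_def)
qed

lemma integrable_gauss_exp: "integrable gauss (\<lambda>x. exp (L * x))"
  by (subst integrable_gauss_iff) (simp_all only: std_normal_density_exp, auto)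

lemma integral_gauss_exp: "(\<integral>x. exp (L * x) \<partial>gauss) = exp (L\<^sup>2 / 2)"
  by (subst integral_gauss) (simp_all only: std_normal_density_exp, auto)

lemma integrable_gauss_exp_abs: "integrable gauss (\<lambda>x. exp (L * \<bar>x\<bar>))"
proof (rule Bochner_Integration.integrable_bound)
  show "integrable gauss (\<lambda>x. exp (L * x) + exp (- L * x))"
    by (intro Bochner_Integration.integrable_add integrable_gauss_exp)
  show "AE x in gauss. norm (exp (L * \<bar>x\<bar>)) \<le> norm (exp (L * x) + exp (- L * x))"
  proof (intro AE_I2)
    fix x :: real
    have "\<bar>exp (L * x) + exp (- L * x)\<bar> = exp (L * x) + exp (- L * x)"
      by (intro abs_of_nonneg add_nonneg_nonneg) auto
    then show "norm (exp (L * \<bar>x\<bar>)) \<le> norm (exp (L * x) + exp (- L * x))"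
      by (cases "x \<ge> 0") auto
  qed
qed auto

lemma abs_le_exp_abs: "\<bar>x::real\<bar> \<le> exp \<bar>x\<bar>"
  by (metis abs_ge_zero abs_le_iff exp_ge_add_one_self le_add_same_cancel1 order_trans zero_le_one add.commute)

text \<open>Growth at most \<open>K * exp (L * \<bar>s\<bar>)\<close> is the working integrability
  criterion: it survives multiplication by \<open>s\<close> at the price of \<open>L + 1\<close>,
  and in several variables it keeps its form when some coordinates are frozen.\<close>

lemma integrable_gauss_growth:
  fixes g :: "real \<Rightarrow> real"
  assumes [measurable]: "g \<in> borel_measurable borel" and "\<And>s. \<bar>g s\<bar> \<le> K * exp (L * \<bar>s\<bar>)"
  shows "integrable gauss g"
proof (rule Bochner_Integration.integrable_bound)
  show "integrable gauss (\<lambda>x. K * exp (L * \<bar>x\<bar>))"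
    by (intro integrable_mult_right integrable_gauss_exp_abs)
  show "AE x in gauss. norm (g x) \<le> norm (K * exp (L * \<bar>x\<bar>))"
    using assms(2) by (intro AE_I2) (force intro: order_trans[OF _ abs_ge_self])
qed auto

text \<open>The standard density \<open>N\<close> satisfies \<open>N' s = - s * N s\<close>, so
  \<open>N * \<phi>\<close> is an antiderivative of \<open>N s * (\<phi>' s - s * \<phi> s)\<close>.
  It vanishes at both infinities, hence that integral is zero.\<close>

lemma gauss_integration_by_parts:
  fixes \<phi> \<phi>' :: "real \<Rightarrow> real"
  assumes deriv: "\<And>s. (\<phi> has_real_derivative \<phi>' s) (at s)"
    and cont: "\<And>s. isCont \<phi>' s"
    and growth: "\<And>s. \<bar>\<phi> s\<bar> \<le> K * exp (L * \<bar>s\<bar>)" "\<And>s. \<bar>\<phi>' s\<bar> \<le> K * exp (L * \<bar>s\<bar>)"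
  shows "(\<integral>s. s * \<phi> s \<partial>gauss) = (\<integral>s. \<phi>' s \<partial>gauss)"
proof -
  have cphi: "isCont \<phi> s" for s using deriv DERIV_isCont by blast
  have [measurable]: "\<phi> \<in> borel_measurable borel" "\<phi>' \<in> borel_measurable borel"
    using cphi cont by (auto intro!: borel_measurable_continuous_onI simp: continuous_on_eq_continuous_at)
  have K: "0 \<le> K"
    using growth(1)[of 0] by simp
  let ?N = "std_normal_density"
  define F where "F s = ?N s * \<phi> s" for s
  define f where "f s = ?N s * (\<phi>' s - s * \<phi> s)" for s
  have DN: "(?N has_real_derivative - s * ?N s) (at s)" for s
    unfolding std_normal_density_def by (auto intro!: derivative_eq_intros simp: field_simps)
  have DF: "(F has_real_derivative f s) (at s)" for s
    unfolding F_def f_def by (auto intro!: derivative_eq_intros DN deriv simp: algebra_simps)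
  have cf: "isCont f s" for s
    unfolding f_def std_normal_density_def by (intro continuous_intros cont cphi) auto
  have i1: "integrable gauss (\<lambda>s. \<phi>' s)"
    by (rule integrable_gauss_growth[OF _ growth(2)]) auto
  have i2: "integrable gauss (\<lambda>s. s * \<phi> s)"
  proof (rule integrable_gauss_growth[where K=K and L="L+1"])
    fix s
    have "\<bar>s * \<phi> s\<bar> \<le> exp \<bar>s\<bar> * (K * exp (L * \<bar>s\<bar>))"
      unfolding abs_mult by (intro mult_mono abs_le_exp_abs growth) auto
    also have "\<dots> = K * exp ((L + 1) * \<bar>s\<bar>)"
      by (simp add: algebra_simps exp_add)
    finally show "\<bar>s * \<phi> s\<bar> \<le> K * exp ((L + 1) * \<bar>s\<bar>)" .
  qed auto
  have i: "integrable lborel f"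
    unfolding f_def using Bochner_Integration.integrable_diff[OF i1 i2]
    by (subst (asm) integrable_gauss_iff) auto
  have bound: "\<bar>F s\<bar> \<le> K * exp (L\<^sup>2) * exp (- s\<^sup>2 / 4)" for s
  proof -
    \<comment> \<open>This square says \<open>L * \<bar>s\<bar> \<le> L^2 + s^2 / 4\<close>: half of
      the Gaussian exponent absorbs the growth of \<open>\<phi>\<close>, the other half still forces
      decay at infinity.\<close>
    have "0 \<le> (\<bar>s\<bar> / 2 - L)\<^sup>2"
      by simp
    then have "- s\<^sup>2 / 2 + L * \<bar>s\<bar> \<le> L\<^sup>2 - s\<^sup>2 / 4"
      by (simp add: power2_diff power_divide mult.commute[of L])
    then have *: "exp (- s\<^sup>2 / 2) * exp (L * \<bar>s\<bar>) \<le> exp (L\<^sup>2) * exp (- s\<^sup>2 / 4)"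
      by (simp flip: exp_add)
    have "1 \<le> sqrt (2 * pi)"
      using pi_ge_two by simp
    then have "?N s \<le> exp (- s\<^sup>2 / 2)"
      by (simp add: std_normal_density_def field_simps)
    then have "?N s * \<bar>\<phi> s\<bar> \<le> exp (- s\<^sup>2 / 2) * (K * exp (L * \<bar>s\<bar>))"
      by (intro mult_mono growth) auto
    also have "\<dots> \<le> K * exp (L\<^sup>2) * exp (- s\<^sup>2 / 4)"
      using mult_left_mono[OF * K] by (simp add: algebra_simps)
    finally show ?thesis
      by (simp add: F_def abs_mult)
  qed
  have top: "((\<lambda>s::real. K * exp (L\<^sup>2) * exp (- s\<^sup>2 / 4)) \<longlongrightarrow> 0) at_top"
    by (rule tendsto_mult_right_zero) real_asymp
  have bot: "((\<lambda>s::real. K * exp (L\<^sup>2) * exp (- s\<^sup>2 / 4)) \<longlongrightarrow> 0) at_bot"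
    by (rule tendsto_mult_right_zero) real_asymp
  have Ftop: "(F \<longlongrightarrow> 0) at_top"
    by (rule Lim_null_comparison[OF always_eventually top]) (use bound in auto)
  have Fbot: "(F \<longlongrightarrow> 0) at_bot"
    by (rule Lim_null_comparison[OF always_eventually bot]) (use bound in auto)
  have "(LBINT s=-\<infinity>..\<infinity>. f s) = 0 - 0"
  proof (rule interval_integral_FTC_integrable[where F=F])
    show "(F has_vector_derivative f x) (at x)" for x
      using DF[of x] by (simp add: has_real_derivative_iff_has_vector_derivative)
    show "set_integrable lborel (einterval (- \<infinity>) \<infinity>) f"
      using i by (simp add: set_integrable_def)
    show "((F \<circ> real_of_ereal) \<longlongrightarrow> 0) (at_right (- \<infinity>))"
      using Fbot by (simp add: ereal_tendsto_simps)
    show "((F \<circ> real_of_ereal) \<longlongrightarrow> 0) (at_left \<infinity>)"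
      using Ftop by (simp add: ereal_tendsto_simps)
  qed (auto intro: cf)
  then have "(\<integral>s. f s \<partial>lborel) = 0"
    by (simp add: interval_lebesgue_integral_def set_lebesgue_integral_def)
  then have "(\<integral>s. \<phi>' s - s * \<phi> s \<partial>gauss) = 0"
    unfolding f_def by (subst integral_gauss) auto
  then show ?thesis
    using Bochner_Integration.integral_diff[OF i1 i2] by simp
qed

lemma gaussian_growth_bound:
  assumes "finite I"
  shows "integrable (gaussian I) (\<lambda>\<xi>. exp (L * (\<Sum>k\<in>I. \<bar>\<xi> k\<bar>)))"
proof -
  have "integrable (gaussian I) (\<lambda>\<xi>. \<Prod>k\<in>I. exp (L * \<bar>\<xi> k\<bar>))"
    unfolding gaussian_def
    by (intro gauss_prod.product_integrable_prod assms integrable_gauss_exp_abs)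
  then show ?thesis
    using assms by (simp add: exp_sum sum_distrib_left)
qed

lemma integrable_gaussian_growth:
  fixes g :: "('k \<Rightarrow> real) \<Rightarrow> real"
  assumes "finite I" and [measurable]: "g \<in> borel_measurable (PiM I (\<lambda>_. borel))"
    and "\<And>\<xi>. \<xi> \<in> PiE I (\<lambda>_. UNIV) \<Longrightarrow> \<bar>g \<xi>\<bar> \<le> K * exp (L * (\<Sum>k\<in>I. \<bar>\<xi> k\<bar>))"
  shows "integrable (gaussian I) g"
proof (rule Bochner_Integration.integrable_bound)
  show "integrable (gaussian I) (\<lambda>\<xi>. K * exp (L * (\<Sum>k\<in>I. \<bar>\<xi> k\<bar>)))"
    by (intro integrable_mult_right gaussian_growth_bound assms)
  show "AE \<xi> in gaussian I. norm (g \<xi>) \<le> norm (K * exp (L * (\<Sum>k\<in>I. \<bar>\<xi> k\<bar>)))"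
    using assms(3) by (intro AE_I2) (force intro: order_trans[OF _ abs_ge_self])
qed auto

text \<open>Fubini isolates coordinate \<open>k\<close>. With the other coordinates frozen the
  one-dimensional formula applies, their share of the growth bound going into its constant
  \<open>K\<close>.\<close>

lemma gaussian_integration_by_parts:
 
  fixes \<Phi> \<Phi>' :: "('k \<Rightarrow> real) \<Rightarrow> real"
  assumes I: "finite I" "k \<in> I"
    and [measurable]: "\<Phi> \<in> borel_measurable (PiM I (\<lambda>_. borel))"
      "\<Phi>' \<in> borel_measurable (PiM I (\<lambda>_. borel))"
    and deriv: "\<And>\<xi> s. \<xi> \<in> PiE I (\<lambda>_. UNIV) \<Longrightarrow>
        ((\<lambda>s. \<Phi> (\<xi>(k := s))) has_real_derivative \<Phi>' (\<xi>(k := s))) (at s)"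
    and cont: "\<And>\<xi> s. \<xi> \<in> PiE I (\<lambda>_. UNIV) \<Longrightarrow> isCont (\<lambda>s. \<Phi>' (\<xi>(k := s))) s"
    and growth: "\<And>\<xi>. \<xi> \<in> PiE I (\<lambda>_. UNIV) \<Longrightarrow> \<bar>\<Phi> \<xi>\<bar> \<le> K * exp (L * (\<Sum>k\<in>I. \<bar>\<xi> k\<bar>))"
      "\<And>\<xi>. \<xi> \<in> PiE I (\<lambda>_. UNIV) \<Longrightarrow> \<bar>\<Phi>' \<xi>\<bar> \<le> K * exp (L * (\<Sum>k\<in>I. \<bar>\<xi> k\<bar>))"
  shows "integrable (gaussian I) (\<lambda>\<xi>. \<xi> k * \<Phi> \<xi>)"
    and "(\<integral>\<xi>. \<xi> k * \<Phi> \<xi> \<partial>gaussian I) = (\<integral>\<xi>. \<Phi>' \<xi> \<partial>gaussian I)"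
proof -
  define J where "J = I - {k}"
  have J: "finite J" "k \<notin> J" "I = insert k J" using I by (auto simp: J_def)
  have K: "0 \<le> K"
    using growth(1)[of "\<lambda>i\<in>I. 0"] by (simp add: zero_le_mult_iff)
  have [measurable]: "(\<lambda>\<xi>. \<xi> k) \<in> borel_measurable (PiM I (\<lambda>_. borel))"
    using I by measurable
  show int1: "integrable (gaussian I) (\<lambda>\<xi>. \<xi> k * \<Phi> \<xi>)"
  proof (rule integrable_gaussian_growth[where K=K and L="L+1"])
    fix \<xi> :: "'k \<Rightarrow> real" assume w: "\<xi> \<in> PiE I (\<lambda>_. UNIV)"
    have "\<bar>\<xi> k\<bar> \<le> exp \<bar>\<xi> k\<bar>" by (rule abs_le_exp_abs)
    also have "\<dots> \<le> exp (\<Sum>k\<in>I. \<bar>\<xi> k\<bar>)"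
      using I by (auto intro!: member_le_sum)
    finally have "\<bar>\<xi> k * \<Phi> \<xi>\<bar> \<le> exp (\<Sum>k\<in>I. \<bar>\<xi> k\<bar>) * (K * exp (L * (\<Sum>k\<in>I. \<bar>\<xi> k\<bar>)))"
      unfolding abs_mult by (intro mult_mono growth w) auto
    also have "\<dots> = K * exp ((L + 1) * (\<Sum>k\<in>I. \<bar>\<xi> k\<bar>))"
      by (simp add: algebra_simps exp_add)
    finally show "\<bar>\<xi> k * \<Phi> \<xi>\<bar> \<le> K * exp ((L + 1) * (\<Sum>k\<in>I. \<bar>\<xi> k\<bar>))" .
  qed (use I in auto)
  have int2: "integrable (gaussian I) \<Phi>'"
    by (rule integrable_gaussian_growth[OF I(1) _ growth(2)]) auto
  have inner: "(\<integral>s. s * \<Phi> (\<xi>(k := s)) \<partial>gauss) = (\<integral>s. \<Phi>' (\<xi>(k := s)) \<partial>gauss)"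
    if w: "\<xi> \<in> space (gaussian J)" for \<xi>
  proof -
    define \<xi>' where "\<xi>' = \<xi>(k := 0)"
    have w': "\<xi>'(k := s) \<in> PiE I (\<lambda>_. UNIV)" for s
      using w by (auto simp: \<xi>'_def J(3) PiE_iff extensional_def)
    have w'': "\<xi>' \<in> PiE I (\<lambda>_. UNIV)"
      using w by (auto simp: \<xi>'_def J(3) PiE_iff extensional_def)
    have sum: "(\<Sum>i\<in>I. \<bar>(\<xi>'(k := s)) i\<bar>) = (\<Sum>i\<in>J. \<bar>\<xi> i\<bar>) + \<bar>s\<bar>" for s
    proof -
      have "(\<Sum>i\<in>J. \<bar>(\<xi>'(k := s)) i\<bar>) = (\<Sum>i\<in>J. \<bar>\<xi> i\<bar>)"
        using J by (intro sum.cong) (auto simp: \<xi>'_def)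
      then show ?thesis
        using J by simp
    qed
    have eq: "K * exp (L * (\<Sum>i\<in>I. \<bar>(\<xi>'(k := s)) i\<bar>)) =
        (K * exp (L * (\<Sum>i\<in>J. \<bar>\<xi> i\<bar>))) * exp (L * \<bar>s\<bar>)" for s
      unfolding sum by (simp add: algebra_simps exp_add)
    have "(\<integral>s. s * \<Phi> (\<xi>'(k := s)) \<partial>gauss) = (\<integral>s. \<Phi>' (\<xi>'(k := s)) \<partial>gauss)"
      by (rule gauss_integration_by_parts[where K="K * exp (L * (\<Sum>i\<in>J. \<bar>\<xi> i\<bar>))" and L=L])
        (use deriv[OF w''] cont[OF w''] growth(1)[OF w'] growth(2)[OF w'] in \<open>simp_all only: eq\<close>)
    then show ?thesis
      by (simp add: \<xi>'_def)
  qed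
  have "(\<integral>\<xi>. \<xi> k * \<Phi> \<xi> \<partial>gaussian I) =
      (\<integral>\<xi>. (\<integral>s. (\<xi>(k := s)) k * \<Phi> (\<xi>(k := s)) \<partial>gauss) \<partial>gaussian J)"
    using gauss_prod.product_integral_insert[OF J(1,2) int1[unfolded gaussian_def J(3)]] by (simp add: gaussian_def J(3))
  also have "\<dots> = (\<integral>\<xi>. (\<integral>s. \<Phi>' (\<xi>(k := s)) \<partial>gauss) \<partial>gaussian J)"
    by (rule Bochner_Integration.integral_cong[OF refl]) (simp add: inner)
  also have "\<dots> = (\<integral>\<xi>. \<Phi>' \<xi> \<partial>gaussian I)"
    using gauss_prod.product_integral_insert[OF J(1,2) int2[unfolded gaussian_def J(3)]] by (simp add: gaussian_def J(3))
  finally show "(\<integral>\<xi>. \<xi> k * \<Phi> \<xi> \<partial>gaussian I) = (\<integral>\<xi>. \<Phi>' \<xi> \<partial>gaussian I)" .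
qed

section \<open>Gaussian interpolation\<close>

lemma integral_nonpos_real:
  fixes f :: "'b \<Rightarrow> real"
  assumes "\<And>x. x \<in> space M \<Longrightarrow> f x \<le> 0"
  shows "(\<integral>x. f x \<partial>M) \<le> 0"
  using Bochner_Integration.integral_nonneg_AE[of "\<lambda>x. - f x" M] assms by simp

text \<open>Differentiability is expressed by the chain rule along curves, since the index sets vary with the
  finite set of test vectors and are not types.\<close>

definition has_gradient ::
  "'a set \<Rightarrow> (('a \<Rightarrow> real) \<Rightarrow> real) \<Rightarrow> ('a \<Rightarrow> ('a \<Rightarrow> real) \<Rightarrow> real) \<Rightarrow> bool" where
  "has_gradient A f f' \<longleftrightarrow> (\<forall>z z' s.
     (\<forall>a\<in>A. ((\<lambda>s. z s a) has_real_derivative z' a) (at s)) \<longrightarrow>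
     ((\<lambda>s. f (z s)) has_real_derivative (\<Sum>a\<in>A. f' a (z s) * z' a)) (at s))"

definition continuous_along :: "'a set \<Rightarrow> (('a \<Rightarrow> real) \<Rightarrow> real) \<Rightarrow> bool" where
  "continuous_along A f \<longleftrightarrow> (\<forall>z (s::real).
     (\<forall>a\<in>A. isCont (\<lambda>s. z s a) s) \<longrightarrow> isCont (\<lambda>s. f (z s)) s)"

lemma has_gradientD:
  assumes "has_gradient A f f'" and "\<And>a. a \<in> A \<Longrightarrow> ((\<lambda>s. z s a) has_real_derivative z' a) (at s)"
  shows "((\<lambda>s. f (z s)) has_real_derivative (\<Sum>a\<in>A. f' a (z s) * z' a)) (at s)"
  using assms unfolding has_gradient_def by blast

lemma continuous_alongD:
  fixes s :: real
  assumes "continuous_along A f" and "\<And>a. a \<in> A \<Longrightarrow> isCont (\<lambda>s. z s a) s"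
  shows "isCont (\<lambda>s. f (z s)) s"
  using assms unfolding continuous_along_def by blast

text \<open>Under \<open>gaussian I\<close> this is a centred Gaussian vector whose covariance is
  \<open>R\<close> times its transpose. Two covariances are thus compared through two coefficient
  matrices on one sample space.\<close>

definition linear_field :: "'a set \<Rightarrow> 'k set \<Rightarrow> ('a \<Rightarrow> 'k \<Rightarrow> real) \<Rightarrow> ('k \<Rightarrow> real) \<Rightarrow> 'a \<Rightarrow> real" where
  "linear_field A I R \<xi> = (\<lambda>a\<in>A. \<Sum>k\<in>I. R a k * \<xi> k)"

lemma measurable_linear_field [measurable]:
  "linear_field A I R \<in> measurable (PiM I (\<lambda>_. borel)) (PiM A (\<lambda>_. borel))"
  unfolding linear_field_def by measurable

lemma linear_field_growth:
  assumes "\<And>a k. a \<in> A \<Longrightarrow> k \<in> I \<Longrightarrow> \<bar>R a k\<bar> \<le> b"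
  shows "(\<Sum>a\<in>A. \<bar>linear_field A I R \<xi> a\<bar>) \<le> real (card A) * b * (\<Sum>k\<in>I. \<bar>\<xi> k\<bar>)"
proof -
  have "(\<Sum>a\<in>A. \<bar>linear_field A I R \<xi> a\<bar>) \<le> (\<Sum>a\<in>A. \<Sum>k\<in>I. b * \<bar>\<xi> k\<bar>)"
  proof (rule sum_mono)
    fix a assume a: "a \<in> A"
    have "\<bar>linear_field A I R \<xi> a\<bar> \<le> (\<Sum>k\<in>I. \<bar>R a k * \<xi> k\<bar>)"
      using a by (simp add: linear_field_def sum_abs)
    also have "\<dots> \<le> (\<Sum>k\<in>I. b * \<bar>\<xi> k\<bar>)"
      unfolding abs_mult using assms a by (intro sum_mono mult_right_mono) auto
    finally show "\<bar>linear_field A I R \<xi> a\<bar> \<le> (\<Sum>k\<in>I. b * \<bar>\<xi> k\<bar>)" .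
  qed
  then show ?thesis
    by (simp add: sum_distrib_left mult.assoc)
qed

lemma exp_linear_field_growth:
  assumes "\<And>a k. a \<in> A \<Longrightarrow> k \<in> I \<Longrightarrow> \<bar>R a k\<bar> \<le> b" and "0 \<le> K" "0 \<le> L"
  shows "K * exp (L * (\<Sum>a\<in>A. \<bar>linear_field A I R \<xi> a\<bar>))
    \<le> K * exp ((L * (real (card A) * b)) * (\<Sum>k\<in>I. \<bar>\<xi> k\<bar>))"
  using mult_left_mono[OF linear_field_growth[of A I R b \<xi>, OF assms(1)] \<open>0 \<le> L\<close>] assms(2)
  by (intro mult_left_mono) (auto simp: mult.assoc)

lemma integrable_linear_field:
  assumes "finite A" "finite I" and [measurable]: "f \<in> borel_measurable (PiM A (\<lambda>_. borel))"
    and growth: "\<And>z. \<bar>f z\<bar> \<le> K * exp (L * (\<Sum>a\<in>A. \<bar>z a\<bar>))" and "0 \<le> L"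
  shows "integrable (gaussian I) (\<lambda>\<xi>. f (linear_field A I R \<xi>))"
proof -
  define b where "b = (\<Sum>a\<in>A. \<Sum>k\<in>I. \<bar>R a k\<bar>)"
  have b: "\<bar>R a k\<bar> \<le> b" if "a \<in> A" "k \<in> I" for a k
  proof -
    have "\<bar>R a k\<bar> \<le> (\<Sum>k\<in>I. \<bar>R a k\<bar>)"
      using that assms by (intro member_le_sum) auto
    also have "\<dots> \<le> b"
      unfolding b_def using that assms by (intro member_le_sum) (auto intro: sum_nonneg)
    finally show ?thesis .
  qed
  have "0 \<le> K"
    using growth[of "\<lambda>_. 0"] by simp
  show ?thesis
    by (rule integrable_gaussian_growth[OF assms(2) _
          order_trans[OF growth exp_linear_field_growth[OF b \<open>0 \<le> K\<close> \<open>0 \<le> L\<close>]]]) auto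
qed

text \<open>Along the rotation \<open>sin \<theta> P + cos \<theta> Q\<close> the derivative of the expectation is, after integrating by
  parts in every coordinate, \<open>sin \<theta> cos \<theta>\<close> times the expectation of the Hessian paired with the
  difference of the covariances.\<close>

lemma gaussian_interpolation:
  fixes P Q :: "'a \<Rightarrow> 'k \<Rightarrow> real"
  assumes A: "finite A" and I: "finite I"
    and disj: "\<And>a b k. a \<in> A \<Longrightarrow> b \<in> A \<Longrightarrow> k \<in> I \<Longrightarrow> P a k * Q b k = 0"
    and meas: "f \<in> borel_measurable (PiM A (\<lambda>_. borel))"
      "\<And>a. a \<in> A \<Longrightarrow> f1 a \<in> borel_measurable (PiM A (\<lambda>_. borel))"
      "\<And>a b. a \<in> A \<Longrightarrow> b \<in> A \<Longrightarrow> f2 a b \<in> borel_measurable (PiM A (\<lambda>_. borel))"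
    and grad: "has_gradient A f f1" "\<And>a. a \<in> A \<Longrightarrow> has_gradient A (f1 a) (f2 a)"
    and cont: "\<And>a b. a \<in> A \<Longrightarrow> b \<in> A \<Longrightarrow> continuous_along A (f2 a b)"
    and growth: "\<And>z. \<bar>f z\<bar> \<le> K * exp (L * (\<Sum>a\<in>A. \<bar>z a\<bar>))"
      "\<And>a z. a \<in> A \<Longrightarrow> \<bar>f1 a z\<bar> \<le> K * exp (L * (\<Sum>a\<in>A. \<bar>z a\<bar>))"
      "\<And>a b z. a \<in> A \<Longrightarrow> b \<in> A \<Longrightarrow> \<bar>f2 a b z\<bar> \<le> K * exp (L * (\<Sum>a\<in>A. \<bar>z a\<bar>))"
    and L: "0 \<le> L"
    and cond: "\<And>z. (\<Sum>a\<in>A. \<Sum>b\<in>A. f2 a b z * (\<Sum>k\<in>I. P a k * P b k - Q a k * Q b k)) \<le> 0"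
  shows "(\<integral>\<xi>. f (linear_field A I P \<xi>) \<partial>gaussian I) \<le> (\<integral>\<xi>. f (linear_field A I Q \<xi>) \<partial>gaussian I)"
proof -
  \<comment> \<open>A quarter turn from \<open>Q\<close> at 0 to \<open>P\<close> at
    \<open>pi / 2\<close>. Unlike the path with the square roots of \<open>t\<close> and
    \<open>1 - t\<close>, it has bounded velocity up to both ends, so the single bound
    \<open>b\<close> serves \<open>R\<close> and \<open>R'\<close>.\<close>
  define R where "R \<theta> a k = sin \<theta> * P a k + cos \<theta> * Q a k" for \<theta> a k
  define R' where "R' \<theta> a k = cos \<theta> * P a k - sin \<theta> * Q a k" for \<theta> a k
  define Z where "Z \<theta> = linear_field A I (R \<theta>)" for \<theta>
  define D where "D \<theta> = linear_field A I (R' \<theta>)" for \<theta>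
  define g where "g \<theta> \<xi> = (\<Sum>a\<in>A. f1 a (Z \<theta> \<xi>) * D \<theta> \<xi> a)" for \<theta> \<xi>
  define b where "b = (\<Sum>a\<in>A. \<Sum>k\<in>I. \<bar>P a k\<bar> + \<bar>Q a k\<bar>)"
  define B where "B = real (card A) * b"
  define S where "S \<xi> = (\<Sum>k\<in>I. \<bar>\<xi> k\<bar>)" for \<xi> :: "'k \<Rightarrow> real"
  have K: "0 \<le> K"
    using growth(1)[of "\<lambda>_. 0"] by simp
  have PQb: "\<bar>P a k\<bar> + \<bar>Q a k\<bar> \<le> b" if "a \<in> A" "k \<in> I" for a k
  proof -
    have "\<bar>P a k\<bar> + \<bar>Q a k\<bar> \<le> (\<Sum>k\<in>I. \<bar>P a k\<bar> + \<bar>Q a k\<bar>)"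
      using that I by (intro member_le_sum[of k I "\<lambda>k. \<bar>P a k\<bar> + \<bar>Q a k\<bar>"]) auto
    also have "\<dots> \<le> b"
      unfolding b_def using that A
      by (intro member_le_sum[of a A "\<lambda>a. \<Sum>k\<in>I. \<bar>P a k\<bar> + \<bar>Q a k\<bar>"]) (auto intro: sum_nonneg)
    finally show ?thesis .
  qed
  have b0: "0 \<le> b"
    unfolding b_def by (intro sum_nonneg) auto
  have le1: "\<bar>x * y\<bar> \<le> \<bar>y\<bar>" if "\<bar>x\<bar> \<le> 1" for x y :: real
    using that by (simp add: abs_mult mult_left_le_one_le)
  have Rb: "\<bar>R \<theta> a k\<bar> \<le> b" "\<bar>R' \<theta> a k\<bar> \<le> b" if "a \<in> A" "k \<in> I" for \<theta> a k
    using PQb[OF that] le1[OF abs_sin_le_one, of \<theta> "P a k"] le1[OF abs_cos_le_one, of \<theta> "Q a k"]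
      le1[OF abs_cos_le_one, of \<theta> "P a k"] le1[OF abs_sin_le_one, of \<theta> "Q a k"]
    unfolding R_def R'_def by linarith+
  have f1b: "\<bar>f1 a (Z \<theta> \<xi>)\<bar> \<le> K * exp (L * B * S \<xi>)" if "a \<in> A" for a \<theta> \<xi>
    using order_trans[OF growth(2)[OF that] exp_linear_field_growth[of A I "R \<theta>" b, OF Rb(1) K L]]
    by (simp add: Z_def B_def S_def)
  have f2b: "\<bar>f2 a c (Z \<theta> \<xi>)\<bar> \<le> K * exp (L * B * S \<xi>)" if "a \<in> A" "c \<in> A" for a c \<theta> \<xi>
    using order_trans[OF growth(3)[OF that] exp_linear_field_growth[of A I "R \<theta>" b, OF Rb(1) K L]]
    by (simp add: Z_def B_def S_def)
  have S0: "0 \<le> S \<xi>" for \<xi>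
    by (simp add: S_def sum_nonneg)
  have gb: "\<bar>g \<theta> \<xi>\<bar> \<le> (K * B) * exp ((L * B + 1) * S \<xi>)" for \<theta> \<xi>
  proof -
    have "\<bar>g \<theta> \<xi>\<bar> \<le> (\<Sum>a\<in>A. \<bar>f1 a (Z \<theta> \<xi>)\<bar> * \<bar>D \<theta> \<xi> a\<bar>)"
      unfolding g_def abs_mult[symmetric] by (rule sum_abs)
    also have "\<dots> \<le> (\<Sum>a\<in>A. K * exp (L * B * S \<xi>) * \<bar>D \<theta> \<xi> a\<bar>)"
      by (intro sum_mono mult_right_mono f1b) auto
    also have "\<dots> = K * exp (L * B * S \<xi>) * (\<Sum>a\<in>A. \<bar>D \<theta> \<xi> a\<bar>)"
      by (simp add: sum_distrib_left)
    also have "\<dots> \<le> K * exp (L * B * S \<xi>) * (B * S \<xi>)"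
      unfolding D_def B_def S_def using K by (intro mult_left_mono linear_field_growth Rb) auto
    also have "\<dots> \<le> K * exp (L * B * S \<xi>) * (B * exp (S \<xi>))"
      using K b0 abs_le_exp_abs[of "S \<xi>"] S0[of \<xi>] unfolding B_def by (intro mult_left_mono) auto
    also have "\<dots> = (K * B) * exp ((L * B + 1) * S \<xi>)"
      by (simp add: algebra_simps exp_add)
    finally show ?thesis .
  qed
  have dZ: "((\<lambda>\<theta>. Z \<theta> \<xi> a) has_real_derivative D \<theta> \<xi> a) (at \<theta>)" if "a \<in> A" for \<theta> \<xi> a
    unfolding Z_def D_def linear_field_def R_def R'_def using that
    by (auto intro!: derivative_eq_intros simp: algebra_simps)
  have cZ: "isCont (\<lambda>\<theta>. Z \<theta> \<xi> a) \<theta>" if "a \<in> A" for \<theta> \<xi> a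
    using dZ[OF that] DERIV_isCont by blast
  have cD: "isCont (\<lambda>\<theta>. D \<theta> \<xi> a) \<theta>" for \<theta> \<xi> a
    unfolding D_def linear_field_def R'_def by (cases "a \<in> A") (auto intro!: continuous_intros)
  have cg: "isCont (\<lambda>\<theta>. g \<theta> \<xi>) \<theta>" for \<theta> \<xi>
  proof -
    have "isCont (\<lambda>\<theta>. f1 a (Z \<theta> \<xi>)) \<theta>" if "a \<in> A" for a
      by (rule DERIV_isCont, rule has_gradientD[OF grad(2)[OF that], of "\<lambda>\<theta>. Z \<theta> \<xi>"], rule dZ)
    then show ?thesis
      unfolding g_def by (intro continuous_intros cD)
  qed
  have FTC: "(\<integral>\<theta>. g \<theta> \<xi> * indicator {0..pi/2} \<theta> \<partial>lborel) = f (Z (pi/2) \<xi>) - f (Z 0 \<xi>)" for \<xi>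
  proof (rule integral_FTC_Icc_real)
    show "((\<lambda>\<theta>. f (Z \<theta> \<xi>)) has_real_derivative g \<theta> \<xi>) (at \<theta>)" for \<theta>
      unfolding g_def by (rule has_gradientD[OF grad(1), of "\<lambda>\<theta>. Z \<theta> \<xi>"]) (rule dZ)
  qed (use cg in auto)

  have Zmeas: "(\<lambda>p. Z (snd p) (fst p)) \<in> measurable (gaussian I \<Otimes>\<^sub>M lborel) (PiM A (\<lambda>_. borel))"
    unfolding Z_def linear_field_def R_def by measurable
  have Dmeas: "(\<lambda>p. D (snd p) (fst p) a) \<in> borel_measurable (gaussian I \<Otimes>\<^sub>M lborel)" if "a \<in> A" for a
    using that unfolding D_def linear_field_def R'_def by simp measurable
  have gmeas[measurable]: "(\<lambda>p. g (snd p) (fst p)) \<in> borel_measurable (gaussian I \<Otimes>\<^sub>M lborel)"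
    unfolding g_def
    by (intro borel_measurable_sum borel_measurable_times Dmeas measurable_compose[OF Zmeas meas(2)])
  interpret G: prob_space "gaussian I" by (rule prob_space_gaussian)
  interpret GL: pair_sigma_finite "gaussian I" lborel by standard
  \<comment> \<open>The indicator turns the integral over the angle into one over the whole line,
    ready for Fubini; \<open>gb\<close> dominates uniformly in the angle.\<close>
  define h where "h p = g (snd p) (fst p) * indicator {0..pi/2} (snd p)" for p
  have hmeas[measurable]: "h \<in> borel_measurable (gaussian I \<Otimes>\<^sub>M lborel)"
    unfolding h_def by measurable
  have h_int1: "integrable lborel (\<lambda>\<theta>. h (\<xi>, \<theta>))" for \<xi>
  proof -
    have "integrable lborel (\<lambda>\<theta>. indicator {0..pi/2} \<theta> *\<^sub>R g \<theta> \<xi>)"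
      using cg by (intro borel_integrable_compact) (auto simp: continuous_at_imp_continuous_on)
    then show ?thesis
      by (simp add: h_def mult.commute)
  qed
  have hint: "integrable (gaussian I \<Otimes>\<^sub>M lborel) h"
  proof (rule GL.Fubini_integrable)
    show "integrable (gaussian I) (\<lambda>\<xi>. \<integral>\<theta>. norm (h (\<xi>, \<theta>)) \<partial>lborel)"
    proof (rule integrable_gaussian_growth[OF I])
      fix \<xi>
      have "(\<integral>\<theta>. norm (h (\<xi>, \<theta>)) \<partial>lborel)
          \<le> (\<integral>\<theta>. (K * B) * exp ((L * B + 1) * S \<xi>) * indicator {0..pi/2} \<theta> \<partial>lborel)"
      proof (rule integral_mono)
        show "integrable lborel (\<lambda>\<theta>. (K * B) * exp ((L * B + 1) * S \<xi>) * indicator {0..pi/2} \<theta>)"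
          by (intro integrable_mult_right integrable_real_indicator) auto
      qed (use gb h_int1 in \<open>auto simp: h_def split: split_indicator\<close>)
      also have "\<dots> = (K * B) * exp ((L * B + 1) * S \<xi>) * (pi / 2)"
        by simp
      finally show "\<bar>\<integral>\<theta>. norm (h (\<xi>, \<theta>)) \<partial>lborel\<bar> \<le> (K * B * (pi / 2)) * exp ((L * B + 1) * (\<Sum>k\<in>I. \<bar>\<xi> k\<bar>))"
        by (simp add: S_def algebra_simps)
    next
      have "(\<lambda>\<xi>. \<integral>\<theta>. norm (h (\<xi>, \<theta>)) \<partial>lborel) \<in> borel_measurable (gaussian I)"
        by measurable
      then show "(\<lambda>\<xi>. \<integral>\<theta>. norm (h (\<xi>, \<theta>)) \<partial>lborel) \<in> borel_measurable (PiM I (\<lambda>_. borel))"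
        by (simp cong: measurable_cong_sets)
    qed
  qed (use h_int1 in auto)

  have Zm[measurable]: "Z \<theta> \<in> measurable (PiM I (\<lambda>_. borel)) (PiM A (\<lambda>_. borel))" for \<theta>
    unfolding Z_def by measurable
  have slice: "(\<integral>\<xi>. g \<theta> \<xi> \<partial>gaussian I) \<le> 0" if \<theta>: "\<theta> \<in> {0..pi/2}" for \<theta>
  proof -
    have ibp: "integrable (gaussian I) (\<lambda>\<xi>. \<xi> k * f1 a (Z \<theta> \<xi>))"
      "(\<integral>\<xi>. \<xi> k * f1 a (Z \<theta> \<xi>) \<partial>gaussian I) = (\<integral>\<xi>. (\<Sum>c\<in>A. f2 a c (Z \<theta> \<xi>) * R \<theta> c k) \<partial>gaussian I)"
      if a: "a \<in> A" and k: "k \<in> I" for a k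
    proof -
      have m2: "(\<lambda>\<xi>. \<Sum>c\<in>A. f2 a c (Z \<theta> \<xi>) * R \<theta> c k) \<in> borel_measurable (PiM I (\<lambda>_. borel))"
        using measurable_compose[OF Zm meas(3)[OF a]] by (intro borel_measurable_sum borel_measurable_times) auto
      have m1: "(\<lambda>\<xi>. f1 a (Z \<theta> \<xi>)) \<in> borel_measurable (PiM I (\<lambda>_. borel))"
        using measurable_compose[OF Zm meas(2)[OF a]] .
      have dcurve: "((\<lambda>s. Z \<theta> (\<xi>(k := s)) c) has_real_derivative R \<theta> c k) (at s)" if "c \<in> A" for \<xi> s c
      proof -
        have "(\<lambda>s. Z \<theta> (\<xi>(k := s)) c) = (\<lambda>s. (\<Sum>j\<in>I-{k}. R \<theta> c j * \<xi> j) + R \<theta> c k * s)"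
          using that k I by (auto simp: Z_def linear_field_def sum.remove[of I k] intro!: sum.cong)
        then show ?thesis
          by (auto intro!: derivative_eq_intros)
      qed
      have ccurve: "isCont (\<lambda>s. Z \<theta> (\<xi>(k := s)) c) s" if "c \<in> A" for \<xi> s c
        using dcurve[OF that] DERIV_isCont by blast
      have bb: "\<bar>\<Sum>c\<in>A. f2 a c (Z \<theta> \<xi>) * R \<theta> c k\<bar> \<le> (K * (B + 1)) * exp (L * B * (\<Sum>k\<in>I. \<bar>\<xi> k\<bar>))" for \<xi>
      proof -
        have "\<bar>\<Sum>c\<in>A. f2 a c (Z \<theta> \<xi>) * R \<theta> c k\<bar> \<le> (\<Sum>c\<in>A. \<bar>f2 a c (Z \<theta> \<xi>)\<bar> * \<bar>R \<theta> c k\<bar>)"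
          unfolding abs_mult[symmetric] by (rule sum_abs)
        also have "\<dots> \<le> (\<Sum>c\<in>A. K * exp (L * B * S \<xi>) * b)"
          using a k by (intro sum_mono mult_mono f2b Rb) (auto simp: K)
        also have "\<dots> = (K * B) * exp (L * B * S \<xi>)"
          by (simp add: B_def)
        also have "\<dots> \<le> (K * (B + 1)) * exp (L * B * S \<xi>)"
          using K by (intro mult_right_mono mult_left_mono) auto
        finally show ?thesis by (simp add: S_def)
      qed
      have b1: "\<bar>f1 a (Z \<theta> \<xi>)\<bar> \<le> (K * (B + 1)) * exp (L * B * (\<Sum>k\<in>I. \<bar>\<xi> k\<bar>))" for \<xi>
      proof -
        have "K * exp (L * B * S \<xi>) \<le> (K * (B + 1)) * exp (L * B * S \<xi>)"
          using K b0 by (intro mult_right_mono) (auto simp: B_def algebra_simps)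
        then show ?thesis
          using f1b[OF a, of \<theta> \<xi>] by (simp add: S_def)
      qed
      have d1: "((\<lambda>s. f1 a (Z \<theta> (\<xi>(k := s)))) has_real_derivative
          (\<Sum>c\<in>A. f2 a c (Z \<theta> (\<xi>(k := s))) * R \<theta> c k)) (at s)" for \<xi> s
        by (rule has_gradientD[OF grad(2)[OF a], of "\<lambda>s. Z \<theta> (\<xi>(k := s))"]) (rule dcurve)
      have c2: "isCont (\<lambda>s. \<Sum>c\<in>A. f2 a c (Z \<theta> (\<xi>(k := s))) * R \<theta> c k) s" for \<xi> s
        by (intro continuous_intros continuous_alongD[OF cont[OF a], where z="\<lambda>s. Z \<theta> (\<xi>(k := s))"] ccurve)
      note IBP = gaussian_integration_by_parts[OF I k m1 m2 d1 c2 b1 bb]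
      show "integrable (gaussian I) (\<lambda>\<xi>. \<xi> k * f1 a (Z \<theta> \<xi>))"
        by (rule IBP(1))
      show "(\<integral>\<xi>. \<xi> k * f1 a (Z \<theta> \<xi>) \<partial>gaussian I) = (\<integral>\<xi>. (\<Sum>c\<in>A. f2 a c (Z \<theta> \<xi>) * R \<theta> c k) \<partial>gaussian I)"
        by (rule IBP(2))
    qed
    have f2int: "integrable (gaussian I) (\<lambda>\<xi>. f2 a c (Z \<theta> \<xi>))" if "a \<in> A" "c \<in> A" for a c
      by (rule integrable_gaussian_growth[OF I measurable_compose[OF Zm meas(3)[OF that]] f2b[OF that, unfolded S_def]])
    \<comment> \<open>The hypothesis \<open>disj\<close>, by which the two fields read different
      coordinates and are independent, enters here: it removes the terms with the squared sine and
      cosine and leaves the difference of the covariances.\<close>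
    have RR: "(\<Sum>k\<in>I. R' \<theta> a k * R \<theta> c k) = sin \<theta> * cos \<theta> * (\<Sum>k\<in>I. P a k * P c k - Q a k * Q c k)"
      if "a \<in> A" "c \<in> A" for a c
      unfolding sum_distrib_left
    proof (rule sum.cong[OF refl])
      fix k assume "k \<in> I"
      then have z: "P a k * Q c k = 0" "P c k * Q a k = 0"
        using disj that by auto
      have "R' \<theta> a k * R \<theta> c k = sin \<theta> * cos \<theta> * (P a k * P c k - Q a k * Q c k)
          + (cos \<theta>)\<^sup>2 * (P a k * Q c k) - (sin \<theta>)\<^sup>2 * (P c k * Q a k)"
        unfolding R_def R'_def by (simp add: algebra_simps power2_eq_square)
      then show "R' \<theta> a k * R \<theta> c k = sin \<theta> * cos \<theta> * (P a k * P c k - Q a k * Q c k)"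
        unfolding z by simp
    qed
    have "(\<integral>\<xi>. g \<theta> \<xi> \<partial>gaussian I) = (\<integral>\<xi>. (\<Sum>a\<in>A. \<Sum>k\<in>I. R' \<theta> a k * (\<xi> k * f1 a (Z \<theta> \<xi>))) \<partial>gaussian I)"
      unfolding g_def D_def linear_field_def
      by (intro Bochner_Integration.integral_cong refl sum.cong) (auto simp: sum_distrib_left algebra_simps)
    also have "\<dots> = (\<Sum>a\<in>A. \<Sum>k\<in>I. R' \<theta> a k * (\<integral>\<xi>. \<xi> k * f1 a (Z \<theta> \<xi>) \<partial>gaussian I))"
      using ibp(1) by (simp add: Bochner_Integration.integral_sum)
    also have "\<dots> = (\<Sum>a\<in>A. \<Sum>k\<in>I. R' \<theta> a k * (\<Sum>c\<in>A. (\<integral>\<xi>. f2 a c (Z \<theta> \<xi>) \<partial>gaussian I) * R \<theta> c k))"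
      using ibp(2) f2int by (intro sum.cong refl) (simp add: Bochner_Integration.integral_sum)
    also have "\<dots> = (\<Sum>a\<in>A. \<Sum>c\<in>A. (\<integral>\<xi>. f2 a c (Z \<theta> \<xi>) \<partial>gaussian I) * (\<Sum>k\<in>I. R' \<theta> a k * R \<theta> c k))"
      unfolding sum_distrib_left by (rule sum.cong[OF refl], subst sum.swap) (simp only: mult.left_commute)
    also have "\<dots> = sin \<theta> * cos \<theta> * (\<Sum>a\<in>A. \<Sum>c\<in>A. (\<integral>\<xi>. f2 a c (Z \<theta> \<xi>) \<partial>gaussian I) *
        (\<Sum>k\<in>I. P a k * P c k - Q a k * Q c k))"
      unfolding sum_distrib_left[of "sin \<theta> * cos \<theta>"] by (intro sum.cong refl) (simp add: RR mult.left_commute)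
    also have "\<dots> = sin \<theta> * cos \<theta> * (\<integral>\<xi>. (\<Sum>a\<in>A. \<Sum>c\<in>A. f2 a c (Z \<theta> \<xi>) *
        (\<Sum>k\<in>I. P a k * P c k - Q a k * Q c k)) \<partial>gaussian I)"
      using f2int by (simp add: Bochner_Integration.integral_sum)
    also have "\<dots> \<le> 0"
    proof (rule mult_nonneg_nonpos)
      show "0 \<le> sin \<theta> * cos \<theta>"
        using \<theta> pi_ge_two by (intro mult_nonneg_nonneg sin_ge_zero cos_ge_zero) auto
      show "(\<integral>\<xi>. (\<Sum>a\<in>A. \<Sum>c\<in>A. f2 a c (Z \<theta> \<xi>) *
        (\<Sum>k\<in>I. P a k * P c k - Q a k * Q c k)) \<partial>gaussian I) \<le> 0"
        by (rule integral_nonpos_real) (use cond in auto)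
    qed
    finally show ?thesis .
  qed
  have "(\<integral>\<xi>. f (Z (pi/2) \<xi>) - f (Z 0 \<xi>) \<partial>gaussian I) = (\<integral>\<xi>. (\<integral>\<theta>. h (\<xi>, \<theta>) \<partial>lborel) \<partial>gaussian I)"
    by (simp add: FTC[symmetric] h_def)
  also have "\<dots> = (\<integral>\<theta>. (\<integral>\<xi>. h (\<xi>, \<theta>) \<partial>gaussian I) \<partial>lborel)"
    using GL.Fubini_integral[of "\<lambda>\<xi> \<theta>. h (\<xi>, \<theta>)"] hint by simp
  also have "\<dots> \<le> 0"
    by (rule integral_nonpos_real) (use slice in \<open>auto simp: h_def indicator_def\<close>)
  finally have le: "(\<integral>\<xi>. f (Z (pi/2) \<xi>) - f (Z 0 \<xi>) \<partial>gaussian I) \<le> 0" .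
  have "R (pi/2) = P" "R 0 = Q"
    by (auto simp: R_def fun_eq_iff)
  then have Z: "Z (pi/2) = linear_field A I P" "Z 0 = linear_field A I Q"
    by (simp_all add: Z_def)
  show ?thesis
    using le integrable_linear_field[OF A I meas(1) growth(1) L] unfolding Z by simp
qed

section \<open>A smooth 1-Lipschitz violation functional\<close>

text \<open>An analytic majorant of \<open>(max 0 y)\<^sup>2\<close> whose square root has slope between 0 and 1, which makes
  \<open>viol\<close> below 1-Lipschitz.\<close>

definition softsq :: "real \<Rightarrow> real \<Rightarrow> real" where
  "softsq d y = ((y + sqrt (y\<^sup>2 + d\<^sup>2)) / 2)\<^sup>2"

text \<open>With \<open>r\<close> the square root of \<open>y^2 + d^2\<close> and
  \<open>u = (y + r) / 2\<close> one has \<open>u' = u / r\<close>, hence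
  \<open>(u^2)' = 2 * u^2 / r\<close>. Writing the derivatives of \<open>softsq\<close> through
  \<open>softsq\<close> itself reduces their bounds to the ratio
  \<open>softsq / r^2\<close>.\<close>

definition softsq1 :: "real \<Rightarrow> real \<Rightarrow> real" where
  "softsq1 d y = 2 * softsq d y / sqrt (y\<^sup>2 + d\<^sup>2)"

definition softsq2 :: "real \<Rightarrow> real \<Rightarrow> real" where
  "softsq2 d y = 4 * softsq d y / (sqrt (y\<^sup>2 + d\<^sup>2))\<^sup>2 - 2 * softsq d y * y / (sqrt (y\<^sup>2 + d\<^sup>2)) ^ 3"

lemma sqrt_sq_add_pos:
  fixes d y :: real
  assumes "0 < d"
  shows "0 < sqrt (y\<^sup>2 + d\<^sup>2)"
proof -
  have "0 < y\<^sup>2 + d\<^sup>2"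
    using assms by (intro add_nonneg_pos) auto
  then show ?thesis
    by (simp only: real_sqrt_gt_0_iff)
qed

lemma abs_le_sqrt_sq_add: "\<bar>y\<bar> \<le> sqrt (y\<^sup>2 + d\<^sup>2)" for d y :: real
  by (rule real_le_rsqrt) simp

lemma DERIV_sqrt_sq_add:
  assumes "0 < d"
  shows "((\<lambda>y. sqrt (y\<^sup>2 + d\<^sup>2)) has_real_derivative y / sqrt (y\<^sup>2 + d\<^sup>2)) (at y)"
proof -
  have pos: "0 < y\<^sup>2 + d\<^sup>2"
    using assms by (intro add_nonneg_pos) auto
  have "((\<lambda>y. y\<^sup>2 + d\<^sup>2) has_real_derivative 2 * y) (at y)"
    by (auto intro!: derivative_eq_intros)
  from DERIV_chain2[OF DERIV_real_sqrt[OF pos] this] show ?thesis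
    by (simp add: field_simps)
qed

lemma DERIV_softsq:
  assumes "0 < d"
  shows "(softsq d has_real_derivative softsq1 d y) (at y)"
proof -
  define R where "R y = sqrt (y\<^sup>2 + d\<^sup>2)" for y
  have r: "0 < R y"
    using sqrt_sq_add_pos[OF assms] by (simp add: R_def)
  have dR: "(R has_real_derivative y / R y) (at y)"
    unfolding R_def by (rule DERIV_sqrt_sq_add[OF assms])
  have "((\<lambda>y. ((y + R y) / 2)\<^sup>2) has_real_derivative 2 * ((y + R y) / 2) * ((1 + y / R y) / 2)) (at y)"
    using r by (auto intro!: derivative_eq_intros dR simp: field_simps)
  moreover have "2 * ((y + R y) / 2) * ((1 + y / R y) / 2) = softsq1 d y"
    using r unfolding softsq1_def softsq_def R_def[symmetric]
    by (simp add: field_simps power2_eq_square)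
  moreover have "(\<lambda>y. ((y + R y) / 2)\<^sup>2) = softsq d"
    by (simp add: softsq_def R_def fun_eq_iff)
  ultimately show ?thesis
    by simp
qed

lemma DERIV_softsq1:
  assumes "0 < d"
  shows "(softsq1 d has_real_derivative softsq2 d y) (at y)"
proof -
  define R where "R y = sqrt (y\<^sup>2 + d\<^sup>2)" for y
  have r: "0 < R y"
    using sqrt_sq_add_pos[OF assms] by (simp add: R_def)
  have dR: "(R has_real_derivative y / R y) (at y)"
    unfolding R_def by (rule DERIV_sqrt_sq_add[OF assms])
  have "((\<lambda>y. 2 * softsq d y / R y) has_real_derivative
      (2 * softsq1 d y * R y - 2 * softsq d y * (y / R y)) / (R y * R y)) (at y)"
    using r by (intro DERIV_divide dR DERIV_cmult DERIV_softsq[OF assms]) auto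
  moreover have "(2 * softsq1 d y * R y - 2 * softsq d y * (y / R y)) / (R y * R y) = softsq2 d y"
    using r unfolding softsq1_def softsq2_def R_def[symmetric]
    by (simp add: field_simps power2_eq_square power3_eq_cube)
  moreover have "(\<lambda>y. 2 * softsq d y / R y) = softsq1 d"
    by (simp add: softsq1_def R_def fun_eq_iff)
  ultimately show ?thesis
    by simp
qed

lemma softsq_nonneg [simp]: "0 \<le> softsq d y"
  by (simp add: softsq_def)

lemma softsq_le:
  assumes "0 < d"
  shows "softsq d y \<le> (sqrt (y\<^sup>2 + d\<^sup>2))\<^sup>2"
proof -
  have "y \<le> sqrt (y\<^sup>2 + d\<^sup>2)" "- y \<le> sqrt (y\<^sup>2 + d\<^sup>2)"
    using abs_le_sqrt_sq_add[of y d] by linarith+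
  then have "\<bar>(y + sqrt (y\<^sup>2 + d\<^sup>2)) / 2\<bar> \<le> sqrt (y\<^sup>2 + d\<^sup>2)"
    by (simp add: abs_le_iff field_simps)
  then show ?thesis
    unfolding softsq_def by (metis abs_ge_zero power2_abs power_mono)
qed

text \<open>As \<open>softsq1\<close> is \<open>2 * softsq / r\<close>, everything reduces to
  \<open>softsq_le\<close>. This is the one-variable Lipschitz bound from which
  \<open>sum_viol1_sq\<close> is assembled.\<close>

lemma softsq1_sq_le:
  assumes "0 < d"
  shows "(softsq1 d y)\<^sup>2 \<le> 4 * softsq d y"
proof -
  let ?r = "sqrt (y\<^sup>2 + d\<^sup>2)"
  have r: "0 < ?r\<^sup>2"
    using sqrt_sq_add_pos[OF assms, of y] by (rule zero_less_power)
  have "(softsq1 d y)\<^sup>2 = 4 * softsq d y * (softsq d y / ?r\<^sup>2)"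
    unfolding softsq1_def by (simp add: power_divide power_mult_distrib power2_eq_square)
  also have "\<dots> \<le> 4 * softsq d y * 1"
    using softsq_le[OF assms, of y] r by (intro mult_left_mono) (auto simp: divide_le_eq_1)
  finally show ?thesis by simp
qed

lemma abs_softsq2_le:
  assumes "0 < d"
  shows "\<bar>softsq2 d y\<bar> \<le> 6"
proof -
  let ?r = "sqrt (y\<^sup>2 + d\<^sup>2)"
  have r: "0 < ?r" "0 < ?r\<^sup>2"
    using sqrt_sq_add_pos[OF assms, of y] by auto
  \<comment> \<open>Everything is expressed by \<open>u\<close> in [0, 1] and \<open>y / r\<close>
    in [-1, 1], whence the constant 6 = 4 + 2.\<close>
  define u where "u = softsq d y / ?r\<^sup>2"
  have u: "0 \<le> u" "u \<le> 1"
    using softsq_le[OF assms, of y] r unfolding u_def by (auto simp: divide_le_eq_1)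
  have "\<bar>y\<bar> \<le> ?r"
    by (rule abs_le_sqrt_sq_add)
  then have v: "\<bar>y / ?r\<bar> \<le> 1"
    using r by (simp add: divide_le_eq_1)
  have "softsq2 d y = 4 * u - 2 * (u * (y / ?r))"
    unfolding softsq2_def u_def by (simp add: power2_eq_square power3_eq_cube)
  moreover have "\<bar>u * (y / ?r)\<bar> \<le> 1"
    unfolding abs_mult using u v by (intro mult_le_one) auto
  ultimately show ?thesis
    using u by linarith
qed

lemma max_sq_le_softsq: "(max 0 y)\<^sup>2 \<le> softsq d y"
proof -
  have "y \<le> sqrt (y\<^sup>2 + d\<^sup>2)" "- y \<le> sqrt (y\<^sup>2 + d\<^sup>2)"
    using abs_le_sqrt_sq_add[of y d] by linarith+
  then have "max 0 y \<le> (y + sqrt (y\<^sup>2 + d\<^sup>2)) / 2"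
    by (simp add: max_def field_simps)
  then show ?thesis
    unfolding softsq_def by (intro power_mono) auto
qed

text \<open>The cost of smoothing: a constraint missed by at most \<open>d\<close> contributes only
  order \<open>d^2\<close>, so the smoothed functional vanishes with \<open>d\<close> at feasible
  points.\<close>

lemma softsq_le_of_le:
  assumes "y \<le> d" "0 < d"
  shows "softsq d y \<le> 4 * d\<^sup>2"
proof -
  have "y + sqrt (y\<^sup>2 + d\<^sup>2) \<le> 4 * d \<and> 0 \<le> y + sqrt (y\<^sup>2 + d\<^sup>2)"
  proof (cases "y \<ge> 0")
    case True
    have "sqrt (y\<^sup>2 + d\<^sup>2) \<le> y + d"
      using True assms by (intro real_le_lsqrt) (auto simp: power2_sum)
    with True assms show ?thesis by auto
  next
    case False
    have "sqrt (y\<^sup>2 + d\<^sup>2) \<le> - y + d"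
      using False assms by (intro real_le_lsqrt) (auto simp: power2_diff mult_nonneg_nonpos)
    moreover have "- y \<le> sqrt (y\<^sup>2 + d\<^sup>2)"
      by (rule real_le_rsqrt) simp
    ultimately show ?thesis using assms by auto
  qed
  then have "((y + sqrt (y\<^sup>2 + d\<^sup>2)) / 2)\<^sup>2 \<le> (2 * d)\<^sup>2"
    by (intro power_mono) auto
  then show ?thesis
    by (simp add: softsq_def power_mult_distrib)
qed

section \<open>The violation functional and its first two derivatives\<close>

text \<open>The extra \<open>d^2\<close> under the root keeps the functional at least
  \<open>d\<close>, uniformly in \<open>v\<close>, which bounds the quotients in its
  derivatives.\<close>

definition viol :: "nat \<Rightarrow> real \<Rightarrow> real \<Rightarrow> (nat \<Rightarrow> real) \<Rightarrow> real" where
  "viol m \<kappa> d v = sqrt (d\<^sup>2 + (\<Sum>i<m. softsq d (v i + \<kappa>)))"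

definition viol1 :: "nat \<Rightarrow> real \<Rightarrow> real \<Rightarrow> nat \<Rightarrow> (nat \<Rightarrow> real) \<Rightarrow> real" where
  "viol1 m \<kappa> d i v = softsq1 d (v i + \<kappa>) / (2 * viol m \<kappa> d v)"

definition viol2 :: "nat \<Rightarrow> real \<Rightarrow> real \<Rightarrow> nat \<Rightarrow> nat \<Rightarrow> (nat \<Rightarrow> real) \<Rightarrow> real" where
  "viol2 m \<kappa> d i j v = (if i = j then softsq2 d (v i + \<kappa>) / (2 * viol m \<kappa> d v) else 0)
     - viol1 m \<kappa> d i v * viol1 m \<kappa> d j v / viol m \<kappa> d v"

lemma viol_ge: "0 < d \<Longrightarrow> d \<le> viol m \<kappa> d v"
  unfolding viol_def by (rule real_le_rsqrt) (auto intro: sum_nonneg)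

lemma viol_pos: "0 < d \<Longrightarrow> 0 < viol m \<kappa> d v"
  using viol_ge[of d m \<kappa> v] by linarith

lemma viol_sq: "(viol m \<kappa> d v)\<^sup>2 = d\<^sup>2 + (\<Sum>i<m. softsq d (v i + \<kappa>))"
  unfolding viol_def by (rule real_sqrt_pow2, intro add_nonneg_nonneg sum_nonneg) auto

lemma DERIV_viol:
  assumes d: "0 < d" and z: "\<And>i. i < m \<Longrightarrow> ((\<lambda>s. z s i) has_real_derivative z' i) (at s)"
  shows "((\<lambda>s. viol m \<kappa> d (z s)) has_real_derivative (\<Sum>i<m. viol1 m \<kappa> d i (z s) * z' i)) (at s)"
proof -
  have D: "((\<lambda>s. softsq d (z s i + \<kappa>)) has_real_derivative softsq1 d (z s i + \<kappa>) * z' i) (at s)" if "i < m" for i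
    by (rule DERIV_chain2[OF DERIV_softsq[OF d]]) (auto intro!: derivative_eq_intros z that)
  have pos: "0 < d\<^sup>2 + (\<Sum>i<m. softsq d (z s i + \<kappa>))"
    using d by (intro add_pos_nonneg sum_nonneg) auto
  have "((\<lambda>s. d\<^sup>2 + (\<Sum>i<m. softsq d (z s i + \<kappa>))) has_real_derivative
      (\<Sum>i<m. softsq1 d (z s i + \<kappa>) * z' i)) (at s)"
    by (auto intro!: derivative_eq_intros D)
  from DERIV_chain2[OF DERIV_real_sqrt[OF pos] this] show ?thesis
    unfolding viol_def viol1_def by (simp add: sum_divide_distrib field_simps)
qed

lemma DERIV_viol1:
  assumes d: "0 < d" and z: "\<And>i. i < m \<Longrightarrow> ((\<lambda>s. z s i) has_real_derivative z' i) (at s)" and i: "i < m"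
  shows "((\<lambda>s. viol1 m \<kappa> d i (z s)) has_real_derivative (\<Sum>j<m. viol2 m \<kappa> d i j (z s) * z' j)) (at s)"
proof -
  have D: "((\<lambda>s. softsq1 d (z s i + \<kappa>)) has_real_derivative softsq2 d (z s i + \<kappa>) * z' i) (at s)"
    by (rule DERIV_chain2[OF DERIV_softsq1[OF d]]) (auto intro!: derivative_eq_intros z i)
  let ?V = "viol m \<kappa> d (z s)" and ?V' = "\<Sum>j<m. viol1 m \<kappa> d j (z s) * z' j"
  have V: "0 < ?V" by (rule viol_pos[OF d])
  have "((\<lambda>s. softsq1 d (z s i + \<kappa>) / (2 * viol m \<kappa> d (z s))) has_real_derivative
     (softsq2 d (z s i + \<kappa>) * z' i * (2 * ?V) - softsq1 d (z s i + \<kappa>) * (2 * ?V')) / ((2 * ?V) * (2 * ?V))) (at s)"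
    using V by (intro DERIV_divide D DERIV_cmult DERIV_viol[OF d z]) auto
  moreover have "(softsq2 d (z s i + \<kappa>) * z' i * (2 * v) - softsq1 d (z s i + \<kappa>) * (2 * w)) / ((2 * v) * (2 * v))
      = softsq2 d (z s i + \<kappa>) * z' i / (2 * v) - (softsq1 d (z s i + \<kappa>) / (2 * v)) / v * w" if "0 < v" for v w
    using that by (simp add: field_simps)
  ultimately have "((\<lambda>s. viol1 m \<kappa> d i (z s)) has_real_derivative
     softsq2 d (z s i + \<kappa>) * z' i / (2 * ?V) - viol1 m \<kappa> d i (z s) / ?V * ?V') (at s)"
    using V unfolding viol1_def[of m \<kappa> d i] by simp
  moreover have "softsq2 d (z s i + \<kappa>) * z' i / (2 * ?V) =
     (\<Sum>j<m. (if i = j then softsq2 d (z s i + \<kappa>) / (2 * ?V) else 0) * z' j)"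
    using i by (simp add: if_distrib[of "\<lambda>x. x * _"] cong: if_cong)
  moreover have "viol1 m \<kappa> d i (z s) / ?V * ?V' = (\<Sum>j<m. viol1 m \<kappa> d i (z s) * viol1 m \<kappa> d j (z s) / ?V * z' j)"
    unfolding sum_distrib_left by (intro sum.cong refl) simp
  ultimately show ?thesis
    by (simp add: viol2_def sum_subtractf left_diff_distrib)
qed

text \<open>Each squared \<open>softsq1\<close> is at most \<open>4 * softsq\<close>, and the
  \<open>softsq\<close> sum to at most the square of \<open>viol\<close>. Hence the gradient has
  length at most 1, which makes \<open>viol\<close> 1-Lipschitz for the Euclidean norm.\<close>

lemma sum_viol1_sq:
  assumes d: "0 < d"
  shows "(\<Sum>i<m. (viol1 m \<kappa> d i v)\<^sup>2) \<le> 1"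
proof -
  let ?V = "viol m \<kappa> d v"
  have V: "0 < ?V" by (rule viol_pos[OF d])
  have "(\<Sum>i<m. (viol1 m \<kappa> d i v)\<^sup>2) = (\<Sum>i<m. (softsq1 d (v i + \<kappa>))\<^sup>2) / (4 * ?V\<^sup>2)"
    by (simp add: viol1_def power_divide power_mult_distrib sum_divide_distrib)
  also have "\<dots> \<le> (\<Sum>i<m. 4 * softsq d (v i + \<kappa>)) / (4 * ?V\<^sup>2)"
    by (intro divide_right_mono sum_mono softsq1_sq_le d) auto
  also have "\<dots> = (\<Sum>i<m. softsq d (v i + \<kappa>)) / ?V\<^sup>2"
    by (simp add: sum_distrib_left[symmetric])
  also have "\<dots> \<le> 1"
  proof -
    have "(\<Sum>i<m. softsq d (v i + \<kappa>)) \<le> ?V\<^sup>2"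
      by (simp add: viol_sq)
    then show ?thesis
      using zero_less_power[OF V, of 2] by (simp only: divide_le_eq_1_pos)
  qed
  finally show ?thesis .
qed

lemma abs_viol1_le:
  assumes "0 < d" "i < m"
  shows "\<bar>viol1 m \<kappa> d i v\<bar> \<le> 1"
proof -
  have "(viol1 m \<kappa> d i v)\<^sup>2 \<le> (\<Sum>i<m. (viol1 m \<kappa> d i v)\<^sup>2)"
    using assms by (intro member_le_sum) auto
  then have "(viol1 m \<kappa> d i v)\<^sup>2 \<le> 1"
    using sum_viol1_sq[OF assms(1)] by (rule order_trans)
  then show ?thesis
    by (simp add: abs_square_le_1)
qed

text \<open>The diagonal term gives \<open>3 / d\<close>, the product of first derivatives
  \<open>1 / d\<close>. That this explodes as \<open>d\<close> tends to 0 does no harm: it feeds the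
  growth condition of the interpolation and leaves no trace in the inequality obtained
  there.\<close>

lemma abs_viol2_le:
  assumes d: "0 < d" and ij: "i < m" "j < m"
  shows "\<bar>viol2 m \<kappa> d i j v\<bar> \<le> 4 / d"
proof -
  let ?V = "viol m \<kappa> d v"
  have V: "0 < ?V" "d \<le> ?V" by (rule viol_pos[OF d], rule viol_ge[OF d])
  have *: "\<bar>softsq2 d (v i + \<kappa>) / (2 * ?V)\<bar> \<le> 6 / (2 * d)"
    unfolding abs_divide using V d abs_softsq2_le[OF d] by (intro frac_le) auto
  have "\<bar>if i = j then softsq2 d (v i + \<kappa>) / (2 * ?V) else 0\<bar> \<le> 6 / (2 * d)"
  proof (cases "i = j")
    case True
    show ?thesis
      using * unfolding if_P[OF True] .
  qed (use d in simp)
  moreover have "\<bar>viol1 m \<kappa> d i v * viol1 m \<kappa> d j v\<bar> \<le> 1"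
    unfolding abs_mult by (intro mult_le_one abs_viol1_le d ij) auto
  then have "\<bar>viol1 m \<kappa> d i v * viol1 m \<kappa> d j v / ?V\<bar> \<le> 1 / d"
    unfolding abs_divide using V d by (intro frac_le) auto
  moreover have "6 / (2 * d) + 1 / d = 4 / d"
    using d by (simp add: field_simps)
  ultimately show ?thesis
    unfolding viol2_def by linarith
qed

text \<open>The coordinate \<open>m\<close> carries the scalar part of the field.\<close>

definition weight :: "nat \<Rightarrow> real \<Rightarrow> real \<Rightarrow> real \<Rightarrow> (nat \<Rightarrow> real) \<Rightarrow> real" where
  "weight m \<kappa> d b v = exp (- b * (viol m \<kappa> d v + v m))"

text \<open>The gradient of the exponent \<open>viol + v m\<close>: its first \<open>m\<close>
  entries form a vector of length at most 1, and the last entry is exactly 1, so that it can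
  outweigh the others.\<close>

definition slope :: "nat \<Rightarrow> real \<Rightarrow> real \<Rightarrow> nat \<Rightarrow> (nat \<Rightarrow> real) \<Rightarrow> real" where
  "slope m \<kappa> d i v = (if i < m then viol1 m \<kappa> d i v else 1)"

definition weight1 :: "nat \<Rightarrow> real \<Rightarrow> real \<Rightarrow> real \<Rightarrow> nat \<Rightarrow> (nat \<Rightarrow> real) \<Rightarrow> real" where
  "weight1 m \<kappa> d b i v = - b * slope m \<kappa> d i v * weight m \<kappa> d b v"

definition weight2 :: "nat \<Rightarrow> real \<Rightarrow> real \<Rightarrow> real \<Rightarrow> nat \<Rightarrow> nat \<Rightarrow> (nat \<Rightarrow> real) \<Rightarrow> real" where
  "weight2 m \<kappa> d b i j v =
     (b\<^sup>2 * slope m \<kappa> d i v * slope m \<kappa> d j v - b * (if i < m \<and> j < m then viol2 m \<kappa> d i j v else 0))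
     * weight m \<kappa> d b v"

lemma weight_pos: "0 < weight m \<kappa> d b v"
  by (simp add: weight_def)

lemma has_gradient_weight:
  assumes d: "0 < d"
  shows "has_gradient {..m} (weight m \<kappa> d b) (weight1 m \<kappa> d b)"
  unfolding has_gradient_def
proof (intro allI impI)
  fix z :: "real \<Rightarrow> nat \<Rightarrow> real" and z' s
  assume z: "\<forall>a\<in>{..m}. ((\<lambda>s. z s a) has_real_derivative z' a) (at s)"
  have "((\<lambda>s. viol m \<kappa> d (z s)) has_real_derivative (\<Sum>i<m. viol1 m \<kappa> d i (z s) * z' i)) (at s)"
    by (rule DERIV_viol[OF d]) (use z in auto)
  moreover have "((\<lambda>s. z s m) has_real_derivative z' m) (at s)"
    using z by auto
  ultimately have "((\<lambda>s. weight m \<kappa> d b (z s)) has_real_derivative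
      weight m \<kappa> d b (z s) * (- b * ((\<Sum>i<m. viol1 m \<kappa> d i (z s) * z' i) + z' m))) (at s)"
    unfolding weight_def by (auto intro!: derivative_eq_intros)
  moreover have "(\<Sum>i<m. viol1 m \<kappa> d i (z s) * z' i) + z' m = (\<Sum>i\<le>m. slope m \<kappa> d i (z s) * z' i)"
    by (simp add: slope_def lessThan_Suc_atMost[symmetric])
  moreover have "weight m \<kappa> d b (z s) * (- b * (\<Sum>i\<le>m. slope m \<kappa> d i (z s) * z' i)) =
      (\<Sum>i\<le>m. weight1 m \<kappa> d b i (z s) * z' i)"
    unfolding sum_distrib_left by (intro sum.cong refl) (simp add: weight1_def)
  ultimately show "((\<lambda>s. weight m \<kappa> d b (z s)) has_real_derivative
      (\<Sum>i\<le>m. weight1 m \<kappa> d b i (z s) * z' i)) (at s)"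
    by (simp only:)
qed

lemma has_gradient_weight1:
  assumes d: "0 < d" and i: "i \<le> m"
  shows "has_gradient {..m} (weight1 m \<kappa> d b i) (weight2 m \<kappa> d b i)"
  unfolding has_gradient_def
proof (intro allI impI)
  fix z :: "real \<Rightarrow> nat \<Rightarrow> real" and z' s
  assume z: "\<forall>a\<in>{..m}. ((\<lambda>s. z s a) has_real_derivative z' a) (at s)"
  let ?V2 = "\<lambda>j. if i < m \<and> j < m then viol2 m \<kappa> d i j (z s) else 0"
  have "((\<lambda>s. weight m \<kappa> d b (z s)) has_real_derivative (\<Sum>j\<le>m. weight1 m \<kappa> d b j (z s) * z' j)) (at s)"
    by (rule has_gradientD[OF has_gradient_weight[OF d]]) (use z in auto)
  moreover have "((\<lambda>s. slope m \<kappa> d i (z s)) has_real_derivative (\<Sum>j\<le>m. ?V2 j * z' j)) (at s)"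
  proof (cases "i < m")
    case True
    have "((\<lambda>s. viol1 m \<kappa> d i (z s)) has_real_derivative (\<Sum>j<m. viol2 m \<kappa> d i j (z s) * z' j)) (at s)"
      by (rule DERIV_viol1[OF d _ True]) (use z in auto)
    then show ?thesis
      using True by (simp add: slope_def lessThan_Suc_atMost[symmetric])
  qed (simp add: slope_def)
  ultimately have "((\<lambda>s. weight1 m \<kappa> d b i (z s)) has_real_derivative
     - b * (\<Sum>j\<le>m. ?V2 j * z' j) * weight m \<kappa> d b (z s)
     + (\<Sum>j\<le>m. weight1 m \<kappa> d b j (z s) * z' j) * (- b * slope m \<kappa> d i (z s))) (at s)"
    unfolding weight1_def[of m \<kappa> d b i] by (auto intro!: derivative_eq_intros simp: algebra_simps)
  also have "- b * (\<Sum>j\<le>m. ?V2 j * z' j) * weight m \<kappa> d b (z s)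
     + (\<Sum>j\<le>m. weight1 m \<kappa> d b j (z s) * z' j) * (- b * slope m \<kappa> d i (z s)) =
     (\<Sum>j\<le>m. weight2 m \<kappa> d b i j (z s) * z' j)"
    unfolding weight1_def weight2_def sum_distrib_left sum_distrib_right sum.distrib[symmetric]
    by (intro sum.cong refl) (simp add: algebra_simps power2_eq_square)
  finally show "((\<lambda>s. weight1 m \<kappa> d b i (z s)) has_real_derivative
      (\<Sum>j\<le>m. weight2 m \<kappa> d b i j (z s) * z' j)) (at s)" .
qed

lemma abs_slope_le: "0 < d \<Longrightarrow> \<bar>slope m \<kappa> d i v\<bar> \<le> 1"
  by (auto simp: slope_def abs_viol1_le)

lemma abs_weight1_le:
  assumes "0 < d" "0 \<le> b"
  shows "\<bar>weight1 m \<kappa> d b i v\<bar> \<le> b * weight m \<kappa> d b v"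
proof -
  have "b * weight m \<kappa> d b v * \<bar>slope m \<kappa> d i v\<bar> \<le> b * weight m \<kappa> d b v * 1"
    using assms weight_pos[of m \<kappa> d b v] by (intro mult_left_mono abs_slope_le) auto
  then show ?thesis
    using assms weight_pos[of m \<kappa> d b v] by (simp add: weight1_def abs_mult mult_ac)
qed

lemma abs_weight2_le:
  assumes d: "0 < d" and b: "0 \<le> b"
  shows "\<bar>weight2 m \<kappa> d b i j v\<bar> \<le> (b\<^sup>2 + b * (4 / d)) * weight m \<kappa> d b v"
proof -
  have "\<bar>slope m \<kappa> d i v * slope m \<kappa> d j v\<bar> \<le> 1"
    unfolding abs_mult by (intro mult_le_one abs_slope_le d) auto
  then have "\<bar>b\<^sup>2 * slope m \<kappa> d i v * slope m \<kappa> d j v\<bar> \<le> b\<^sup>2"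
    using mult_left_mono[of _ 1 "b\<^sup>2"] by (simp add: abs_mult mult.assoc)
  moreover have "\<bar>b * (if i < m \<and> j < m then viol2 m \<kappa> d i j v else 0)\<bar> \<le> b * (4 / d)"
    unfolding abs_mult using abs_viol2_le[OF d] b d by (intro mult_mono) auto
  ultimately have "\<bar>b\<^sup>2 * slope m \<kappa> d i v * slope m \<kappa> d j v
      - b * (if i < m \<and> j < m then viol2 m \<kappa> d i j v else 0)\<bar> \<le> b\<^sup>2 + b * (4 / d)"
    by linarith
  then show ?thesis
    unfolding weight2_def abs_mult[of _ "weight m \<kappa> d b v"] using weight_pos[of m \<kappa> d b v]
    by (intro mult_mono) auto
qed

text \<open>Without the common positive factor this is the bound 1 for the inner product of two
  gradients of \<open>viol\<close>, which follows from \<open>sum_viol1_sq\<close> and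
  \<open>2 * s * t \<le> s^2 + t^2\<close>. Here the 1-Lipschitz property enters the comparison: the
  scalar coordinate outweighs all \<open>m\<close> rows together.\<close>

lemma sum_weight1_le:
  assumes d: "0 < d"
  shows "(\<Sum>i<m. weight1 m \<kappa> d b i v * weight1 m \<kappa> d b i w)
    \<le> weight1 m \<kappa> d b m v * weight1 m \<kappa> d b m w"
proof -
  have "(\<Sum>i<m. viol1 m \<kappa> d i v * viol1 m \<kappa> d i w)
      \<le> (\<Sum>i<m. ((viol1 m \<kappa> d i v)\<^sup>2 + (viol1 m \<kappa> d i w)\<^sup>2) / 2)"
  proof (rule sum_mono)
    fix i
    show "viol1 m \<kappa> d i v * viol1 m \<kappa> d i w \<le> ((viol1 m \<kappa> d i v)\<^sup>2 + (viol1 m \<kappa> d i w)\<^sup>2) / 2"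
      using sum_squares_bound[of "viol1 m \<kappa> d i v" "viol1 m \<kappa> d i w"] by simp
  qed
  also have "\<dots> \<le> 1"
    using sum_viol1_sq[OF d, of m \<kappa> v] sum_viol1_sq[OF d, of m \<kappa> w]
    by (simp add: sum_divide_distrib[symmetric] sum.distrib)
  finally have 1: "(\<Sum>i<m. viol1 m \<kappa> d i v * viol1 m \<kappa> d i w) \<le> 1" .
  have "(\<Sum>i<m. weight1 m \<kappa> d b i v * weight1 m \<kappa> d b i w) =
      (b\<^sup>2 * weight m \<kappa> d b v * weight m \<kappa> d b w) * (\<Sum>i<m. viol1 m \<kappa> d i v * viol1 m \<kappa> d i w)"
    unfolding sum_distrib_left
    by (intro sum.cong refl) (simp add: weight1_def slope_def power2_eq_square)
  also have "\<dots> \<le> (b\<^sup>2 * weight m \<kappa> d b v * weight m \<kappa> d b w) * 1"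
    using weight_pos[of m \<kappa> d b] by (intro mult_left_mono[OF 1] mult_nonneg_nonneg) (auto simp: less_imp_le)
  also have "\<dots> = weight1 m \<kappa> d b m v * weight1 m \<kappa> d b m w"
    by (simp add: weight1_def slope_def power2_eq_square)
  finally show ?thesis .
qed

section \<open>Gordon's comparison inequality\<close>

lemma measurable_softsq [measurable]:
  "softsq d \<in> borel_measurable borel" "softsq1 d \<in> borel_measurable borel"
  "softsq2 d \<in> borel_measurable borel"
  unfolding softsq2_def softsq1_def softsq_def by measurable

text \<open>Only coordinates below \<open>m\<close> are read, so \<open>g\<close> is assumed
  measurable only there. A general family \<open>g\<close> also covers the slices
  \<open>z (x, i)\<close> of a field indexed by \<open>X\<close> and \<open>{..m}\<close>.\<close>

lemma measurable_viol:
  assumes [measurable]: "\<And>i. i < m \<Longrightarrow> g i \<in> borel_measurable N"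
  shows "(\<lambda>\<omega>. viol m \<kappa> d (\<lambda>i. g i \<omega>)) \<in> borel_measurable N"
  unfolding viol_def by measurable

lemma measurable_viol1:
  assumes [measurable]: "\<And>i. i < m \<Longrightarrow> g i \<in> borel_measurable N" and "i < m"
  shows "(\<lambda>\<omega>. viol1 m \<kappa> d i (\<lambda>i. g i \<omega>)) \<in> borel_measurable N"
proof -
  have [measurable]: "(\<lambda>\<omega>. viol m \<kappa> d (\<lambda>i. g i \<omega>)) \<in> borel_measurable N" "g i \<in> borel_measurable N"
    using assms by (auto intro: measurable_viol)
  show ?thesis
    unfolding viol1_def by measurable
qed

lemma measurable_viol2:
  assumes [measurable]: "\<And>i. i < m \<Longrightarrow> g i \<in> borel_measurable N" and "i < m" "j < m"
  shows "(\<lambda>\<omega>. viol2 m \<kappa> d i j (\<lambda>i. g i \<omega>)) \<in> borel_measurable N"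
proof -
  have [measurable]: "(\<lambda>\<omega>. viol m \<kappa> d (\<lambda>i. g i \<omega>)) \<in> borel_measurable N" "g i \<in> borel_measurable N"
    "(\<lambda>\<omega>. viol1 m \<kappa> d i (\<lambda>i. g i \<omega>)) \<in> borel_measurable N"
    "(\<lambda>\<omega>. viol1 m \<kappa> d j (\<lambda>i. g i \<omega>)) \<in> borel_measurable N"
    using assms by (auto intro: measurable_viol measurable_viol1)
  show ?thesis
    unfolding viol2_def by measurable
qed

lemma measurable_weight:
  assumes [measurable]: "\<And>i. i \<le> m \<Longrightarrow> g i \<in> borel_measurable N"
  shows "(\<lambda>\<omega>. weight m \<kappa> d b (\<lambda>i. g i \<omega>)) \<in> borel_measurable N"
proof -
  have [measurable]: "(\<lambda>\<omega>. viol m \<kappa> d (\<lambda>i. g i \<omega>)) \<in> borel_measurable N"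
    by (rule measurable_viol) auto
  show ?thesis
    unfolding weight_def by measurable
qed

lemma measurable_slope:
  assumes "\<And>i. i \<le> m \<Longrightarrow> g i \<in> borel_measurable N"
  shows "(\<lambda>\<omega>. slope m \<kappa> d i (\<lambda>i. g i \<omega>)) \<in> borel_measurable N"
  using assms unfolding slope_def by (cases "i < m") (auto intro: measurable_viol1)

lemma measurable_weight1:
  assumes "\<And>i. i \<le> m \<Longrightarrow> g i \<in> borel_measurable N"
  shows "(\<lambda>\<omega>. weight1 m \<kappa> d b i (\<lambda>i. g i \<omega>)) \<in> borel_measurable N"
  unfolding weight1_def
  by (intro borel_measurable_times borel_measurable_const measurable_slope measurable_weight assms)

lemma measurable_weight2:
  assumes "\<And>i. i \<le> m \<Longrightarrow> g i \<in> borel_measurable N"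
  shows "(\<lambda>\<omega>. weight2 m \<kappa> d b i j (\<lambda>i. g i \<omega>)) \<in> borel_measurable N"
proof -
  have "(\<lambda>\<omega>. if i < m \<and> j < m then viol2 m \<kappa> d i j (\<lambda>i. g i \<omega>) else 0) \<in> borel_measurable N"
    using assms by (cases "i < m \<and> j < m") (auto intro: measurable_viol2)
  then show ?thesis
    unfolding weight2_def
    by (intro borel_measurable_times borel_measurable_diff borel_measurable_const measurable_slope
        measurable_weight assms)
qed

section \<open>Continuity of the derivatives along curves\<close>

context
  fixes d :: real
  assumes d: "0 < d"
begin

lemma isCont_softsq: "isCont (softsq d) y" "isCont (softsq1 d) y" "isCont (softsq2 d) y"
proof -
  show 1: "isCont (softsq d) y"
    using DERIV_softsq[OF d] DERIV_isCont by blast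
  show 2: "isCont (softsq1 d) y"
    using DERIV_softsq1[OF d] DERIV_isCont by blast
  show "isCont (softsq2 d) y"
    unfolding softsq2_def using sqrt_sq_add_pos[OF d, of y]
    by (intro continuous_intros 1) auto
qed

lemma isCont_viol:
  fixes z :: "real \<Rightarrow> nat \<Rightarrow> real"
  assumes "\<And>i. i < m \<Longrightarrow> isCont (\<lambda>s. z s i) s"
  shows "isCont (\<lambda>s. viol m \<kappa> d (z s)) s"
  unfolding viol_def
  by (intro continuous_intros isCont_o2[OF _ isCont_softsq(1)] assms) auto

lemma isCont_viol1:
  fixes z :: "real \<Rightarrow> nat \<Rightarrow> real"
  assumes "\<And>i. i < m \<Longrightarrow> isCont (\<lambda>s. z s i) s" "i < m"
  shows "isCont (\<lambda>s. viol1 m \<kappa> d i (z s)) s"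
  unfolding viol1_def using viol_pos[OF d, of m \<kappa> "z s"]
  by (intro continuous_intros isCont_o2[OF _ isCont_softsq(2)] isCont_viol assms) auto

lemma isCont_viol2:
  fixes z :: "real \<Rightarrow> nat \<Rightarrow> real"
  assumes "\<And>i. i < m \<Longrightarrow> isCont (\<lambda>s. z s i) s" "i < m" "j < m"
  shows "isCont (\<lambda>s. viol2 m \<kappa> d i j (z s)) s"
proof -
  have "isCont (\<lambda>s. if i = j then softsq2 d (z s i + \<kappa>) / (2 * viol m \<kappa> d (z s)) else 0) s"
    using viol_pos[OF d, of m \<kappa> "z s"]
    by (cases "i = j")
      (auto intro!: continuous_intros isCont_o2[OF _ isCont_softsq(3)] isCont_viol assms)
  then show ?thesis
    unfolding viol2_def using viol_pos[OF d, of m \<kappa> "z s"]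
    by (intro continuous_intros isCont_viol1 isCont_viol assms) auto
qed

lemma isCont_weight:
  fixes z :: "real \<Rightarrow> nat \<Rightarrow> real"
  assumes "\<And>i. i \<le> m \<Longrightarrow> isCont (\<lambda>s. z s i) s"
  shows "isCont (\<lambda>s. weight m \<kappa> d b (z s)) s"
  unfolding weight_def by (intro continuous_intros isCont_viol assms) auto

lemma isCont_slope:
  fixes z :: "real \<Rightarrow> nat \<Rightarrow> real"
  assumes "\<And>i. i \<le> m \<Longrightarrow> isCont (\<lambda>s. z s i) s"
  shows "isCont (\<lambda>s. slope m \<kappa> d i (z s)) s"
  using assms unfolding slope_def by (cases "i < m") (auto intro: isCont_viol1)

lemma isCont_weight1:
  fixes z :: "real \<Rightarrow> nat \<Rightarrow> real"
  assumes "\<And>i. i \<le> m \<Longrightarrow> isCont (\<lambda>s. z s i) s"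
  shows "isCont (\<lambda>s. weight1 m \<kappa> d b i (z s)) s"
  unfolding weight1_def by (intro continuous_intros isCont_slope isCont_weight assms)

lemma isCont_weight2:
  fixes z :: "real \<Rightarrow> nat \<Rightarrow> real"
  assumes "\<And>i. i \<le> m \<Longrightarrow> isCont (\<lambda>s. z s i) s"
  shows "isCont (\<lambda>s. weight2 m \<kappa> d b i j (z s)) s"
proof -
  have "isCont (\<lambda>s. if i < m \<and> j < m then viol2 m \<kappa> d i j (z s) else 0) s"
    using assms by (cases "i < m \<and> j < m") (auto intro: isCont_viol2)
  then show ?thesis
    unfolding weight2_def by (intro continuous_intros isCont_slope isCont_weight assms)
qed

end

section \<open>The comparison on finite sets of test vectors\<close>

definition partition_sum ::
  "(nat \<Rightarrow> real) set \<Rightarrow> nat \<Rightarrow> real \<Rightarrow> real \<Rightarrow> real \<Rightarrow> ((nat \<Rightarrow> real) \<times> nat \<Rightarrow> real) \<Rightarrow> real" where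
  "partition_sum X m \<kappa> d b z = (\<Sum>x\<in>X. weight m \<kappa> d b (\<lambda>i. z (x, i)))"

lemma has_gradient_partition_sum:
  assumes "finite X" "0 < d"
  shows "has_gradient (X \<times> {..m}) (partition_sum X m \<kappa> d b) (\<lambda>(x, i) z. weight1 m \<kappa> d b i (\<lambda>i. z (x, i)))"
  unfolding has_gradient_def
proof (intro allI impI)
  fix z :: "real \<Rightarrow> (nat \<Rightarrow> real) \<times> nat \<Rightarrow> real" and z' s
  assume z: "\<forall>a\<in>X \<times> {..m}. ((\<lambda>s. z s a) has_real_derivative z' a) (at s)"
  have "((\<lambda>s. weight m \<kappa> d b (\<lambda>i. z s (x, i))) has_real_derivative
      (\<Sum>i\<le>m. weight1 m \<kappa> d b i (\<lambda>i. z s (x, i)) * z' (x, i))) (at s)" if "x \<in> X" for x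
    by (rule has_gradientD[OF has_gradient_weight[OF assms(2)], where z = "\<lambda>s i. z s (x, i)"]) (use z that in auto)
  then have "((\<lambda>s. partition_sum X m \<kappa> d b (z s)) has_real_derivative
      (\<Sum>x\<in>X. \<Sum>i\<le>m. weight1 m \<kappa> d b i (\<lambda>i. z s (x, i)) * z' (x, i))) (at s)"
    unfolding partition_sum_def by (intro DERIV_sum)
  then show "((\<lambda>s. partition_sum X m \<kappa> d b (z s)) has_real_derivative
      (\<Sum>a\<in>X \<times> {..m}. (\<lambda>(x, i) z. weight1 m \<kappa> d b i (\<lambda>i. z (x, i))) a (z s) * z' a)) (at s)"
    by (simp add: sum.cartesian_product case_prod_unfold)
qed

text \<open>The exponent \<open>a \<le> 1\<close> makes the functional concave in the weights, which gives the mixed second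
  derivatives at distinct points of \<open>X\<close> the right sign; the points themselves contribute nothing
  because both fields have the same variance.\<close>

lemma gordon_comparison_smooth:
  fixes X :: "(nat \<Rightarrow> real) set" and P Q :: "(nat \<Rightarrow> real) \<times> nat \<Rightarrow> 'k \<Rightarrow> real"
  assumes X: "finite X" "X \<noteq> {}" and I: "finite I"
    and d: "0 < d" and b: "0 < b" and a: "0 < a" "a \<le> 1"
    and disj: "\<And>p q k. p \<in> X \<times> {..m} \<Longrightarrow> q \<in> X \<times> {..m} \<Longrightarrow> k \<in> I \<Longrightarrow> P p k * Q q k = 0"
    and cov: "\<And>x y i j. x \<in> X \<Longrightarrow> y \<in> X \<Longrightarrow> i \<le> m \<Longrightarrow> j \<le> m \<Longrightarrow>
        (\<Sum>k\<in>I. P (x, i) k * P (y, j) k - Q (x, i) k * Q (y, j) k) =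
        (if i = j then (if i < m then C x y - 1 else 1 - C x y) else 0)"
    and C: "\<And>x y. x \<in> X \<Longrightarrow> y \<in> X \<Longrightarrow> C x y \<le> 1" "\<And>x. x \<in> X \<Longrightarrow> C x x = 1"
  shows "(\<integral>\<xi>. partition_sum X m \<kappa> d b (linear_field (X \<times> {..m}) I P \<xi>) powr a \<partial>gaussian I)
    \<le> (\<integral>\<xi>. partition_sum X m \<kappa> d b (linear_field (X \<times> {..m}) I Q \<xi>) powr a \<partial>gaussian I)"
    and "integrable (gaussian I) (\<lambda>\<xi>. partition_sum X m \<kappa> d b (linear_field (X \<times> {..m}) I P \<xi>) powr a)"
    and "integrable (gaussian I) (\<lambda>\<xi>. partition_sum X m \<kappa> d b (linear_field (X \<times> {..m}) I Q \<xi>) powr a)"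
proof -
  let ?A = "X \<times> {..m}"
  define S where "S = partition_sum X m \<kappa> d b"
  define W where "W x z = weight m \<kappa> d b (\<lambda>i. z (x, i))" for x :: "nat \<Rightarrow> real" and z :: "(nat \<Rightarrow> real) \<times> nat \<Rightarrow> real"
  define W1 where "W1 p z = weight1 m \<kappa> d b (snd p) (\<lambda>i. z (fst p, i))"
    for p :: "(nat \<Rightarrow> real) \<times> nat" and z :: "(nat \<Rightarrow> real) \<times> nat \<Rightarrow> real"
  define W2 where "W2 p j z = weight2 m \<kappa> d b (snd p) j (\<lambda>i. z (fst p, i))"
    for p :: "(nat \<Rightarrow> real) \<times> nat" and j and z :: "(nat \<Rightarrow> real) \<times> nat \<Rightarrow> real"
  define f where "f z = S z powr a" for z
  define f1 where "f1 p z = a * S z powr (a - 1) * W1 p z" for p z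
  \<comment> \<open>The first summand stems from the outer power and links any two points of
    \<open>X\<close>, with the sign of \<open>a - 1\<close>; the second, from the Hessian of a
    single weight, lives on equal points.\<close>
  define f2 where "f2 p q z = a * ((a - 1) * S z powr (a - 2) * W1 q z) * W1 p z
      + (if fst p = fst q then a * S z powr (a - 1) * W2 p (snd q) z else 0)" for p q z
  have A: "finite ?A" using X by auto
  have W_pos: "0 < W x z" for x z
    by (simp add: W_def weight_pos)
  have S_eq: "S z = (\<Sum>x\<in>X. W x z)" for z
    by (simp add: S_def W_def partition_sum_def)
  have S_pos: "0 < S z" for z
    unfolding S_eq using X W_pos by (intro sum_pos) auto
  have W_le: "W x z \<le> S z" if "x \<in> X" for x z
    unfolding S_eq using X W_pos that by (intro member_le_sum) (auto simp: less_imp_le)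

  have meas_comp: "(\<lambda>z. z (x, i)) \<in> borel_measurable (PiM ?A (\<lambda>_. borel))" if "x \<in> X" "i \<le> m" for x i
    using that by (intro measurable_component_singleton) auto
  have Sm[measurable]: "S \<in> borel_measurable (PiM ?A (\<lambda>_. borel))"
    unfolding S_eq[abs_def] W_def by (intro borel_measurable_sum measurable_weight meas_comp)
  have W1m: "W1 p \<in> borel_measurable (PiM ?A (\<lambda>_. borel))" if "p \<in> ?A" for p
    unfolding W1_def by (rule measurable_weight1) (use that in \<open>auto intro!: meas_comp\<close>)
  have W2m: "W2 p j \<in> borel_measurable (PiM ?A (\<lambda>_. borel))" if "p \<in> ?A" for p j
    unfolding W2_def by (rule measurable_weight2) (use that in \<open>auto intro!: meas_comp\<close>)
  have fm: "f \<in> borel_measurable (PiM ?A (\<lambda>_. borel))"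
    unfolding f_def by measurable
  have f1m: "f1 p \<in> borel_measurable (PiM ?A (\<lambda>_. borel))" if "p \<in> ?A" for p
    using W1m[OF that] unfolding f1_def by measurable
  have f2m: "f2 p q \<in> borel_measurable (PiM ?A (\<lambda>_. borel))" if "p \<in> ?A" "q \<in> ?A" for p q
    using W1m[OF that(1)] W1m[OF that(2)] W2m[OF that(1), of "snd q"] unfolding f2_def by measurable

  have dS: "((\<lambda>s. S (z s)) has_real_derivative (\<Sum>p\<in>?A. W1 p (z s) * z' p)) (at s)"
    if "\<And>p. p \<in> ?A \<Longrightarrow> ((\<lambda>s. z s p) has_real_derivative z' p) (at s)" for z z' s
    using has_gradientD[OF has_gradient_partition_sum[OF X(1) d], of m z z' s \<kappa> b] that
    by (simp add: S_def W1_def case_prod_unfold)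
  have grad: "has_gradient ?A f f1"
    unfolding has_gradient_def
  proof (intro allI impI)
    fix z :: "real \<Rightarrow> (nat \<Rightarrow> real) \<times> nat \<Rightarrow> real" and z' s
    assume z: "\<forall>p\<in>?A. ((\<lambda>s. z s p) has_real_derivative z' p) (at s)"
    have "((\<lambda>s. S (z s) powr a) has_real_derivative
        (a * S (z s) powr (a - 1)) * (\<Sum>p\<in>?A. W1 p (z s) * z' p)) (at s)"
      by (rule DERIV_chain2[OF has_real_derivative_powr[OF S_pos] dS]) (use z in auto)
    then show "((\<lambda>s. f (z s)) has_real_derivative (\<Sum>p\<in>?A. f1 p (z s) * z' p)) (at s)"
      by (simp add: f_def f1_def sum_distrib_left mult.assoc)
  qed
  have grad1: "has_gradient ?A (f1 p) (f2 p)" if p: "p \<in> ?A" for p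
    unfolding has_gradient_def
  proof (intro allI impI)
    fix z :: "real \<Rightarrow> (nat \<Rightarrow> real) \<times> nat \<Rightarrow> real" and z' s
    assume z: "\<forall>p\<in>?A. ((\<lambda>s. z s p) has_real_derivative z' p) (at s)"
    have 1: "((\<lambda>s. S (z s) powr (a - 1)) has_real_derivative
        ((a - 1) * S (z s) powr (a - 1 - 1)) * (\<Sum>q\<in>?A. W1 q (z s) * z' q)) (at s)"
      by (rule DERIV_chain2[OF has_real_derivative_powr[OF S_pos] dS]) (use z in auto)
    have "((\<lambda>s. W1 p (z s)) has_real_derivative (\<Sum>j\<le>m. W2 p j (z s) * z' (fst p, j))) (at s)"
      unfolding W1_def W2_def
      by (rule has_gradientD[OF has_gradient_weight1[OF d], where z = "\<lambda>s i. z s (fst p, i)"])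
        (use z p in auto)
    also have "(\<Sum>j\<le>m. W2 p j (z s) * z' (fst p, j)) =
        (\<Sum>q\<in>?A. (if fst p = fst q then W2 p (snd q) (z s) else 0) * z' q)"
    proof -
      have "(\<Sum>q\<in>?A. (if fst p = fst q then W2 p (snd q) (z s) else 0) * z' q) =
          (\<Sum>x\<in>X. \<Sum>j\<le>m. (if fst p = x then W2 p j (z s) else 0) * z' (x, j))"
        by (simp add: sum.cartesian_product case_prod_unfold)
      also have "\<dots> = (\<Sum>x\<in>X. if fst p = x then (\<Sum>j\<le>m. W2 p j (z s) * z' (x, j)) else 0)"
        by (intro sum.cong refl) auto
      also have "\<dots> = (\<Sum>j\<le>m. W2 p j (z s) * z' (fst p, j))"
        using p X by (auto simp: sum.delta')
      finally show ?thesis by simp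
    qed
    finally have 2: "((\<lambda>s. W1 p (z s)) has_real_derivative
        (\<Sum>q\<in>?A. (if fst p = fst q then W2 p (snd q) (z s) else 0) * z' q)) (at s)" .
    have "((\<lambda>s. a * S (z s) powr (a - 1) * W1 p (z s)) has_real_derivative
        (a * (((a - 1) * S (z s) powr (a - 1 - 1)) * (\<Sum>q\<in>?A. W1 q (z s) * z' q))) * W1 p (z s)
        + (\<Sum>q\<in>?A. (if fst p = fst q then W2 p (snd q) (z s) else 0) * z' q) * (a * S (z s) powr (a - 1))) (at s)"
      by (intro DERIV_mult DERIV_cmult 1 2)
    also have "(a * (((a - 1) * S (z s) powr (a - 1 - 1)) * (\<Sum>q\<in>?A. W1 q (z s) * z' q))) * W1 p (z s)
        + (\<Sum>q\<in>?A. (if fst p = fst q then W2 p (snd q) (z s) else 0) * z' q) * (a * S (z s) powr (a - 1))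
        = (\<Sum>q\<in>?A. f2 p q (z s) * z' q)"
      unfolding sum_distrib_left sum_distrib_right sum.distrib[symmetric] f2_def
      by (intro sum.cong refl) (simp add: algebra_simps)
    finally show "((\<lambda>s. f1 p (z s)) has_real_derivative (\<Sum>q\<in>?A. f2 p q (z s) * z' q)) (at s)"
      by (simp add: f1_def)
  qed
  have cont: "continuous_along ?A (f2 p q)" if p: "p \<in> ?A" and q: "q \<in> ?A" for p q
    unfolding continuous_along_def
  proof (intro allI impI)
    fix z :: "real \<Rightarrow> (nat \<Rightarrow> real) \<times> nat \<Rightarrow> real" and s
    assume "\<forall>p\<in>?A. isCont (\<lambda>s. z s p) s"
    then have z: "isCont (\<lambda>s. z s (x, i)) s" if "x \<in> X" "i \<le> m" for x i
      using that by auto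
    have "isCont (\<lambda>s. S (z s)) s"
      unfolding S_eq W_def by (intro continuous_intros isCont_weight[OF d] z)
    then have S: "isCont (\<lambda>s. S (z s) powr r) s" for r
      using S_pos[of "z s"] by (intro continuous_intros) auto
    have W1: "isCont (\<lambda>s. W1 p (z s)) s" if "p \<in> ?A" for p
      unfolding W1_def by (rule isCont_weight1[OF d]) (use that in \<open>auto intro!: z\<close>)
    have W2: "isCont (\<lambda>s. W2 p j (z s)) s" for j
      unfolding W2_def by (rule isCont_weight2[OF d]) (use p in \<open>auto intro!: z\<close>)
    have "isCont (\<lambda>s. if fst p = fst q then a * S (z s) powr (a - 1) * W2 p (snd q) (z s) else 0) s"
      by (cases "fst p = fst q") (auto intro!: continuous_intros S W2)
    then show "isCont (\<lambda>s. f2 p q (z s)) s"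
      unfolding f2_def by (intro continuous_intros S W1 p q)
  qed

  define U where "U z = (\<Sum>p\<in>?A. \<bar>z p\<bar>)" for z :: "(nat \<Rightarrow> real) \<times> nat \<Rightarrow> real"
  define N where "N = real (card X) powr a"
  define B where "B = b\<^sup>2 + b * (4 / d)"
  have B: "b\<^sup>2 \<le> B" "0 \<le> B"
    using b d by (auto simp: B_def)
  have N0: "0 \<le> N" by (simp add: N_def)
  have fb: "S z powr a \<le> N * exp (a * b * U z)" for z
  proof -
    have "W x z \<le> exp (b * U z)" if "x \<in> X" for x
    proof -
      have "- z (x, m) \<le> \<bar>z (x, m)\<bar>" by simp
      also have "\<dots> \<le> U z"
        unfolding U_def using A that by (intro member_le_sum[of "(x, m)" ?A "\<lambda>p. \<bar>z p\<bar>"]) auto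
      finally have "- (viol m \<kappa> d (\<lambda>i. z (x, i)) + z (x, m)) \<le> U z"
        using viol_pos[OF d, of m \<kappa> "\<lambda>i. z (x, i)"] by linarith
      then have "b * - (viol m \<kappa> d (\<lambda>i. z (x, i)) + z (x, m)) \<le> b * U z"
        using b by (intro mult_left_mono) auto
      then show ?thesis
        by (simp only: W_def weight_def mult_minus_left mult_minus_right exp_le_cancel_iff)
    qed
    then have "S z \<le> real (card X) * exp (b * U z)"
      unfolding S_eq using sum_bounded_above[of X "\<lambda>x. W x z" "exp (b * U z)"] by simp
    then have "S z powr a \<le> (real (card X) * exp (b * U z)) powr a"
      using S_pos[of z] a by (intro powr_mono2) auto
    also have "\<dots> = N * exp (a * b * U z)"
      by (simp add: N_def powr_mult exp_powr_real mult_ac)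
    finally show ?thesis .
  qed
  \<comment> \<open>Derivatives of a weight are at most a constant times that weight, hence times
    \<open>S\<close>. As \<open>f\<close> has degree \<open>a\<close> in the weights,
    \<open>f\<close>, \<open>f1\<close> and \<open>f2\<close> are all bounded by multiples of
    \<open>S powr a\<close>, and one growth estimate serves all three.\<close>
  have W1b: "\<bar>W1 p z\<bar> \<le> b * S z" if "p \<in> ?A" for p z
  proof -
    have "\<bar>W1 p z\<bar> \<le> b * W (fst p) z"
      unfolding W1_def W_def using b by (intro abs_weight1_le d) auto
    also have "\<dots> \<le> b * S z"
      using b that by (intro mult_left_mono W_le) auto
    finally show ?thesis .
  qed
  have W2b: "\<bar>W2 p j z\<bar> \<le> B * S z" if "p \<in> ?A" for p j z
  proof -
    have "\<bar>W2 p j z\<bar> \<le> B * W (fst p) z"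
      unfolding W2_def W_def B_def using b by (intro abs_weight2_le d) auto
    also have "\<dots> \<le> B * S z"
      using B that by (intro mult_left_mono W_le) auto
    finally show ?thesis .
  qed
  have S1: "S z powr (a - 1) * S z = S z powr a" for z
    using S_pos[of z] powr_add[of "S z" "a - 1" 1] by simp
  have S2: "S z powr (a - 2) * (S z * S z) = S z powr a" for z
    using S_pos[of z] powr_add[of "S z" "a - 2" 2] by (simp add: powr_numeral power2_eq_square)
  have f1b: "\<bar>f1 p z\<bar> \<le> b * S z powr a" if "p \<in> ?A" for p z
  proof -
    have "\<bar>f1 p z\<bar> = a * (S z powr (a - 1) * \<bar>W1 p z\<bar>)"
      using a by (simp add: f1_def abs_mult)
    also have "\<dots> \<le> 1 * (S z powr (a - 1) * (b * S z))"
      using a W1b[OF that] by (intro mult_mono) auto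
    also have "\<dots> = b * (S z powr (a - 1) * S z)"
      by simp
    finally show ?thesis
      unfolding S1 .
  qed
  have f2b: "\<bar>f2 p q z\<bar> \<le> 2 * B * S z powr a" if p: "p \<in> ?A" and q: "q \<in> ?A" for p q z
  proof -
    have "\<bar>a * ((a - 1) * S z powr (a - 2) * W1 q z) * W1 p z\<bar>
        = (a * (1 - a)) * (S z powr (a - 2) * (\<bar>W1 q z\<bar> * \<bar>W1 p z\<bar>))"
      using a by (simp add: abs_mult)
    also have "\<dots> \<le> 1 * (S z powr (a - 2) * ((b * S z) * (b * S z)))"
      using a b W1b[OF p, of z] W1b[OF q, of z] S_pos[of z]
      by (intro mult_mono mult_le_one) auto
    also have "\<dots> = b\<^sup>2 * (S z powr (a - 2) * (S z * S z))"
      by (simp add: power2_eq_square)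
    also have "\<dots> \<le> B * S z powr a"
      unfolding S2 by (intro mult_right_mono B) auto
    finally have 1: "\<bar>a * ((a - 1) * S z powr (a - 2) * W1 q z) * W1 p z\<bar> \<le> B * S z powr a" .
    have "\<bar>a * S z powr (a - 1) * W2 p (snd q) z\<bar> = a * (S z powr (a - 1) * \<bar>W2 p (snd q) z\<bar>)"
      using a by (simp add: abs_mult)
    also have "\<dots> \<le> 1 * (S z powr (a - 1) * (B * S z))"
      using a W2b[OF p] by (intro mult_mono) auto
    also have "\<dots> = B * (S z powr (a - 1) * S z)"
      by simp
    finally have "\<bar>a * S z powr (a - 1) * W2 p (snd q) z\<bar> \<le> B * S z powr a"
      unfolding S1 .
    then have 2: "\<bar>if fst p = fst q then a * S z powr (a - 1) * W2 p (snd q) z else 0\<bar> \<le> B * S z powr a"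
      using B by (cases "fst p = fst q") (simp_all only: if_True if_False, auto)
    show ?thesis
      unfolding f2_def using 1 2 by linarith
  qed
  define K where "K = (1 + b + 2 * B) * N"
  have growth: "r * S z powr a \<le> K * exp (a * b * U z)" if "0 \<le> r" "r \<le> 1 + b + 2 * B" for r z
  proof -
    have "r * S z powr a \<le> (1 + b + 2 * B) * (N * exp (a * b * U z))"
      using that fb[of z] by (intro mult_mono) auto
    then show ?thesis
      by (simp add: K_def mult.assoc)
  qed
  have g0: "\<bar>f z\<bar> \<le> K * exp (a * b * (\<Sum>p\<in>?A. \<bar>z p\<bar>))" for z
    using growth[of 1 z] b B by (simp add: f_def U_def)
  have g1: "\<bar>f1 p z\<bar> \<le> K * exp (a * b * (\<Sum>p\<in>?A. \<bar>z p\<bar>))" if "p \<in> ?A" for p z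
    using order_trans[OF f1b[OF that] growth] b B by (simp add: U_def)
  have g2: "\<bar>f2 p q z\<bar> \<le> K * exp (a * b * (\<Sum>p\<in>?A. \<bar>z p\<bar>))" if "p \<in> ?A" "q \<in> ?A" for p q z
    using order_trans[OF f2b[OF that] growth] b B by (simp add: U_def)

  have cond: "(\<Sum>p\<in>?A. \<Sum>q\<in>?A. f2 p q z * (\<Sum>k\<in>I. P p k * P q k - Q p k * Q q k)) \<le> 0" for z
  proof -
    have cp: "sum g ?A = (\<Sum>x\<in>X. \<Sum>i\<le>m. g (x, i))" for g :: "(nat \<Rightarrow> real) \<times> nat \<Rightarrow> real"
      by (simp add: sum.cartesian_product)
    define D where "D x y i = (if i < m then C x y - 1 else 1 - C x y)" for x y and i :: nat
    have "(\<Sum>p\<in>?A. \<Sum>q\<in>?A. f2 p q z * (\<Sum>k\<in>I. P p k * P q k - Q p k * Q q k)) =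
        (\<Sum>x\<in>X. \<Sum>i\<le>m. \<Sum>y\<in>X. \<Sum>j\<le>m. f2 (x, i) (y, j) z *
          (\<Sum>k\<in>I. P (x, i) k * P (y, j) k - Q (x, i) k * Q (y, j) k))"
      by (simp only: cp)
    also have "\<dots> = (\<Sum>x\<in>X. \<Sum>i\<le>m. \<Sum>y\<in>X. \<Sum>j\<le>m. if i = j then f2 (x, i) (y, i) z * D x y i else 0)"
      by (intro sum.cong refl) (simp add: cov D_def)
    also have "\<dots> = (\<Sum>x\<in>X. \<Sum>y\<in>X. \<Sum>i\<le>m. f2 (x, i) (y, i) z * D x y i)"
      by (intro sum.cong refl, subst sum.swap) simp
    also have "\<dots> \<le> 0"
    proof (rule sum_nonpos, rule sum_nonpos)
      fix x y assume xy: "x \<in> X" "y \<in> X"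
      show "(\<Sum>i\<le>m. f2 (x, i) (y, i) z * D x y i) \<le> 0"
      proof (cases "x = y")
        case True
        then have "D x y i = 0" for i
          using C(2)[OF xy(1)] by (simp add: D_def)
        then show ?thesis
          by simp
      next
        case False
        define v where "v = (\<lambda>i. z (x, i))"
        define w where "w = (\<lambda>i. z (y, i))"
        define G where "G = a * (1 - a) * S z powr (a - 2)"
        have "f2 (x, i) (y, i) z = - G * (weight1 m \<kappa> d b i v * weight1 m \<kappa> d b i w)" for i
          using False by (simp add: f2_def W1_def v_def w_def G_def algebra_simps)
        then have "(\<Sum>i\<le>m. f2 (x, i) (y, i) z * D x y i) =
            (\<Sum>i<m. - G * (weight1 m \<kappa> d b i v * weight1 m \<kappa> d b i w) * (C x y - 1))
              - G * (weight1 m \<kappa> d b m v * weight1 m \<kappa> d b m w) * (1 - C x y)"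
          by (simp add: D_def lessThan_Suc_atMost[symmetric])
        also have "(\<Sum>i<m. - G * (weight1 m \<kappa> d b i v * weight1 m \<kappa> d b i w) * (C x y - 1)) =
            G * (1 - C x y) * (\<Sum>i<m. weight1 m \<kappa> d b i v * weight1 m \<kappa> d b i w)"
          unfolding sum_distrib_left by (intro sum.cong refl) (simp add: algebra_simps)
        \<comment> \<open>The rows enter with \<open>C x y - 1\<close> and the scalar with
          \<open>1 - C x y\<close>. Once \<open>G * (1 - C x y) \<ge> 0\<close> is factored out, the
          sign is that of \<open>sum_weight1_le\<close>.\<close>
        finally have "(\<Sum>i\<le>m. f2 (x, i) (y, i) z * D x y i) =
            G * (1 - C x y) * ((\<Sum>i<m. weight1 m \<kappa> d b i v * weight1 m \<kappa> d b i w)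
              - weight1 m \<kappa> d b m v * weight1 m \<kappa> d b m w)"
          by (simp add: algebra_simps)
        also have "\<dots> \<le> 0"
          using sum_weight1_le[OF d] C(1)[OF xy] a
          by (intro mult_nonneg_nonpos) (auto simp: G_def)
        finally show ?thesis .
      qed
    qed
    finally show ?thesis .
  qed
  have L: "0 \<le> a * b" using a b by simp
  show "(\<integral>\<xi>. partition_sum X m \<kappa> d b (linear_field ?A I P \<xi>) powr a \<partial>gaussian I)
    \<le> (\<integral>\<xi>. partition_sum X m \<kappa> d b (linear_field ?A I Q \<xi>) powr a \<partial>gaussian I)"
    using gaussian_interpolation[OF A I disj fm f1m f2m grad grad1 cont g0 g1 g2 L cond]
    by (simp add: f_def S_def)
  show "integrable (gaussian I) (\<lambda>\<xi>. partition_sum X m \<kappa> d b (linear_field ?A I P \<xi>) powr a)"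
    "integrable (gaussian I) (\<lambda>\<xi>. partition_sum X m \<kappa> d b (linear_field ?A I Q \<xi>) powr a)"
    using integrable_linear_field[OF A I fm g0 L] by (simp_all add: f_def S_def)
qed

text \<open>The index \<open>(i, j)\<close> stands for a matrix entry if \<open>i < m\<close> and \<open>j < n\<close>, the entries \<open>(i, n)\<close> and
  \<open>(m, j)\<close> form the two vectors of the decoupled field, and \<open>(m, n)\<close> is the scalar that equalises the
  variances.\<close>

definition gordon_coeff :: "bool \<Rightarrow> nat \<Rightarrow> nat \<Rightarrow> (nat \<Rightarrow> real) \<times> nat \<Rightarrow> nat \<times> nat \<Rightarrow> real" where
  "gordon_coeff coupled m n p k =
    (if fst k = snd p \<and> (snd p < m) = ((snd k < n) = coupled)
     then (if snd k < n then fst p (snd k) else 1) else 0)"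

text \<open>With \<open>g\<close> arbitrary, one computation yields the field, taking the sample for
  \<open>g\<close>, and the covariance, taking another row of coefficients.\<close>

lemma sum_gordon_coeff:
  assumes "i \<le> m"
  shows "(\<Sum>k\<in>{..m} \<times> {..n}. gordon_coeff coupled m n (x, i) k * g k) =
    (if (i < m) = coupled then (\<Sum>j<n. x j * g (i, j)) else g (i, n))"
proof -
  let ?c = "\<lambda>j. if (i < m) = ((j < n) = coupled) then (if j < n then x j else 1) else 0"
  have "(\<Sum>k\<in>{..m} \<times> {..n}. gordon_coeff coupled m n (x, i) k * g k) =
      (\<Sum>i'\<le>m. \<Sum>j\<le>n. gordon_coeff coupled m n (x, i) (i', j) * g (i', j))"
    by (simp add: sum.cartesian_product)
  also have "\<dots> = (\<Sum>i'\<le>m. if i' = i then (\<Sum>j\<le>n. ?c j * g (i, j)) else 0)"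
    by (intro sum.cong refl) (auto simp: gordon_coeff_def intro!: sum.cong sum.neutral)
  also have "\<dots> = (\<Sum>j\<le>n. ?c j * g (i, j))"
    using assms by simp
  also have "\<dots> = (\<Sum>j<n. ?c j * g (i, j)) + ?c n * g (i, n)"
    by (simp add: lessThan_Suc_atMost[symmetric])
  also have "\<dots> = (if (i < m) = coupled then (\<Sum>j<n. x j * g (i, j)) else g (i, n))"
    by (cases coupled; cases "i < m") (auto intro!: sum.cong)
  finally show ?thesis .
qed

lemma linear_field_gordon_coeff:
  assumes "x \<in> X" "i \<le> m"
  shows "linear_field (X \<times> {..m}) ({..m} \<times> {..n}) (gordon_coeff coupled m n) \<xi> (x, i) =
    (if (i < m) = coupled then (\<Sum>j<n. x j * \<xi> (i, j)) else \<xi> (i, n))"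
  using assms sum_gordon_coeff[OF assms(2), where n = n and coupled = coupled and x = x and g = \<xi>] by (simp add: linear_field_def)

text \<open>Rows have covariance \<open>x . y\<close> in the coupled field and 1 in the decoupled
  one; for the scalar coordinate the roles are exchanged. On unit vectors the variances therefore
  agree, and between different points the two differences have opposite signs.\<close>

lemma gordon_coeff_cov:
  assumes "i \<le> m" "l \<le> m"
  shows "(\<Sum>k\<in>{..m} \<times> {..n}. gordon_coeff coupled m n (x, i) k * gordon_coeff coupled m n (y, l) k) =
    (if i = l then (if (i < m) = coupled then (\<Sum>j<n. x j * y j) else 1) else 0)"
  unfolding sum_gordon_coeff[OF assms(1)]
  by (cases coupled; cases "i < m"; cases "i = l") (auto simp: gordon_coeff_def)

lemma sum_mult_le_L2_set: "(\<Sum>j\<in>A. x j * y j) \<le> L2_set x A * L2_set y A"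
proof -
  have "(\<Sum>j\<in>A. x j * y j) \<le> (\<Sum>j\<in>A. \<bar>x j\<bar> * \<bar>y j\<bar>)"
    by (intro sum_mono) (metis abs_ge_self abs_mult)
  also have "\<dots> \<le> L2_set x A * L2_set y A"
    by (rule L2_set_mult_ineq)
  finally show ?thesis .
qed

lemma L2_set_unit_iff: "L2_set x A = 1 \<longleftrightarrow> (\<Sum>j\<in>A. x j * x j) = 1"
  by (simp add: L2_set_def power2_eq_square)

lemma viol_cong: "(\<And>i. i < m \<Longrightarrow> v i = w i) \<Longrightarrow> viol m \<kappa> d v = viol m \<kappa> d w"
  unfolding viol_def by simp

lemma partition_sum_gordon_coeff:
  assumes X: "finite X"
  shows "partition_sum X m \<kappa> d b (linear_field (X \<times> {..m}) ({..m} \<times> {..n}) (gordon_coeff True m n) \<xi>) =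
      (\<Sum>x\<in>X. exp (- b * (viol m \<kappa> d (\<lambda>i. \<Sum>j<n. x j * \<xi> (i, j)) + \<xi> (m, n))))" (is ?th1)
    and "partition_sum X m \<kappa> d b (linear_field (X \<times> {..m}) ({..m} \<times> {..n}) (gordon_coeff False m n) \<xi>) =
      (\<Sum>x\<in>X. exp (- b * (viol m \<kappa> d (\<lambda>i. \<xi> (i, n)) + (\<Sum>j<n. x j * \<xi> (m, j)))))" (is ?th2)
proof -
  have "viol m \<kappa> d (\<lambda>i. linear_field (X \<times> {..m}) ({..m} \<times> {..n}) (gordon_coeff True m n) \<xi> (x, i)) =
      viol m \<kappa> d (\<lambda>i. \<Sum>j<n. x j * \<xi> (i, j))" if "x \<in> X" for x
    using that by (intro viol_cong) (simp add: linear_field_gordon_coeff)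
  then show ?th1
    unfolding partition_sum_def weight_def by (intro sum.cong refl) (simp add: linear_field_gordon_coeff)
  have "viol m \<kappa> d (\<lambda>i. linear_field (X \<times> {..m}) ({..m} \<times> {..n}) (gordon_coeff False m n) \<xi> (x, i)) =
      viol m \<kappa> d (\<lambda>i. \<xi> (i, n))" if "x \<in> X" for x
    using that by (intro viol_cong) (simp add: linear_field_gordon_coeff)
  then show ?th2
    unfolding partition_sum_def weight_def by (intro sum.cong refl) (simp add: linear_field_gordon_coeff)
qed

text \<open>What remains of the decoupled field once the test vector is eliminated by Cauchy-Schwarz
  and \<open>softsq\<close> is replaced by the squared positive part below it. Column
  \<open>n\<close> holds the vector \<open>g\<close>, row \<open>m\<close> the vector
  \<open>h\<close>.\<close>

definition decoupled :: "nat \<Rightarrow> nat \<Rightarrow> real \<Rightarrow> real \<Rightarrow> (nat \<times> nat \<Rightarrow> real) \<Rightarrow> real" where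
  "decoupled m n \<kappa> c \<xi> = exp (- c * L2_set (\<lambda>i. max 0 (\<xi> (i, n) + \<kappa>)) {..<m}) *
     exp (c * L2_set (\<lambda>j. \<xi> (m, j)) {..<n})"

lemma integrable_decoupled:
  assumes c: "0 < c"
  shows "integrable (gaussian ({..m} \<times> {..n})) (decoupled m n \<kappa> c)"
proof (rule integrable_gaussian_growth[where K = 1 and L = c])
  show "decoupled m n \<kappa> c \<in> borel_measurable (PiM ({..m} \<times> {..n}) (\<lambda>_. borel))"
    unfolding decoupled_def L2_set_def by measurable
  fix \<xi> :: "nat \<times> nat \<Rightarrow> real"
  have "L2_set (\<lambda>j. \<xi> (m, j)) {..<n} \<le> (\<Sum>j<n. \<bar>\<xi> (m, j)\<bar>)"
    by (rule L2_set_le_sum_abs)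
  also have "\<dots> = (\<Sum>k\<in>{m} \<times> {..<n}. \<bar>\<xi> k\<bar>)"
    using sum.cartesian_product[of "\<lambda>i j. \<bar>\<xi> (i, j)\<bar>" "{..<n}" "{m}"] by simp
  also have "\<dots> \<le> (\<Sum>k\<in>{..m} \<times> {..n}. \<bar>\<xi> k\<bar>)"
    by (intro sum_mono2) auto
  finally have 1: "c * L2_set (\<lambda>j. \<xi> (m, j)) {..<n} \<le> c * (\<Sum>k\<in>{..m} \<times> {..n}. \<bar>\<xi> k\<bar>)"
    using c by (intro mult_left_mono) auto
  have "0 \<le> c * L2_set (\<lambda>i. max 0 (\<xi> (i, n) + \<kappa>)) {..<m}"
    using c by simp
  then have "decoupled m n \<kappa> c \<xi> \<le> 1 * exp (c * (\<Sum>k\<in>{..m} \<times> {..n}. \<bar>\<xi> k\<bar>))"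
    unfolding decoupled_def using 1 by (intro mult_mono) auto
  then show "\<bar>decoupled m n \<kappa> c \<xi>\<bar> \<le> 1 * exp (c * (\<Sum>k\<in>{..m} \<times> {..n}. \<bar>\<xi> k\<bar>))"
    by (simp add: decoupled_def)
qed auto

text \<open>The event concerns the matrix entries alone, while the comparison lives on the larger
  index set that also holds the vectors and the scalar.\<close>

lemma measure_gaussian_restrict:
  assumes "finite J" "J \<subseteq> I" and E: "E \<in> sets (gaussian J)"
  shows "measure (gaussian I) ((\<lambda>\<xi>. restrict \<xi> J) -` E \<inter> space (gaussian I)) = measure (gaussian J) E"
proof -
  interpret product_prob_space "\<lambda>_. gauss" I by standard
  have "distr (gaussian I) (gaussian J) (\<lambda>\<xi>. restrict \<xi> J) = gaussian J"
    unfolding gaussian_def by (rule distr_PiM_restrict_finite[OF assms(1,2)])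
  moreover have "(\<lambda>\<xi>. restrict \<xi> J) \<in> measurable (gaussian I) (gaussian J)"
    unfolding gaussian_def using assms(2) by (intro measurable_restrict_subset) auto
  ultimately show ?thesis
    using measure_distr[of "\<lambda>\<xi>. restrict \<xi> J" "gaussian I" "gaussian J" E] E by simp
qed

text \<open>The scalar coordinate is independent of the matrix block and contributes its exponential
  moment. With \<open>L = - c\<close> this is the origin of the factor
  \<open>exp (c^2 / 2)\<close>.\<close>

lemma integral_indicator_exp:
  fixes k :: 'k
  assumes "finite J" "k \<notin> J" and I: "finite I" "J \<subseteq> I" "k \<in> I" and E: "E \<in> sets (gaussian J)"
  shows "integrable (gaussian I) (\<lambda>\<xi>. indicator E (restrict \<xi> J) * exp (L * \<xi> k))"
    and "(\<integral>\<xi>. indicator E (restrict \<xi> J) * exp (L * \<xi> k) \<partial>gaussian I) =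
      exp (L\<^sup>2 / 2) * measure (gaussian J) E"
proof -
  define I' where "I' = I - {k}"
  have I': "finite I'" "k \<notin> I'" "I = insert k I'" "J \<subseteq> I'"
    using assms by (auto simp: I'_def)
  have E': "E \<in> sets (PiM J (\<lambda>_. borel))"
    using E by simp
  have [measurable]: "(\<lambda>\<xi>. indicator E (restrict \<xi> J) :: real) \<in> borel_measurable (PiM I (\<lambda>_. borel))"
    using measurable_compose[OF measurable_restrict_subset[OF I(2)] borel_measurable_indicator[OF E']] .
  have [measurable]: "(\<lambda>\<xi>. \<xi> k) \<in> borel_measurable (PiM I (\<lambda>_. borel))"
    using I by measurable
  show int: "integrable (gaussian I) (\<lambda>\<xi>. indicator E (restrict \<xi> J) * exp (L * \<xi> k))"
  proof (rule integrable_gaussian_growth[where K = 1 and L = "\<bar>L\<bar>", OF I(1)])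
    fix \<xi> :: "'k \<Rightarrow> real"
    have "L * \<xi> k \<le> \<bar>L\<bar> * \<bar>\<xi> k\<bar>"
      by (metis abs_ge_self abs_mult)
    also have "\<dots> \<le> \<bar>L\<bar> * (\<Sum>k\<in>I. \<bar>\<xi> k\<bar>)"
      using I by (intro mult_left_mono member_le_sum) auto
    finally show "\<bar>indicator E (restrict \<xi> J) * exp (L * \<xi> k)\<bar> \<le> 1 * exp (\<bar>L\<bar> * (\<Sum>k\<in>I. \<bar>\<xi> k\<bar>))"
      by (auto simp: indicator_def)
  qed measurable
  have "(\<integral>\<xi>. indicator E (restrict \<xi> J) * exp (L * \<xi> k) \<partial>gaussian I) =
      (\<integral>\<xi>. (\<integral>s. indicator E (restrict (\<xi>(k := s)) J) * exp (L * (\<xi>(k := s)) k) \<partial>gauss) \<partial>gaussian I')"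
    using gauss_prod.product_integral_insert[OF I'(1,2) int[unfolded gaussian_def I'(3)]]
    by (simp add: gaussian_def I'(3))
  also have "\<dots> = (\<integral>\<xi>. indicator E (restrict \<xi> J) * exp (L\<^sup>2 / 2) \<partial>gaussian I')"
  proof (rule Bochner_Integration.integral_cong[OF refl])
    fix \<xi> :: "'k \<Rightarrow> real"
    have "restrict (\<xi>(k := s)) J = restrict \<xi> J" for s
      using assms(2) by (auto simp: restrict_def)
    then show "(\<integral>s. indicator E (restrict (\<xi>(k := s)) J) * exp (L * (\<xi>(k := s)) k) \<partial>gauss) =
        indicator E (restrict \<xi> J) * exp (L\<^sup>2 / 2)"
      by (simp add: integral_gauss_exp)
  qed
  also have "\<dots> = exp (L\<^sup>2 / 2) * (\<integral>\<xi>. indicator E (restrict \<xi> J) \<partial>gaussian I')"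
    by simp
  also have "(\<integral>\<xi>. indicator E (restrict \<xi> J) \<partial>gaussian I') =
      (\<integral>\<xi>. indicator ((\<lambda>\<xi>. restrict \<xi> J) -` E \<inter> space (gaussian I')) \<xi> \<partial>gaussian I')"
    by (rule Bochner_Integration.integral_cong[OF refl]) (auto simp: indicator_def)
  also have "\<dots> = measure (gaussian J) E"
    using measure_gaussian_restrict[OF assms(1) I'(4) E] by simp
  finally show "(\<integral>\<xi>. indicator E (restrict \<xi> J) * exp (L * \<xi> k) \<partial>gaussian I) =
      exp (L\<^sup>2 / 2) * measure (gaussian J) E" .
qed

text \<open>As \<open>a \<rightarrow> 0\<close> the functional \<open>(\<Sum>x. exp (- c / a * \<dots>)) powr a\<close> becomes a maximum over \<open>X\<close>.\<close>

lemma gordon_bound_finite: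
  fixes X :: "(nat \<Rightarrow> real) set"
  assumes X: "finite X" and unit: "\<And>x. x \<in> X \<Longrightarrow> L2_set x {..<n} = 1"
    and d: "0 < d" and c: "0 < c"
    and E: "E \<in> sets (gaussian ({..<m} \<times> {..<n}))"
      "\<And>\<xi>. \<xi> \<in> E \<Longrightarrow> \<exists>x\<in>X. viol m \<kappa> d (\<lambda>i. \<Sum>j<n. x j * \<xi> (i, j)) \<le> \<eta>"
  shows "exp (c\<^sup>2 / 2) * exp (- c * \<eta>) * measure (gaussian ({..<m} \<times> {..<n})) E
    \<le> (\<integral>\<xi>. decoupled m n \<kappa> c \<xi> \<partial>gaussian ({..m} \<times> {..n}))"
proof (cases "X = {}")
  case True
  then have "E = {}" using E(2) by auto
  then show ?thesis
    by (auto intro!: Bochner_Integration.integral_nonneg simp: decoupled_def)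
next
  case False
  let ?I = "{..m} \<times> {..n}" and ?J = "{..<m} \<times> {..<n}"
  let ?P = "\<lambda>\<xi>. linear_field (X \<times> {..m}) ?I (gordon_coeff True m n) \<xi>"
  let ?Q = "\<lambda>\<xi>. linear_field (X \<times> {..m}) ?I (gordon_coeff False m n) \<xi>"
  let ?R = "\<integral>\<xi>. decoupled m n \<kappa> c \<xi> \<partial>gaussian ?I"
  let ?L = "exp (c\<^sup>2 / 2) * exp (- c * \<eta>) * measure (gaussian ?J) E"
  define ind where "ind \<xi> = indicator E (restrict \<xi> ?J) * exp (- c * \<xi> (m, n))" for \<xi> :: "nat \<times> nat \<Rightarrow> real"
  have JI: "?J \<subseteq> ?I" by auto
  have ind: "integrable (gaussian ?I) ind" "(\<integral>\<xi>. ind \<xi> \<partial>gaussian ?I) = exp (c\<^sup>2 / 2) * measure (gaussian ?J) E"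
    using integral_indicator_exp[of ?J "(m, n)" ?I E "- c", OF _ _ _ JI _ E(1)] unfolding ind_def[abs_def] by auto
  have step: "?L \<le> real (card X) powr a * ?R" if a: "0 < a" "a \<le> 1" for a
  proof -
    \<comment> \<open>Keeping \<open>a * b = c\<close> fixed, the power \<open>a\<close> of every
      weight has the exponent \<open>c\<close>.\<close>
    define b where "b = c / a"
    have b: "0 < b" "b * a = c" "a * b = c" using a c by (auto simp: b_def)
    have C1: "(\<Sum>j<n. x j * y j) \<le> 1" if "x \<in> X" "y \<in> X" for x y
      using sum_mult_le_L2_set[of x y "{..<n}"] unit that by simp
    have C2: "(\<Sum>j<n. x j * x j) = 1" if "x \<in> X" for x
      using unit[OF that] by (simp add: L2_set_unit_iff)
    have disj: "gordon_coeff True m n p k * gordon_coeff False m n q k = 0" for p q k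
      by (auto simp: gordon_coeff_def)
    have cov: "(\<Sum>k\<in>?I. gordon_coeff True m n (x, i) k * gordon_coeff True m n (y, j) k
        - gordon_coeff False m n (x, i) k * gordon_coeff False m n (y, j) k) =
        (if i = j then (if i < m then (\<Sum>j<n. x j * y j) - 1 else 1 - (\<Sum>j<n. x j * y j)) else 0)"
      if "i \<le> m" "j \<le> m" for x y i j
      using that by (simp add: sum_subtractf gordon_coeff_cov)
    have finI: "finite ?I" by simp
    note G = gordon_comparison_smooth[OF X False finI d b(1) a disj cov C1 C2, of \<kappa>]
    have "?L = (\<integral>\<xi>. exp (- c * \<eta>) * ind \<xi> \<partial>gaussian ?I)"
      using ind by simp
    also have "\<dots> \<le> (\<integral>\<xi>. partition_sum X m \<kappa> d b (?P \<xi>) powr a \<partial>gaussian ?I)"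
    proof (intro integral_mono G(2) integrable_mult_right ind(1))
      fix \<xi> :: "nat \<times> nat \<Rightarrow> real"
      show "exp (- c * \<eta>) * ind \<xi> \<le> partition_sum X m \<kappa> d b (?P \<xi>) powr a"
      proof (cases "restrict \<xi> ?J \<in> E")
        case True
        then obtain x where x: "x \<in> X" "viol m \<kappa> d (\<lambda>i. \<Sum>j<n. x j * restrict \<xi> ?J (i, j)) \<le> \<eta>"
          using E(2) by blast
        have "viol m \<kappa> d (\<lambda>i. \<Sum>j<n. x j * restrict \<xi> ?J (i, j)) = viol m \<kappa> d (\<lambda>i. \<Sum>j<n. x j * \<xi> (i, j))"
          by (intro viol_cong) simp
        with x have v: "viol m \<kappa> d (\<lambda>i. \<Sum>j<n. x j * \<xi> (i, j)) \<le> \<eta>" by simp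
        let ?e = "exp (- b * (viol m \<kappa> d (\<lambda>i. \<Sum>j<n. x j * \<xi> (i, j)) + \<xi> (m, n)))"
        have "exp (- c * \<eta>) * ind \<xi> = exp (- (c * (\<eta> + \<xi> (m, n))))"
          using True by (simp add: ind_def exp_add[symmetric] algebra_simps)
        also have "\<dots> \<le> exp (- (c * (viol m \<kappa> d (\<lambda>i. \<Sum>j<n. x j * \<xi> (i, j)) + \<xi> (m, n))))"
          using c v by simp
        also have "\<dots> = ?e powr a"
          by (simp add: exp_powr_real b(2)[symmetric] mult_ac)
        also have "\<dots> \<le> partition_sum X m \<kappa> d b (?P \<xi>) powr a"
          unfolding partition_sum_gordon_coeff(1)[OF X]
          using X x a by (intro powr_mono2 member_le_sum[of x X "\<lambda>x. exp (- b * (viol m \<kappa> d (\<lambda>i. \<Sum>j<n. x j * \<xi> (i, j)) + \<xi> (m, n)))"]) auto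
        finally show ?thesis .
      qed (simp add: ind_def)
    qed
    also have "\<dots> \<le> (\<integral>\<xi>. partition_sum X m \<kappa> d b (?Q \<xi>) powr a \<partial>gaussian ?I)"
      by (rule G(1))
    also have "\<dots> \<le> (\<integral>\<xi>. real (card X) powr a * decoupled m n \<kappa> c \<xi> \<partial>gaussian ?I)"
    proof (intro integral_mono G(3) integrable_mult_right integrable_decoupled c)
      fix \<xi> :: "nat \<times> nat \<Rightarrow> real"
      let ?v = "L2_set (\<lambda>i. max 0 (\<xi> (i, n) + \<kappa>)) {..<m}" and ?h = "L2_set (\<lambda>j. \<xi> (m, j)) {..<n}"
      have v: "?v \<le> viol m \<kappa> d (\<lambda>i. \<xi> (i, n))"
        unfolding L2_set_def viol_def
        by (intro real_sqrt_le_mono) (simp add: add_increasing max_sq_le_softsq sum_mono)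
      \<comment> \<open>Every summand obeys the same bound, free of \<open>x\<close>: as
        \<open>x\<close> is a unit vector, \<open>- x . h\<close> is at most the norm of
        \<open>h\<close>.\<close>
      have "exp (- b * (viol m \<kappa> d (\<lambda>i. \<xi> (i, n)) + (\<Sum>j<n. x j * \<xi> (m, j)))) \<le> exp (b * (?h - ?v))"
        if "x \<in> X" for x
      proof -
        have "(\<Sum>j<n. - x j * \<xi> (m, j)) \<le> ?h"
          using sum_mult_le_L2_set[of "\<lambda>j. - x j" "\<lambda>j. \<xi> (m, j)" "{..<n}"] unit[OF that]
          by (simp add: L2_set_def)
        then have "- (viol m \<kappa> d (\<lambda>i. \<xi> (i, n)) + (\<Sum>j<n. x j * \<xi> (m, j))) \<le> ?h - ?v"
          using v by (simp add: sum_negf)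
        from mult_left_mono[OF this less_imp_le[OF b(1)]] show ?thesis
          by (simp only: mult_minus_left mult_minus_right exp_le_cancel_iff)
      qed
      then have "partition_sum X m \<kappa> d b (?Q \<xi>) \<le> real (card X) * exp (b * (?h - ?v))"
        unfolding partition_sum_gordon_coeff(2)[OF X] by (rule sum_bounded_above)
      then have "partition_sum X m \<kappa> d b (?Q \<xi>) powr a \<le> (real (card X) * exp (b * (?h - ?v))) powr a"
        unfolding partition_sum_gordon_coeff(2)[OF X] using a
        by (intro powr_mono2) (auto intro: sum_nonneg)
      also have "\<dots> = real (card X) powr a * exp (c * (?h - ?v))"
        by (simp add: powr_mult exp_powr_real b(2)[symmetric] mult_ac)
      also have "exp (c * (?h - ?v)) = decoupled m n \<kappa> c \<xi>"
        by (simp add: decoupled_def exp_add[symmetric] algebra_simps)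
      finally show "partition_sum X m \<kappa> d b (?Q \<xi>) powr a \<le> real (card X) powr a * decoupled m n \<kappa> c \<xi>" .
    qed
    also have "\<dots> = real (card X) powr a * ?R"
      by simp
    finally show ?thesis .
  qed
  \<comment> \<open>The number of points costs only \<open>card X powr a\<close>, which tends to 1.
    Nonemptiness matters, since \<open>0 powr 0 = 0\<close>.\<close>
  have "((\<lambda>a. real (card X) powr a * ?R) \<longlongrightarrow> real (card X) powr 0 * ?R) (at_right 0)"
    using X False by (intro tendsto_intros) auto
  moreover have "eventually (\<lambda>a. ?L \<le> real (card X) powr a * ?R) (at_right 0)"
    using eventually_at_right_real[of 0 "1::real", OF zero_less_one]
    by eventually_elim (rule step, simp_all)
  ultimately have "?L \<le> real (card X) powr 0 * ?R"
    by (rule tendsto_lowerbound) simp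
  then show ?thesis
    using X False by simp
qed

section \<open>From finite sets to the sphere\<close>

text \<open>Normalised rational vectors rather than unit vectors with rational entries: their
  density follows from that of the rationals, coordinate by coordinate. For \<open>n = 0\<close> the
  set is empty, as there are no unit vectors.\<close>

definition rational_sphere :: "nat \<Rightarrow> (nat \<Rightarrow> real) set" where
  "rational_sphere n = (\<lambda>q j. q j / L2_set q {..<n}) `
     {q \<in> PiE {..<n} (\<lambda>_. \<rat>). L2_set q {..<n} \<noteq> 0}"

lemma countable_rational_sphere: "countable (rational_sphere n)"
  unfolding rational_sphere_def
  by (intro countable_image countable_subset[OF _ countable_PiE[of "{..<n}" "\<lambda>_. \<rat>"]])
    (auto simp: countable_rat)

lemma L2_set_rational_sphere:
  assumes "x \<in> rational_sphere n"
  shows "L2_set x {..<n} = 1"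
proof -
  from assms obtain q where q: "L2_set q {..<n} \<noteq> 0" "x = (\<lambda>j. q j / L2_set q {..<n})"
    unfolding rational_sphere_def by auto
  have "L2_set x {..<n} = L2_set (\<lambda>j. q j * inverse (L2_set q {..<n})) {..<n}"
    by (simp add: q(2) field_simps)
  also have "\<dots> = L2_set q {..<n} * inverse (L2_set q {..<n})"
    by (rule L2_set_left_distrib[symmetric]) simp
  finally show ?thesis
    using q(1) by simp
qed

text \<open>Rationals converging to the entries of \<open>x\<close> have norms tending to 1, so
  their normalisations tend to \<open>x\<close> too, and the finitely many constraints hold together
  far along the sequence. The slack \<open>d\<close> is there because a constraint may be tight at
  \<open>x\<close>.\<close>

lemma rational_sphere_approx:
  fixes A :: "nat \<Rightarrow> nat \<Rightarrow> real"
  assumes x: "L2_set x {..<n} = 1" and feas: "\<And>i. i < m \<Longrightarrow> \<kappa> \<le> (\<Sum>j<n. A i j * x j)" and d: "0 < d"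
  shows "\<exists>q\<in>rational_sphere n. \<forall>i<m. \<kappa> - d \<le> (\<Sum>j<n. A i j * q j)"
proof -
  have "\<forall>k j. \<exists>r. r \<in> \<rat> \<and> x j < r \<and> r < x j + inverse (real (Suc k))"
    using Rats_dense_in_real by (auto simp: Bex_def)
  then obtain r where r: "\<And>j k. r k j \<in> \<rat>" "\<And>j k. x j < r k j" "\<And>j k. r k j < x j + inverse (real (Suc k))"
    by metis
  have r_lim: "(\<lambda>k. r k j) \<longlonglongrightarrow> x j" for j
  proof (rule tendsto_sandwich[of "\<lambda>_. x j" _ _ "\<lambda>k. x j + inverse (real (Suc k))"])
    show "(\<lambda>k. x j + inverse (real (Suc k))) \<longlonglongrightarrow> x j"
      by (rule LIMSEQ_inverse_real_of_nat_add)
  qed (use r in \<open>auto intro!: always_eventually less_imp_le\<close>)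
  define q where "q k = restrict (r k) {..<n}" for k
  define l where "l k = L2_set (q k) {..<n}" for k
  have q_lim: "(\<lambda>k. q k j) \<longlonglongrightarrow> x j" if "j < n" for j
    using that r_lim by (simp add: q_def)
  have l_lim: "l \<longlonglongrightarrow> 1"
    unfolding l_def[abs_def] x[symmetric] L2_set_def by (intro tendsto_intros q_lim) auto
  have lim: "(\<lambda>k. \<Sum>j<n. A i j * (q k j / l k)) \<longlonglongrightarrow> (\<Sum>j<n. A i j * (x j / 1))" for i
    by (intro tendsto_intros q_lim l_lim) auto
  have ev: "eventually (\<lambda>k. \<kappa> - d < (\<Sum>j<n. A i j * (q k j / l k))) sequentially" if "i < m" for i
    by (rule order_tendstoD(1)[OF lim]) (use feas[OF that] d in auto)
  have "eventually (\<lambda>k. \<forall>i\<in>{..<m}. \<kappa> - d < (\<Sum>j<n. A i j * (q k j / l k))) sequentially"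
    by (rule eventually_ball_finite) (use ev in auto)
  moreover have "eventually (\<lambda>k. 0 < l k) sequentially"
    by (rule order_tendstoD(1)[OF l_lim]) simp
  ultimately have "eventually (\<lambda>k. (\<forall>i\<in>{..<m}. \<kappa> - d < (\<Sum>j<n. A i j * (q k j / l k))) \<and> 0 < l k) sequentially"
    by (rule eventually_conj)
  from eventually_happens'[OF sequentially_bot this]
  obtain k where k: "\<forall>i\<in>{..<m}. \<kappa> - d < (\<Sum>j<n. A i j * (q k j / l k))" "0 < l k"
    by blast
  have "q k \<in> PiE {..<n} (\<lambda>_. \<rat>)"
    using r(1) by (auto simp: q_def)
  then have "(\<lambda>j. q k j / l k) \<in> rational_sphere n"
    using k(2) unfolding rational_sphere_def l_def by (intro image_eqI[where x = "q k"]) simp_all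
  then show ?thesis
    using k(1) by (intro bexI[where x = "\<lambda>j. q k j / l k"]) (simp_all add: less_imp_le)
qed

text \<open>One direction is density. For the other, compactness gives nearly feasible points a
  limit on the sphere, and the slack vanishes along the subsequence. The right side uses countable
  operations only, which makes the feasibility event measurable.\<close>

lemma spherical_feasible_iff_rational:
  "spherical_feasible m n \<kappa> A \<longleftrightarrow>
    (\<forall>k. \<exists>q\<in>rational_sphere n. \<forall>i<m. \<kappa> - inverse (real (Suc k)) \<le> (\<Sum>j<n. A i j * q j))"
proof
  assume "spherical_feasible m n \<kappa> A"
  then obtain x where x: "L2_set x {..<n} = 1" "\<And>i. i < m \<Longrightarrow> \<kappa> \<le> (\<Sum>j<n. A i j * x j)"
    unfolding spherical_feasible_def by (elim exE conjE) simp
  show "\<forall>k. \<exists>q\<in>rational_sphere n. \<forall>i<m. \<kappa> - inverse (real (Suc k)) \<le> (\<Sum>j<n. A i j * q j)"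
  proof
    show "\<exists>q\<in>rational_sphere n. \<forall>i<m. \<kappa> - inverse (real (Suc k)) \<le> (\<Sum>j<n. A i j * q j)" for k
      by (rule rational_sphere_approx[OF x]) simp_all
  qed
next
  assume "\<forall>k. \<exists>q\<in>rational_sphere n. \<forall>i<m. \<kappa> - inverse (real (Suc k)) \<le> (\<Sum>j<n. A i j * q j)"
  then have "\<forall>k. \<exists>q. q \<in> rational_sphere n \<and> (\<forall>i<m. \<kappa> - inverse (real (Suc k)) \<le> (\<Sum>j<n. A i j * q j))"
    unfolding Bex_def .
  from choice[OF this] obtain f
    where "\<forall>k. f k \<in> rational_sphere n \<and> (\<forall>i<m. \<kappa> - inverse (real (Suc k)) \<le> (\<Sum>j<n. A i j * f k j))" ..
  then have f: "f k \<in> rational_sphere n"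
    "i < m \<Longrightarrow> \<kappa> - inverse (real (Suc k)) \<le> (\<Sum>j<n. A i j * f k j)" for k i
    by simp_all
  have unit: "L2_set (f k) {..<n} = 1" for k
    by (rule L2_set_rational_sphere[OF f(1)])
  have "\<bar>f k j\<bar> \<le> 1" if "j < n" for j k
  proof -
    have "\<bar>f k j\<bar> = L2_set (f k) {j}"
      by (simp add: L2_set_def)
    also have "\<dots> \<le> L2_set (f k) {..<n}"
      unfolding L2_set_def using that by (intro real_sqrt_le_mono sum_mono2) auto
    finally show ?thesis
      by (simp add: unit)
  qed
  then have bounded: "bounded ((\<lambda>x. x j) ` range f)" if "j \<in> {..<n}" for j
    using that by (intro boundedI[of _ 1]) auto
  \<comment> \<open>Bolzano-Weierstrass in \<open>n\<close> coordinates at once. Vectors are plain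
    functions, so \<open>proj\<close> is application and \<open>unproj\<close> the identity.\<close>
  have "\<forall>\<delta>\<subseteq>{..<n}. \<exists>l r. strict_mono (r :: nat \<Rightarrow> nat) \<and>
      (\<forall>\<epsilon>>0. eventually (\<lambda>k. \<forall>j\<in>\<delta>. dist (f (r k) j) (l j) < \<epsilon>) sequentially)"
    by (rule compact_lemma_general[where proj = "\<lambda>x j. x j" and unproj = "\<lambda>x. x"])
      (simp_all add: bounded)
  from this[THEN spec, of "{..<n}", THEN mp, OF subset_refl]
  obtain l r where lr: "strict_mono (r :: nat \<Rightarrow> nat) \<and>
      (\<forall>\<epsilon>>0. eventually (\<lambda>k. \<forall>j\<in>{..<n}. dist (f (r k) j) (l j) < \<epsilon>) sequentially)"
    by (elim exE)
  then have r: "strict_mono r" ..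
  have l: "eventually (\<lambda>k. \<forall>j\<in>{..<n}. dist (f (r k) j) (l j) < \<epsilon>) sequentially" if "0 < \<epsilon>" for \<epsilon>
    using lr that by simp
  have lim: "(\<lambda>k. f (r k) j) \<longlonglongrightarrow> l j" if "j < n" for j
  proof (rule tendstoI)
    fix \<epsilon> :: real assume "0 < \<epsilon>"
    from l[OF this] show "eventually (\<lambda>k. dist (f (r k) j) (l j) < \<epsilon>) sequentially"
      by eventually_elim (use that in auto)
  qed
  have "(\<lambda>k. L2_set (f (r k)) {..<n}) \<longlonglongrightarrow> L2_set l {..<n}"
    unfolding L2_set_def by (intro tendsto_intros lim) auto
  then have "L2_set l {..<n} = 1"
    by (simp add: unit LIMSEQ_const_iff)
  moreover have "\<kappa> \<le> (\<Sum>j<n. A i j * l j)" if "i < m" for i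
  proof (rule LIMSEQ_le)
    show "(\<lambda>k. \<Sum>j<n. A i j * f (r k) j) \<longlonglongrightarrow> (\<Sum>j<n. A i j * l j)"
      by (intro tendsto_intros lim) auto
    show "(\<lambda>k. \<kappa> - inverse (real (Suc (r k)))) \<longlonglongrightarrow> \<kappa>"
      using LIMSEQ_subseq_LIMSEQ[OF LIMSEQ_inverse_real_of_nat_add_minus r, of \<kappa>] by (simp add: o_def)
    show "\<exists>N. \<forall>k\<ge>N. \<kappa> - inverse (real (Suc (r k))) \<le> (\<Sum>j<n. A i j * f (r k) j)"
      using f(2)[OF that] by blast
  qed
  ultimately show "spherical_feasible m n \<kappa> A"
    unfolding spherical_feasible_def by (intro exI[where x = l]) simp
qed

lemma measurable_spherical_feasible:
  assumes H: "\<And>i j. i < m \<Longrightarrow> j < n \<Longrightarrow> H i j \<in> borel_measurable M"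
  shows "{\<omega> \<in> space M. spherical_feasible m n \<kappa> (\<lambda>i j. H i j \<omega>)} \<in> sets M"
proof -
  have Hm: "(\<lambda>\<omega>. \<Sum>j<n. H i j \<omega> * q j) \<in> borel_measurable M" if "i < m" for i and q :: "nat \<Rightarrow> real"
    using that by (intro borel_measurable_sum borel_measurable_times H) auto
  have "Measurable.pred M (\<lambda>\<omega>. r \<le> (\<Sum>j<n. H i j \<omega> * q j))" if "i < m" for r i q
    using Hm[OF that, of q] by measurable
  then have "Measurable.pred M (\<lambda>\<omega>. \<forall>i\<in>{..<m}. r \<le> (\<Sum>j<n. H i j \<omega> * q j))" for r q
    by (intro pred_intros_finite(3)) auto
  then have "Measurable.pred M (\<lambda>\<omega>. \<forall>k. \<exists>q\<in>rational_sphere n.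
      \<forall>i\<in>{..<m}. \<kappa> - inverse (real (Suc k)) \<le> (\<Sum>j<n. H i j \<omega> * q j))"
    unfolding pred_def
    by (intro sets.sets_Collect_countable_All sets.sets_Collect_countable_Ex' countable_rational_sphere)
  then show ?thesis
    by (simp only: spherical_feasible_iff_rational pred_def Ball_def lessThan_iff)
qed

text \<open>For \<open>v = - H x\<close> the hypothesis is feasibility of \<open>x\<close> up to the
  slack \<open>d\<close>. With \<open>m\<close> fixed, the bound vanishes with
  \<open>d\<close>.\<close>

lemma viol_le:
  assumes d: "0 < d" and v: "\<And>i. i < m \<Longrightarrow> v i + \<kappa> \<le> d"
  shows "viol m \<kappa> d v \<le> d * sqrt (1 + 4 * real m)"
proof -
  have "(\<Sum>i<m. softsq d (v i + \<kappa>)) \<le> (\<Sum>i<m. 4 * d\<^sup>2)"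
    using v d by (intro sum_mono softsq_le_of_le) auto
  then have "d\<^sup>2 + (\<Sum>i<m. softsq d (v i + \<kappa>)) \<le> d\<^sup>2 * (1 + 4 * real m)"
    by (simp add: algebra_simps)
  then have "viol m \<kappa> d v \<le> sqrt (d\<^sup>2 * (1 + 4 * real m))"
    unfolding viol_def by (rule real_sqrt_le_mono)
  also have "\<dots> = d * sqrt (1 + 4 * real m)"
    using d by (simp add: real_sqrt_mult)
  finally show ?thesis .
qed

text \<open>Initial segments of an enumeration of \<open>rational_sphere\<close> exhaust the event
  up to the slack \<open>d\<close>. The bound \<open>R\<close> depends neither on their size nor on
  \<open>d\<close>, so continuity from below and then the limit in \<open>d\<close> preserve
  it.\<close>

lemma gordon_bound_sphere:
  fixes \<kappa> c :: real and m n :: nat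
  assumes c: "0 < c"
  defines "J \<equiv> {..<m} \<times> {..<n}"
  shows "measure (gaussian J) {\<xi> \<in> space (gaussian J). spherical_feasible m n \<kappa> (\<lambda>i j. \<xi> (i, j))}
    \<le> exp (- c\<^sup>2 / 2) * (\<integral>\<xi>. decoupled m n \<kappa> c \<xi> \<partial>gaussian ({..m} \<times> {..n}))"
proof -
  let ?F = "{\<xi> \<in> space (gaussian J). spherical_feasible m n \<kappa> (\<lambda>i j. \<xi> (i, j))}"
  define R where "R = (\<integral>\<xi>. decoupled m n \<kappa> c \<xi> \<partial>gaussian ({..m} \<times> {..n}))"
  interpret G: prob_space "gaussian J" by (rule prob_space_gaussian)
  have comp: "(\<lambda>\<xi>. \<xi> (i, j)) \<in> borel_measurable (gaussian J)" if "i < m" "j < n" for i j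
    using that by (simp add: J_def)
  have le: "exp (c\<^sup>2 / 2) * exp (- c * (d * sqrt (1 + 4 * real m))) * measure (gaussian J) ?F \<le> R"
    if d: "0 < d" for d
  proof (cases "rational_sphere n = {}")
    \<comment> \<open>This is the case \<open>n = 0\<close>; the enumeration below needs a nonempty
      set.\<close>
    case True
    then have "?F = {}"
      by (auto simp: spherical_feasible_iff_rational)
    moreover have "0 \<le> R"
      unfolding R_def decoupled_def by (rule Bochner_Integration.integral_nonneg) simp
    ultimately show ?thesis
      by (simp only: measure_empty mult_zero_right)
  next
    case False
    define e where "e = from_nat_into (rational_sphere n)"
    have e: "range e = rational_sphere n"
      unfolding e_def using False countable_rational_sphere by (rule range_from_nat_into)
    define E where "E N = {\<xi> \<in> space (gaussian J). \<exists>k<N. \<forall>i<m. \<kappa> - d \<le> (\<Sum>j<n. \<xi> (i, j) * e k j)}" for N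
    have E_sets: "E N \<in> sets (gaussian J)" for N
    proof -
      have "(\<lambda>\<xi>. \<Sum>j<n. \<xi> (i, j) * e k j) \<in> borel_measurable (gaussian J)" if "i < m" for i k
        using that by (intro borel_measurable_sum borel_measurable_times comp) auto
      then have "Measurable.pred (gaussian J) (\<lambda>\<xi>. \<kappa> - d \<le> (\<Sum>j<n. \<xi> (i, j) * e k j))" if "i < m" for i k
        using that by measurable
      then have "Measurable.pred (gaussian J) (\<lambda>\<xi>. \<exists>k\<in>{..<N}. \<forall>i\<in>{..<m}. \<kappa> - d \<le> (\<Sum>j<n. \<xi> (i, j) * e k j))"
        by (intro pred_intros_finite(4) pred_intros_finite(3)) auto
      moreover have "E N = {\<xi> \<in> space (gaussian J). \<exists>k\<in>{..<N}. \<forall>i\<in>{..<m}. \<kappa> - d \<le> (\<Sum>j<n. \<xi> (i, j) * e k j)}"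
        unfolding E_def by blast
      ultimately show ?thesis
        by (simp only: pred_def)
    qed
    have bound: "exp (c\<^sup>2 / 2) * exp (- c * (d * sqrt (1 + 4 * real m))) * measure (gaussian J) (E N) \<le> R" for N
      unfolding R_def J_def
    \<comment> \<open>The sign flip: \<open>viol\<close> penalises positive values of
      \<open>\<kappa> + v\<close>, so the test vector is the negative of the nearly feasible
      one.\<close>
    proof (rule gordon_bound_finite[where X = "(\<lambda>k j. - e k j) ` {..<N}" and d = d])
      show "L2_set x {..<n} = 1" if "x \<in> (\<lambda>k j. - e k j) ` {..<N}" for x
      proof -
        from that obtain k where "x = (\<lambda>j. - e k j)" by auto
        moreover have "L2_set (e k) {..<n} = 1"
          by (rule L2_set_rational_sphere) (use e in auto)
        ultimately show ?thesis
          by (simp add: L2_set_def)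
      qed
      show "E N \<in> sets (gaussian ({..<m} \<times> {..<n}))"
        using E_sets[of N] by (simp add: J_def)
      show "\<exists>x\<in>(\<lambda>k j. - e k j) ` {..<N}. viol m \<kappa> d (\<lambda>i. \<Sum>j<n. x j * \<xi> (i, j)) \<le> d * sqrt (1 + 4 * real m)"
        if "\<xi> \<in> E N" for \<xi>
      proof -
        from that obtain k where k: "k < N" "\<And>i. i < m \<Longrightarrow> \<kappa> - d \<le> (\<Sum>j<n. \<xi> (i, j) * e k j)"
          by (auto simp: E_def)
        have "viol m \<kappa> d (\<lambda>i. \<Sum>j<n. - e k j * \<xi> (i, j)) \<le> d * sqrt (1 + 4 * real m)"
        proof (rule viol_le[OF d])
          fix i assume "i < m"
          from k(2)[OF this] show "(\<Sum>j<n. - e k j * \<xi> (i, j)) + \<kappa> \<le> d"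
            by (simp add: sum_negf mult.commute)
        qed
        then show ?thesis
          using k(1) by (intro bexI[where x = "\<lambda>j. - e k j"] imageI) auto
      qed
    qed (use d c in auto)
    have "incseq E"
      unfolding incseq_def E_def by (blast intro: less_le_trans)
    then have "(\<lambda>N. measure (gaussian J) (E N)) \<longlonglongrightarrow> measure (gaussian J) (\<Union>N. E N)"
      using E_sets by (intro G.finite_Lim_measure_incseq) auto
    then have "(\<lambda>N. exp (c\<^sup>2 / 2) * exp (- c * (d * sqrt (1 + 4 * real m))) * measure (gaussian J) (E N)) \<longlonglongrightarrow>
        exp (c\<^sup>2 / 2) * exp (- c * (d * sqrt (1 + 4 * real m))) * measure (gaussian J) (\<Union>N. E N)"
      by (intro tendsto_intros)
    then have *: "exp (c\<^sup>2 / 2) * exp (- c * (d * sqrt (1 + 4 * real m))) * measure (gaussian J) (\<Union>N. E N) \<le> R"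
      by (rule LIMSEQ_le_const2) (use bound in blast)
    have "?F \<subseteq> (\<Union>N. E N)"
    proof
      fix \<xi> assume xi: "\<xi> \<in> ?F"
      then obtain x where "L2_set x {..<n} = 1" "\<And>i. i < m \<Longrightarrow> \<kappa> \<le> (\<Sum>j<n. \<xi> (i, j) * x j)"
        by (auto simp: spherical_feasible_def)
      then have "\<exists>q\<in>rational_sphere n. \<forall>i<m. \<kappa> - d \<le> (\<Sum>j<n. \<xi> (i, j) * q j)"
        using d by (rule rational_sphere_approx)
      then obtain k where "\<forall>i<m. \<kappa> - d \<le> (\<Sum>j<n. \<xi> (i, j) * e k j)"
        unfolding e[symmetric] by auto
      then have "\<xi> \<in> E (Suc k)"
        using xi by (auto simp: E_def)
      then show "\<xi> \<in> (\<Union>N. E N)" by blast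
    qed
    then have "measure (gaussian J) ?F \<le> measure (gaussian J) (\<Union>N. E N)"
      using E_sets by (intro G.finite_measure_mono) auto
    then show ?thesis
      by (rule order_trans[OF mult_left_mono *]) simp
  qed
  have "((\<lambda>d. exp (c\<^sup>2 / 2) * exp (- c * (d * sqrt (1 + 4 * real m))) * measure (gaussian J) ?F) \<longlongrightarrow>
      exp (c\<^sup>2 / 2) * exp (- c * (0 * sqrt (1 + 4 * real m))) * measure (gaussian J) ?F) (at_right 0)"
    by (intro tendsto_intros)
  moreover have "eventually (\<lambda>d. exp (c\<^sup>2 / 2) * exp (- c * (d * sqrt (1 + 4 * real m))) * measure (gaussian J) ?F \<le> R) (at_right 0)"
    using eventually_at_right_less[of 0] by eventually_elim (rule le)
  ultimately have "exp (c\<^sup>2 / 2) * exp (- c * (0 * sqrt (1 + 4 * real m))) * measure (gaussian J) ?F \<le> R"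
    by (rule tendsto_upperbound) simp
  then have "exp (c\<^sup>2 / 2) * measure (gaussian J) ?F \<le> R"
    by simp
  then have "exp (- c\<^sup>2 / 2) * (exp (c\<^sup>2 / 2) * measure (gaussian J) ?F) \<le> exp (- c\<^sup>2 / 2) * R"
    by (intro mult_left_mono) auto
  also have "exp (- c\<^sup>2 / 2) * (exp (c\<^sup>2 / 2) * measure (gaussian J) ?F) = measure (gaussian J) ?F"
    unfolding mult.assoc[symmetric] exp_add[symmetric] by simp
  finally show ?thesis
    by (simp add: R_def)
qed

section \<open>Evaluation of the decoupled expectation\<close>

lemma std_normal_matrix_borel_measurable:
  assumes "std_normal_matrix M m n H" "i < m" "j < n"
  shows "H i j \<in> borel_measurable M"
  using assms distributed_measurable[of M lborel "H i j"] unfolding std_normal_matrix_def by auto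

text \<open>Feasibility depends on finitely many entries, and by independence their joint law is the
  product measure \<open>gaussian J\<close>; the event is measurable, so its probability can be
  computed there.\<close>

lemma measure_spherical_feasible_gaussian:
  assumes H: "std_normal_matrix M m n H" and mn: "0 < m" "0 < n"
  defines "J \<equiv> {..<m} \<times> {..<n}"
  shows "measure M {\<omega> \<in> space M. spherical_feasible m n \<kappa> (\<lambda>i j. H i j \<omega>)} =
    measure (gaussian J) {\<xi> \<in> space (gaussian J). spherical_feasible m n \<kappa> (\<lambda>i j. \<xi> (i, j))}"
    (is "_ = measure _ ?F")
proof -
  interpret prob_space M
    using H by (simp add: std_normal_matrix_def)
  define X where "X = (\<lambda>(i, j). H i j)"
  have rv: "X k \<in> borel_measurable M" if "k \<in> J" for k
    using that std_normal_matrix_borel_measurable[OF H] by (auto simp: X_def J_def)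
  have distr: "distr M borel (X k) = gauss" if k: "k \<in> J" for k
  proof -
    have "distributed M lborel (X k) (\<lambda>x. ennreal (std_normal_density x))"
      using H k by (auto simp: std_normal_matrix_def X_def J_def)
    from distributed_distr_eq_density[OF this] have "distr M lborel (X k) = gauss"
      by (simp add: gauss_def)
    moreover have "distr M lborel (X k) = distr M borel (X k)"
      by (rule distr_cong) auto
    ultimately show ?thesis by simp
  qed
  \<comment> \<open>Independence is characterised by the product law for nonempty index sets, hence
    the assumptions \<open>0 < m\<close> and \<open>0 < n\<close>.\<close>
  have "J \<noteq> {}" using mn by (auto simp: J_def)
  moreover have "indep_vars (\<lambda>_. borel) X J"
    using H by (simp add: std_normal_matrix_def X_def J_def)
  ultimately have "distr M (PiM J (\<lambda>_. borel)) (\<lambda>\<omega>. \<lambda>k\<in>J. X k \<omega>) = PiM J (\<lambda>k. distr M borel (X k))"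
    using indep_vars_iff_distr_eq_PiM'[where I = J and M' = "\<lambda>_. borel" and X = X] rv by simp
  also have "\<dots> = gaussian J"
    unfolding gaussian_def by (intro PiM_cong refl distr)
  finally have D: "distr M (PiM J (\<lambda>_. borel)) (\<lambda>\<omega>. \<lambda>k\<in>J. X k \<omega>) = gaussian J" .
  have Xm: "(\<lambda>\<omega>. \<lambda>k\<in>J. X k \<omega>) \<in> measurable M (PiM J (\<lambda>_. borel))"
    by (intro measurable_restrict rv)
  have "?F \<in> sets (gaussian J)"
  proof (rule measurable_spherical_feasible)
    fix i j assume "i < m" "j < n"
    then show "(\<lambda>\<xi>. \<xi> (i, j)) \<in> borel_measurable (gaussian J)"
      by (simp add: J_def)
  qed
  then have F: "?F \<in> sets (PiM J (\<lambda>_. borel))"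
    by simp
  have "measure (gaussian J) ?F = measure M ((\<lambda>\<omega>. \<lambda>k\<in>J. X k \<omega>) -` ?F \<inter> space M)"
    using measure_distr[OF Xm F] unfolding D .
  also have "(\<lambda>\<omega>. \<lambda>k\<in>J. X k \<omega>) -` ?F \<inter> space M =
      {\<omega> \<in> space M. spherical_feasible m n \<kappa> (\<lambda>i j. H i j \<omega>)}"
  proof -
    have "spherical_feasible m n \<kappa> (\<lambda>i j. (\<lambda>k\<in>J. X k \<omega>) (i, j)) \<longleftrightarrow>
        spherical_feasible m n \<kappa> (\<lambda>i j. H i j \<omega>)" for \<omega>
      unfolding spherical_feasible_def by (simp add: J_def X_def)
    then show ?thesis
      by auto
  qed
  finally show ?thesis ..
qed

section \<open>Gaussian integrals in closed form\<close>

lemma gauss_tail: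
  "(\<integral>x. indicator {a..} x * std_normal_density x \<partial>lborel) = erfc (a / sqrt 2) / 2"
proof -
  have "(\<integral>x. indicator {a..} x * std_normal_density x \<partial>lborel) =
      sqrt 2 * (\<integral>t. indicator {a..} (sqrt 2 * t) * std_normal_density (sqrt 2 * t) \<partial>lborel)"
    by (subst lborel_integral_real_affine[of "sqrt 2" _ 0]) auto
  also have "(\<lambda>t. indicator {a..} (sqrt 2 * t) * std_normal_density (sqrt 2 * t)) =
      (\<lambda>t. 1 / sqrt (2 * pi) * (indicator {a / sqrt 2..} t * exp (- t\<^sup>2)))"
    by (auto simp: std_normal_density_def indicator_def fun_eq_iff field_simps power_mult_distrib)
  also have "sqrt 2 * (\<integral>t. 1 / sqrt (2 * pi) * (indicator {a / sqrt 2..} t * exp (- t\<^sup>2)) \<partial>lborel) =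
      1 / sqrt pi * (\<integral>t. indicator {a / sqrt 2..} t * exp (- t\<^sup>2) \<partial>lborel)"
    by (simp add: real_sqrt_mult)
  also have "\<dots> = erfc (a / sqrt 2) / 2"
    by (simp add: erfc_def set_lebesgue_integral_def)
  finally show ?thesis .
qed

text \<open>This decodes the formula of \<open>I_per1\<close>. For \<open>x \<le> - \<kappa>\<close>
  the integrand is 1, which gives the first \<open>erfc\<close>. Beyond, \<open>x^2 / 2 + c / (4 *
  \<gamma>) * (x + \<kappa>)^2 = p * x^2 / 2 + q * x + r\<close>. Completing the square leads to the
  variable \<open>sqrt p * x + q / sqrt p\<close>, whose value at \<open>- \<kappa>\<close> is
  \<open>s\<close>, and to the prefactor \<open>C\<close>, which contains the Jacobian
  \<open>1 / sqrt p\<close>.\<close>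

lemma I_per1_eq_integral:
  assumes c: "0 < c" and \<gamma>: "0 < \<gamma>"
  shows "(\<integral>x. exp (- (c / (4 * \<gamma>)) * (max 0 (x + \<kappa>))\<^sup>2) \<partial>gauss) = I_per1 c \<gamma> \<kappa>"
proof -
  define p where "p = 1 + c / (2 * \<gamma>)"
  define q where "q = c * \<kappa> / (2 * \<gamma>)"
  define r where "r = c * \<kappa>\<^sup>2 / (4 * \<gamma>)"
  define s where "s = - \<kappa> * sqrt p + q / sqrt p"
  define E where "E = exp (q\<^sup>2 / (2 * p) - r)"
  have p: "0 < p" using c \<gamma> by (auto simp: p_def add_pos_pos)
  have sp: "0 < sqrt p" "sqrt p * sqrt p = p" using p by auto
  let ?N = "std_normal_density"
  have sq: "?N x * exp (- (c / (4 * \<gamma>)) * (x + \<kappa>)\<^sup>2) = E * ?N (sqrt p * x + q / sqrt p)" for x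
  proof -
    have "- x\<^sup>2 / 2 + - (c / (4 * \<gamma>)) * (x + \<kappa>)\<^sup>2 = - (p * x\<^sup>2) / 2 - q * x - r"
      using \<gamma> by (simp add: p_def q_def r_def power2_eq_square field_simps)
    also have "\<dots> = (q\<^sup>2 / (2 * p) - r) + - (sqrt p * x + q / sqrt p)\<^sup>2 / 2"
    proof -
      have "(sqrt p * x + q / sqrt p)\<^sup>2 = p * x\<^sup>2 + 2 * q * x + q\<^sup>2 / p"
        using sp p by (simp add: power2_sum power_mult_distrib power_divide)
      then show ?thesis using p by (simp add: field_simps)
    qed
    finally have "exp (- x\<^sup>2 / 2) * exp (- (c / (4 * \<gamma>)) * (x + \<kappa>)\<^sup>2) =
        E * exp (- (sqrt p * x + q / sqrt p)\<^sup>2 / 2)"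
      unfolding E_def exp_add[symmetric] by simp
    then show ?thesis
      by (simp add: std_normal_density_def)
  qed
  have int1: "integrable lborel (\<lambda>x. indicator {..- \<kappa>} x * ?N x)"
    using integrable_mult_indicator[of "{..- \<kappa>}" lborel ?N] by simp
  have int2: "integrable lborel (\<lambda>x. indicator {- \<kappa>..} x * (?N x * exp (- (c / (4 * \<gamma>)) * (x + \<kappa>)\<^sup>2)))"
  proof (rule Bochner_Integration.integrable_bound)
    show "integrable lborel ?N" by simp
    show "AE x in lborel. norm (indicator {- \<kappa>..} x * (?N x * exp (- (c / (4 * \<gamma>)) * (x + \<kappa>)\<^sup>2))) \<le> norm (?N x)"
    proof (rule AE_I2)
      fix x
      have "?N x * exp (- (c / (4 * \<gamma>)) * (x + \<kappa>)\<^sup>2) \<le> ?N x * 1"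
        using c \<gamma> by (intro mult_left_mono) auto
      then show "norm (indicator {- \<kappa>..} x * (?N x * exp (- (c / (4 * \<gamma>)) * (x + \<kappa>)\<^sup>2))) \<le> norm (?N x)"
        by (simp add: indicator_def)
    qed
  qed auto
  have "(\<integral>x. exp (- (c / (4 * \<gamma>)) * (max 0 (x + \<kappa>))\<^sup>2) \<partial>gauss) =
      (\<integral>x. ?N x * exp (- (c / (4 * \<gamma>)) * (max 0 (x + \<kappa>))\<^sup>2) \<partial>lborel)"
    by (rule integral_gauss) measurable
  also have "\<dots> = (\<integral>x. indicator {..- \<kappa>} x * ?N x +
      indicator {- \<kappa>..} x * (?N x * exp (- (c / (4 * \<gamma>)) * (x + \<kappa>)\<^sup>2)) \<partial>lborel)"
  proof (rule integral_cong_AE)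
    \<comment> \<open>Both half-lines contain \<open>- \<kappa>\<close>, so the splitting fails at
      this one point of measure zero.\<close>
    show "AE x in lborel. ?N x * exp (- (c / (4 * \<gamma>)) * (max 0 (x + \<kappa>))\<^sup>2) =
        indicator {..- \<kappa>} x * ?N x + indicator {- \<kappa>..} x * (?N x * exp (- (c / (4 * \<gamma>)) * (x + \<kappa>)\<^sup>2))"
      using AE_lborel_singleton[of "- \<kappa>"]
    proof eventually_elim
      case (elim x)
      then show ?case
        by (cases "x < - \<kappa>") (simp_all add: indicator_def max_def)
    qed
  qed measurable
  also have "\<dots> = (\<integral>x. indicator {..- \<kappa>} x * ?N x \<partial>lborel) +
      (\<integral>x. indicator {- \<kappa>..} x * (?N x * exp (- (c / (4 * \<gamma>)) * (x + \<kappa>)\<^sup>2)) \<partial>lborel)"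
    by (rule Bochner_Integration.integral_add[OF int1 int2])
  also have "(\<integral>x. indicator {..- \<kappa>} x * ?N x \<partial>lborel) = (\<integral>x. indicator {\<kappa>..} x * ?N x \<partial>lborel)"
    by (subst lborel_integral_real_affine[of "-1" _ 0])
      (auto simp: std_normal_density_def indicator_def intro!: Bochner_Integration.integral_cong)
  also have "\<dots> = erfc (\<kappa> / sqrt 2) / 2"
    by (rule gauss_tail)
  also have "(\<integral>x. indicator {- \<kappa>..} x * (?N x * exp (- (c / (4 * \<gamma>)) * (x + \<kappa>)\<^sup>2)) \<partial>lborel) =
      E / sqrt p * (\<integral>y. indicator {s..} y * ?N y \<partial>lborel)"
  proof -
    have ind: "indicator {- \<kappa>..} (- q / p + 1 / sqrt p * y) = (indicator {s..} y :: real)" for y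
    proof -
      have "- \<kappa> \<le> - q / p + 1 / sqrt p * y \<longleftrightarrow> sqrt p * - \<kappa> \<le> sqrt p * (- q / p + 1 / sqrt p * y)"
        using sp(1) by (simp only: mult_le_cancel_left_pos)
      also have "sqrt p * (- q / p + 1 / sqrt p * y) = y - q / sqrt p"
        using sp p by (simp add: field_simps)
      finally show ?thesis
        by (simp add: indicator_def s_def algebra_simps)
    qed
    have arg: "sqrt p * (- q / p + 1 / sqrt p * y) + q / sqrt p = y" for y
      using sp p by (simp add: field_simps)
    have "(\<integral>x. indicator {- \<kappa>..} x * (E * ?N (sqrt p * x + q / sqrt p)) \<partial>lborel) =
        1 / sqrt p * (\<integral>y. indicator {s..} y * (E * ?N y) \<partial>lborel)"
      using sp(1) by (subst lborel_integral_real_affine[of "1 / sqrt p" _ "- q / p"]) (simp_all only: ind arg, simp_all)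
    then show ?thesis
      unfolding sq by (simp add: mult.left_commute)
  qed
  also have "(\<integral>y. indicator {s..} y * ?N y \<partial>lborel) = erfc (s / sqrt 2) / 2"
    by (rule gauss_tail)
  finally show ?thesis
    unfolding I_per1_def Let_def p_def[symmetric] q_def[symmetric] r_def[symmetric]
    by (simp add: s_def E_def)
qed

lemma integrable_exp_max_sq:
  assumes "0 \<le> a"
  shows "integrable gauss (\<lambda>x. exp (- a * (max 0 (x + \<kappa>))\<^sup>2))"
  by (rule integrable_gauss_growth[where K = 1 and L = 0]) (use assms in auto)

text \<open>Evident from the positive integrand of the integral form. It allows the logarithm in
  \<open>I_per\<close> to be exponentiated.\<close>

lemma I_per1_pos:
  assumes "0 < c" "0 < \<gamma>"
  shows "0 < I_per1 c \<gamma> \<kappa>"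
proof -
  let ?f = "\<lambda>x. exp (- (c / (4 * \<gamma>)) * (max 0 (x + \<kappa>))\<^sup>2)"
  have int: "integrable gauss ?f"
    using assms by (intro integrable_exp_max_sq) auto
  have "(\<integral>x. ?f x \<partial>gauss) \<noteq> 0"
  proof
    assume "(\<integral>x. ?f x \<partial>gauss) = 0"
    then have "AE x in gauss. ?f x = 0"
      using integral_nonneg_eq_0_iff_AE[OF int] by simp
    then show False
      by simp
  qed
  moreover have "0 \<le> (\<integral>x. ?f x \<partial>gauss)"
    by (rule Bochner_Integration.integral_nonneg) simp
  ultimately show ?thesis
    unfolding I_per1_eq_integral[OF assms, symmetric] by linarith
qed

text \<open>The integrand is at most 1. The logarithm is then nonpositive, which controls the
  rounding of \<open>\<alpha> * n\<close> to an integer.\<close>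

lemma I_per1_le_1:
  assumes "0 < c" "0 < \<gamma>"
  shows "I_per1 c \<gamma> \<kappa> \<le> 1"
proof -
  let ?f = "\<lambda>x. exp (- (c / (4 * \<gamma>)) * (max 0 (x + \<kappa>))\<^sup>2)"
  have "integrable gauss ?f"
    using assms by (intro integrable_exp_max_sq) auto
  then have "(\<integral>x. ?f x \<partial>gauss) \<le> (\<integral>x. 1 \<partial>gauss)"
    using assms by (intro integral_mono) auto
  then show ?thesis
    using I_per1_eq_integral[OF assms] gauss.prob_space by simp
qed

text \<open>Density times integrand is a multiple of the centred normal density with variance
  \<open>1 / (1 - 2 * a)\<close>.\<close>

lemma gauss_exp_square:
  assumes "2 * a < 1"
  shows "integrable gauss (\<lambda>x. exp (a * x\<^sup>2))"
    and "(\<integral>x. exp (a * x\<^sup>2) \<partial>gauss) = 1 / sqrt (1 - 2 * a)"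
proof -
  define \<sigma> where "\<sigma> = 1 / sqrt (1 - 2 * a)"
  have \<sigma>: "0 < \<sigma>" using assms by (simp add: \<sigma>_def)
  have s2: "\<sigma>\<^sup>2 = 1 / (1 - 2 * a)" using assms by (simp add: \<sigma>_def power_divide)
  have eq: "std_normal_density x * exp (a * x\<^sup>2) = \<sigma> * normal_density 0 \<sigma> x" for x
  proof -
    have "- x\<^sup>2 / 2 + a * x\<^sup>2 = - (x - 0)\<^sup>2 / (2 * \<sigma>\<^sup>2)"
      unfolding s2 using assms by (simp add: field_simps)
    then have "exp (- x\<^sup>2 / 2) * exp (a * x\<^sup>2) = exp (- (x - 0)\<^sup>2 / (2 * \<sigma>\<^sup>2))"
      by (simp only: exp_add[symmetric])
    then show ?thesis
      using \<sigma> by (simp add: std_normal_density_def normal_density_def real_sqrt_mult)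
  qed
  show "integrable gauss (\<lambda>x. exp (a * x\<^sup>2))"
    by (subst integrable_gauss_iff) (use \<sigma> in \<open>simp_all only: eq, auto\<close>)
  show "(\<integral>x. exp (a * x\<^sup>2) \<partial>gauss) = 1 / sqrt (1 - 2 * a)"
    by (subst integral_gauss) (use \<sigma> in \<open>simp_all only: eq, auto simp: \<sigma>_def\<close>)
qed

lemma gaussian_product_integral:
  fixes F G :: "real \<Rightarrow> real"
  assumes F: "integrable gauss F" and G: "integrable gauss G"
  shows "integrable (gaussian ({..m} \<times> {..n})) (\<lambda>\<xi>. (\<Prod>i<m. F (\<xi> (i, n))) * (\<Prod>j<n. G (\<xi> (m, j))))"
    and "(\<integral>\<xi>. (\<Prod>i<m. F (\<xi> (i, n))) * (\<Prod>j<n. G (\<xi> (m, j))) \<partial>gaussian ({..m} \<times> {..n})) =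
      (\<integral>x. F x \<partial>gauss) ^ m * (\<integral>x. G x \<partial>gauss) ^ n"
proof -
  define f where "f k = (if fst k < m then (if snd k < n then (\<lambda>_. 1) else F)
      else (if snd k < n then G else (\<lambda>_. 1)))" for k :: "nat \<times> nat"
  have int: "integrable gauss (f k)" for k
    using F G by (simp add: f_def)
  \<comment> \<open>Stated for an arbitrary \<open>g\<close>, to factorise first the pointwise
    product and then the product of the integrals.\<close>
  have prod: "(\<Prod>k\<in>{..m} \<times> {..n}. g k (f k)) = (\<Prod>i<m. g (i, n) F) * (\<Prod>j<n. g (m, j) G)"
    if "\<And>k. g k (\<lambda>_. 1) = 1" for g :: "nat \<times> nat \<Rightarrow> (real \<Rightarrow> real) \<Rightarrow> real"
  proof -
    have "(\<Prod>k\<in>{..m} \<times> {..n}. g k (f k)) = (\<Prod>i\<le>m. \<Prod>j\<le>n. g (i, j) (f (i, j)))"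
      by (simp add: prod.cartesian_product)
    also have "\<dots> = (\<Prod>i<m. \<Prod>j\<le>n. g (i, j) (f (i, j))) * (\<Prod>j\<le>n. g (m, j) (f (m, j)))"
      by (simp add: lessThan_Suc_atMost[symmetric])
    also have "(\<Prod>i<m. \<Prod>j\<le>n. g (i, j) (f (i, j))) = (\<Prod>i<m. g (i, n) F)"
      by (intro prod.cong refl) (simp add: lessThan_Suc_atMost[symmetric] f_def that)
    also have "(\<Prod>j\<le>n. g (m, j) (f (m, j))) = (\<Prod>j<n. g (m, j) G)"
      by (simp add: lessThan_Suc_atMost[symmetric] f_def that)
    finally show ?thesis .
  qed
  have eq: "(\<Prod>k\<in>{..m} \<times> {..n}. f k (\<xi> k)) = (\<Prod>i<m. F (\<xi> (i, n))) * (\<Prod>j<n. G (\<xi> (m, j)))" for \<xi>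
    using prod[of "\<lambda>k h. h (\<xi> k)"] by simp
  show "integrable (gaussian ({..m} \<times> {..n})) (\<lambda>\<xi>. (\<Prod>i<m. F (\<xi> (i, n))) * (\<Prod>j<n. G (\<xi> (m, j))))"
    unfolding eq[symmetric] gaussian_def by (intro gauss_prod.product_integrable_prod int) simp
  have "(\<integral>\<xi>. (\<Prod>k\<in>{..m} \<times> {..n}. f k (\<xi> k)) \<partial>gaussian ({..m} \<times> {..n})) = (\<Prod>k\<in>{..m} \<times> {..n}. \<integral>x. f k x \<partial>gauss)"
    unfolding gaussian_def by (intro gauss_prod.product_integral_prod int) simp
  also have "\<dots> = (\<integral>x. F x \<partial>gauss) ^ m * (\<integral>x. G x \<partial>gauss) ^ n"
    using prod[of "\<lambda>k h. \<integral>x. h x \<partial>gauss"] gauss.prob_space by simp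
  finally show "(\<integral>\<xi>. (\<Prod>i<m. F (\<xi> (i, n))) * (\<Prod>j<n. G (\<xi> (m, j))) \<partial>gaussian ({..m} \<times> {..n})) =
      (\<integral>x. F x \<partial>gauss) ^ m * (\<integral>x. G x \<partial>gauss) ^ n"
    unfolding eq .
qed

section \<open>Bounds for the two decoupled factors\<close>

text \<open>\<open>gamma_hat c\<close> is the positive root of
  \<open>4 * \<gamma>^2 - 2 * c * \<gamma> = 1\<close>, the stationary point of
  \<open>\<gamma> - 1 / (2 * c) * ln (1 - c / (2 * \<gamma>))\<close>, the rate that
  \<open>exp_norm_le\<close> yields. Lying above \<open>c / 2\<close> makes
  \<open>exp (c / (4 * \<gamma>) * x^2)\<close> integrable at \<open>\<gamma> = gamma_hat c\<close>
  and the logarithm's argument positive.\<close>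

lemma gamma_hat_gt:
  assumes "0 < c"
  shows "c / 2 < gamma_hat c"
proof -
  have "2 * c < sqrt (4 * c\<^sup>2 + 16)"
    by (rule real_less_rsqrt) (simp add: power_mult_distrib)
  then show ?thesis
    using assms by (simp add: gamma_hat_def)
qed

text \<open>The weighted arithmetic-geometric mean inequality \<open>x y \<le> \<gamma> x\<^sup>2 + y\<^sup>2 / (4 \<gamma>)\<close> with
  \<open>x = sqrt n\<close> and \<open>y\<close> the norm.\<close>

lemma exp_norm_le:
  assumes c: "0 < c" and \<gamma>: "0 < \<gamma>"
  shows "exp (c * sqrt (real n) * L2_set h {..<n}) \<le>
    exp (c * \<gamma> * real n) * (\<Prod>j<n. exp (c / (4 * \<gamma>) * (h j)\<^sup>2))"
proof -
  let ?h = "L2_set h {..<n}"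
  have "0 \<le> (sqrt \<gamma> * sqrt (real n) - ?h / (2 * sqrt \<gamma>))\<^sup>2"
    by simp
  then have "sqrt (real n) * ?h \<le> \<gamma> * real n + ?h\<^sup>2 / (4 * \<gamma>)"
    using \<gamma> by (simp add: power2_diff power_mult_distrib power_divide)
  from mult_left_mono[OF this, of c] c
  have "c * sqrt (real n) * ?h \<le> c * \<gamma> * real n + c / (4 * \<gamma>) * ?h\<^sup>2"
    by (simp add: algebra_simps)
  moreover have "?h\<^sup>2 = (\<Sum>j<n. (h j)\<^sup>2)"
    by (simp add: L2_set_def sum_nonneg)
  ultimately have "exp (c * sqrt (real n) * ?h) \<le> exp (c * \<gamma> * real n + (\<Sum>j<n. c / (4 * \<gamma>) * (h j)\<^sup>2))"
    by (simp add: sum_distrib_left)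
  then show ?thesis
    by (simp add: exp_add exp_sum)
qed

text \<open>The supremum over \<open>\<gamma>\<close> is replaced by a maximum over the grid \<open>\<gamma> = (k + 1) \<eta> / 2\<close>, so that it
  can be taken out of the expectation.\<close>

lemma exp_minus_norm_le:
  fixes v :: "nat \<Rightarrow> real"
  assumes c: "0 < c" and \<eta>: "0 < \<eta>" and n: "0 < n"
  shows "exp (- (c * sqrt (real n)) * L2_set v {..<m}) \<le> exp (- c * real n * T) +
    (\<Sum>k<nat \<lceil>T / \<eta>\<rceil>. exp (c * real n * (\<eta> / 2 - (real k + 1) * \<eta> / 2)) *
       (\<Prod>i<m. exp (- (c / (4 * ((real k + 1) * \<eta> / 2))) * (v i)\<^sup>2)))"
    (is "_ \<le> _ + (\<Sum>k<_. ?t k)")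
proof -
  define t where "t = L2_set v {..<m} / sqrt (real n)"
  have t0: "0 \<le> t" by (simp add: t_def)
  have sn: "0 < sqrt (real n)" using n by simp
  have L: "L2_set v {..<m} = sqrt (real n) * t"
    using sn by (simp add: t_def)
  have lhs: "exp (- (c * sqrt (real n)) * L2_set v {..<m}) = exp (- (c * real n * t))"
    using sn by (simp add: L)
  have nn: "0 \<le> ?t k" for k
    by (simp add: prod_nonneg)
  show ?thesis
  proof (cases "T \<le> t")
    \<comment> \<open>Large norms go into the first summand, which keeps the grid finite.\<close>
    case True
    then have "exp (- (c * real n * t)) \<le> exp (- c * real n * T)"
      using c by (simp add: mult_left_mono)
    also have "\<dots> \<le> exp (- c * real n * T) + (\<Sum>k<nat \<lceil>T / \<eta>\<rceil>. ?t k)"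
      using nn by (simp add: sum_nonneg)
    finally show ?thesis
      unfolding lhs .
  next
    case False
    \<comment> \<open>The chosen \<open>\<gamma>\<close> is the grid point just above
      \<open>t / 2\<close>, where \<open>\<gamma> + t^2 / (4 * \<gamma>)\<close> attains its minimum
      \<open>t\<close>. From \<open>t \<le> 2 * \<gamma> \<le> t + \<eta>\<close> the loss is at
      most \<open>\<eta> / 2\<close>. The shift of the index by one keeps \<open>\<gamma>\<close>
      positive.\<close>
    define k where "k = nat \<lfloor>t / \<eta>\<rfloor>"
    have tk: "0 \<le> t / \<eta>" using t0 \<eta> by simp
    have k: "real k \<le> t / \<eta>" "t / \<eta> < real k + 1"
      unfolding k_def using tk by linarith+
    have "t / \<eta> < T / \<eta>" using False \<eta> by (simp add: divide_strict_right_mono)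
    then have "real k < T / \<eta>" using k by linarith
    then have kN: "k < nat \<lceil>T / \<eta>\<rceil>" by linarith
    define \<gamma> where "\<gamma> = (real k + 1) * \<eta> / 2"
    have \<gamma>: "0 < \<gamma>" using \<eta> by (simp add: \<gamma>_def add_nonneg_pos)
    have g1: "\<gamma> \<le> (t + \<eta>) / 2" and g2: "t \<le> 2 * \<gamma>"
      using k \<eta> by (simp_all add: \<gamma>_def field_simps)
    have "t\<^sup>2 / (4 * \<gamma>) \<le> t / 2"
      using mult_left_mono[OF g2 t0] \<gamma> by (simp add: field_simps power2_eq_square)
    with g1 have "\<gamma> + t\<^sup>2 / (4 * \<gamma>) - \<eta> / 2 \<le> t"
      by (simp add: field_simps)
    from mult_left_mono[OF this, of "c * real n"] c
    have "- (c * real n * t) \<le> c * real n * (\<eta> / 2 - \<gamma>) + - (c / (4 * \<gamma>)) * (real n * t\<^sup>2)"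
      by (simp add: algebra_simps)
    moreover have "real n * t\<^sup>2 = (\<Sum>i<m. (v i)\<^sup>2)"
    proof -
      have "real n * t\<^sup>2 = (L2_set v {..<m})\<^sup>2"
        by (simp add: L power_mult_distrib)
      then show ?thesis
        by (simp add: L2_set_def sum_nonneg)
    qed
    ultimately have "exp (- (c * real n * t)) \<le> exp (c * real n * (\<eta> / 2 - \<gamma>) + (\<Sum>i<m. - (c / (4 * \<gamma>)) * (v i)\<^sup>2))"
      by (simp add: sum_distrib_left sum_negf)
    also have "\<dots> = ?t k"
      by (simp only: exp_add exp_sum[OF finite_lessThan] \<gamma>_def)
    also have "\<dots> \<le> (\<Sum>k<nat \<lceil>T / \<eta>\<rceil>. ?t k)"
      using kN nn by (intro member_le_sum) auto
    also have "\<dots> \<le> exp (- c * real n * T) + (\<Sum>k<nat \<lceil>T / \<eta>\<rceil>. ?t k)"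
      by simp
    finally show ?thesis
      unfolding lhs .
  qed
qed

text \<open>The factors are the constant of \<open>exp_norm_le\<close> and the exponential moment of
  \<open>n\<close> independent squared normals; \<open>I_sph\<close> is the logarithm of their
  product divided by \<open>c * n\<close>.\<close>

lemma exp_I_sph:
  assumes c: "0 < c"
  shows "exp (c * gamma_hat c * real n) * (1 / sqrt (1 - 2 * (c / (4 * gamma_hat c)))) ^ n =
    exp (c * real n * I_sph c)"
proof -
  define u where "u = 1 - c / (2 * gamma_hat c)"
  have g: "0 < gamma_hat c" "c < 2 * gamma_hat c"
    using gamma_hat_gt[OF c] c by linarith+
  have u: "0 < u"
    using g by (simp add: u_def)
  have u': "1 - 2 * (c / (4 * gamma_hat c)) = u"
    by (simp add: u_def)
  have "1 / sqrt u = exp (- ln u / 2)"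
    using u by (simp add: exp_minus ln_sqrt[symmetric] field_simps)
  then have "(1 / sqrt u) ^ n = exp (real n * (- ln u / 2))"
    by (simp only: exp_of_nat_mult)
  moreover have "c * gamma_hat c * real n + real n * (- ln u / 2) = c * real n * I_sph c"
    unfolding I_sph_def u_def[symmetric] using c by (simp add: field_simps)
  ultimately show ?thesis
    unfolding u' by (simp only: exp_add[symmetric])
qed

text \<open>Both pointwise bounds are built from products over coordinates, so integration replaces
  each factor by its one-dimensional value. \<open>T\<close> and \<open>\<eta>\<close> stay free, to
  be balanced against the gap at the end.\<close>

lemma integral_decoupled_le:
  assumes c: "0 < c" and \<eta>: "0 < \<eta>" and n: "0 < n"
  shows "(\<integral>\<xi>. decoupled m n \<kappa> (c * sqrt (real n)) \<xi> \<partial>gaussian ({..m} \<times> {..n})) \<le>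
    exp (c * real n * I_sph c) * (exp (- c * real n * T) +
      (\<Sum>k<nat \<lceil>T / \<eta>\<rceil>. exp (c * real n * (\<eta> / 2 - (real k + 1) * \<eta> / 2)) *
        I_per1 c ((real k + 1) * \<eta> / 2) \<kappa> ^ m))"
proof -
  let ?I = "{..m} \<times> {..n}" and ?K = "nat \<lceil>T / \<eta>\<rceil>" and ?g = "gamma_hat c"
  define \<gamma> where "\<gamma> k = (real k + 1) * \<eta> / 2" for k
  define F where "F k x = exp (- (c / (4 * \<gamma> k)) * (max 0 (x + \<kappa>))\<^sup>2)" for k x
  define G where "G x = exp (c / (4 * ?g) * x\<^sup>2)" for x
  have \<gamma>: "0 < \<gamma> k" for k
    using \<eta> by (simp add: \<gamma>_def add_nonneg_pos)
  have g: "0 < ?g" "c < 2 * ?g"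
    using gamma_hat_gt[OF c] c by linarith+
  have a: "2 * (c / (4 * ?g)) < 1"
    using g by (simp add: field_simps)
  have F: "integrable gauss (F k)" "(\<integral>x. F k x \<partial>gauss) = I_per1 c (\<gamma> k) \<kappa>" for k
  proof -
    show "integrable gauss (F k)"
      unfolding F_def using c \<gamma>[of k] by (intro integrable_exp_max_sq) simp
    show "(\<integral>x. F k x \<partial>gauss) = I_per1 c (\<gamma> k) \<kappa>"
      unfolding F_def by (rule I_per1_eq_integral[OF c \<gamma>])
  qed
  have G: "integrable gauss G" "(\<integral>x. G x \<partial>gauss) = 1 / sqrt (1 - 2 * (c / (4 * ?g)))"
    unfolding G_def using gauss_exp_square[OF a] by simp_all
  have one: "integrable gauss (\<lambda>_. 1 :: real)"
    by simp
  note P = gaussian_product_integral[OF F(1) G(1)] and P1 = gaussian_product_integral[OF one G(1)]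
  \<comment> \<open>The product of ones gives the first summand the shape that
    \<open>gaussian_product_integral\<close> handles.\<close>
  define B where "B \<xi> = exp (c * ?g * real n) *
      (exp (- c * real n * T) * ((\<Prod>i<m. 1) * (\<Prod>j<n. G (\<xi> (m, j)))) +
       (\<Sum>k<?K. exp (c * real n * (\<eta> / 2 - \<gamma> k)) * ((\<Prod>i<m. F k (\<xi> (i, n))) * (\<Prod>j<n. G (\<xi> (m, j))))))"
    for \<xi>
  have "decoupled m n \<kappa> (c * sqrt (real n)) \<xi> \<le> B \<xi>" for \<xi>
  proof -
    have "decoupled m n \<kappa> (c * sqrt (real n)) \<xi> \<le>
        (exp (- c * real n * T) + (\<Sum>k<?K. exp (c * real n * (\<eta> / 2 - \<gamma> k)) * (\<Prod>i<m. F k (\<xi> (i, n))))) *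
        (exp (c * ?g * real n) * (\<Prod>j<n. G (\<xi> (m, j))))"
      unfolding decoupled_def
    proof (rule mult_mono)
      show "exp (- (c * sqrt (real n)) * L2_set (\<lambda>i. max 0 (\<xi> (i, n) + \<kappa>)) {..<m}) \<le>
          exp (- c * real n * T) + (\<Sum>k<?K. exp (c * real n * (\<eta> / 2 - \<gamma> k)) * (\<Prod>i<m. F k (\<xi> (i, n))))"
        unfolding F_def \<gamma>_def by (rule exp_minus_norm_le[OF c \<eta> n])
      show "exp (c * sqrt (real n) * L2_set (\<lambda>j. \<xi> (m, j)) {..<n}) \<le> exp (c * ?g * real n) * (\<Prod>j<n. G (\<xi> (m, j)))"
        unfolding G_def by (rule exp_norm_le[OF c g(1)])
      show "0 \<le> exp (- c * real n * T) + (\<Sum>k<?K. exp (c * real n * (\<eta> / 2 - \<gamma> k)) * (\<Prod>i<m. F k (\<xi> (i, n))))"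
        by (intro add_nonneg_nonneg sum_nonneg mult_nonneg_nonneg prod_nonneg) (auto simp: F_def)
    qed simp
    also have "\<dots> = B \<xi>"
      by (simp add: B_def algebra_simps sum_distrib_left)
    finally show ?thesis .
  qed
  moreover have Bint: "integrable (gaussian ?I) B"
    unfolding B_def
    by (intro integrable_mult_right Bochner_Integration.integrable_add Bochner_Integration.integrable_sum P(1) P1(1))
  ultimately have "(\<integral>\<xi>. decoupled m n \<kappa> (c * sqrt (real n)) \<xi> \<partial>gaussian ?I) \<le> (\<integral>\<xi>. B \<xi> \<partial>gaussian ?I)"
    using c n by (intro integral_mono integrable_decoupled) auto
  also have "\<dots> = exp (c * ?g * real n) *
      (exp (- c * real n * T) * ((\<integral>x. 1 \<partial>gauss) ^ m * (\<integral>x. G x \<partial>gauss) ^ n) +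
       (\<Sum>k<?K. exp (c * real n * (\<eta> / 2 - \<gamma> k)) * ((\<integral>x. F k x \<partial>gauss) ^ m * (\<integral>x. G x \<partial>gauss) ^ n)))"
    unfolding B_def integral_mult_right_zero P(2)[symmetric] P1(2)[symmetric]
    by (subst Bochner_Integration.integral_add Bochner_Integration.integral_sum |
        intro integrable_mult_right Bochner_Integration.integrable_sum P(1) P1(1) |
        simp only: integral_mult_right_zero)+
  also have "\<dots> = (exp (c * ?g * real n) * (\<integral>x. G x \<partial>gauss) ^ n) * (exp (- c * real n * T) +
      (\<Sum>k<?K. exp (c * real n * (\<eta> / 2 - \<gamma> k)) * I_per1 c (\<gamma> k) \<kappa> ^ m))"
    using gauss.prob_space by (simp add: F(2) algebra_simps sum_distrib_left)
  also have "exp (c * ?g * real n) * (\<integral>x. G x \<partial>gauss) ^ n = exp (c * real n * I_sph c)"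
    unfolding G(2) by (rule exp_I_sph[OF c])
  finally show ?thesis
    by (simp add: \<gamma>_def)
qed


section \<open>Exponential decay of the feasibility probability\<close>

theorem theorem4:
  fixes \<kappa> \<alpha> :: real
    and m :: "nat \<Rightarrow> nat"
    and M :: "nat \<Rightarrow> 'a measure"
    and H :: "nat \<Rightarrow> nat \<Rightarrow> nat \<Rightarrow> 'a \<Rightarrow> real"
  assumes "\<kappa> < 0" and "\<alpha> > 0"
    and "\<And>n. \<bar>real (m n) - \<alpha> * real n\<bar> < 1"
    and "\<And>n. std_normal_matrix (M n) (m n) n (H n)"
    and "(INF c\<in>{0<..}. ereal (- c / 2 + I_sph c) + I_per c \<alpha> \<kappa>) < 0"
  shows "with_overwhelming_probability M
    (\<lambda>n \<omega>. \<not> spherical_feasible (m n) n \<kappa> (\<lambda>i j. H n i j \<omega>))"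
proof -
  let ?feas = "\<lambda>n. {\<omega> \<in> space (M n). spherical_feasible (m n) n \<kappa> (\<lambda>i j. H n i j \<omega>)}"
  have compl: "{\<omega> \<in> space (M n). \<not> spherical_feasible (m n) n \<kappa> (\<lambda>i j. H n i j \<omega>)} = space (M n) - ?feas n" for n
    by auto
  have feas_sets: "?feas n \<in> sets (M n)" for n
    by (rule measurable_spherical_feasible) (rule std_normal_matrix_borel_measurable[OF assms(4)])
  have prob: "prob_space (M n)" for n
    using assms(4)[of n] by (simp add: std_normal_matrix_def)
  obtain c where c: "0 < c" and neg: "ereal (- c / 2 + I_sph c) + I_per c \<alpha> \<kappa> < 0"
    using assms(5) unfolding INF_less_iff by auto
  \<comment> \<open>If the supremum is minus infinity, any sufficiently small real bound will do;
    plus infinity is excluded by \<open>neg\<close>.\<close>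
  obtain J where J: "I_per c \<alpha> \<kappa> \<le> ereal J" "- c / 2 + I_sph c + J < 0"
  proof (cases "I_per c \<alpha> \<kappa>")
    case (real r)
    then show ?thesis using neg by (intro that[of r]) auto
  next
    case PInf
    then show ?thesis using neg by simp
  next
    case MInf
    then show ?thesis by (intro that[of "c / 2 - I_sph c - 1"]) auto
  qed
  have sup: "- \<gamma> + \<alpha> / c * ln (I_per1 c \<gamma> \<kappa>) \<le> J" if "0 < \<gamma>" for \<gamma>
  proof -
    have "ereal (- \<gamma> + \<alpha> / c * ln (I_per1 c \<gamma> \<kappa>)) \<le> I_per c \<alpha> \<kappa>"
      unfolding I_per_def by (rule SUP_upper) (use that in simp)
    then show ?thesis
      using J(1) by (metis ereal_less_eq(3) order_trans)
  qed
  \<comment> \<open>The gap below zero. Used as \<open>\<eta>\<close> it costs \<open>D / 2\<close>,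
    which leaves the rate \<open>c * D / 2\<close>.\<close>
  define D where "D = c / 2 - I_sph c - J"
  have D: "0 < D" using J(2) by (simp add: D_def)
  \<comment> \<open>The cut-off is \<open>T = - J\<close>: the tail term then equals
    \<open>exp (c * n * J)\<close>, which stays below the common bound \<open>?e\<close>.\<close>
  define N where "N = nat \<lceil>- J / D\<rceil>"
  define \<gamma> where "\<gamma> k = (real k + 1) * D / 2" for k
  have \<gamma>: "0 < \<gamma> k" for k
    using D by (simp add: \<gamma>_def add_nonneg_pos)
  define I where "I k = I_per1 c (\<gamma> k) \<kappa>" for k
  have I: "0 < I k" "I k \<le> 1" for k
    unfolding I_def using I_per1_pos[OF c \<gamma>] I_per1_le_1[OF c \<gamma>] by auto
  define K where "K = 1 + (\<Sum>k<N. 1 / I k)"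
  have K: "0 < K"
    unfolding K_def using I by (intro add_pos_nonneg sum_nonneg) (auto simp: less_imp_le)
  \<comment> \<open>As \<open>m n\<close> is at least \<open>\<alpha> * n - 1\<close> and
    \<open>I k \<le> 1\<close>, replacing \<open>m n\<close> by \<open>\<alpha> * n\<close> costs at
    most the factor \<open>1 / I k\<close>. These factors do not depend on \<open>n\<close> and are
    collected in \<open>K\<close>.\<close>
  have pow: "I k ^ m n \<le> exp (c * real n * (J + \<gamma> k)) / I k" for k n
  proof -
    have l: "ln (I k) \<le> 0"
      using I[of k] by simp
    have "\<alpha> * real n - 1 \<le> real (m n)"
      using assms(3)[of n] by linarith
    from mult_right_mono_neg[OF this l]
    have "real (m n) * ln (I k) \<le> real n * (\<alpha> * ln (I k)) - ln (I k)"
      by (simp add: algebra_simps)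
    also have "\<dots> \<le> real n * (c * (J + \<gamma> k)) - ln (I k)"
    proof -
      have "\<alpha> / c * ln (I k) \<le> J + \<gamma> k"
        using sup[OF \<gamma>[of k]] by (simp add: I_def)
      from mult_left_mono[OF this, of c] have "\<alpha> * ln (I k) \<le> c * (J + \<gamma> k)"
        using c by simp
      then show ?thesis
        by (simp add: mult_left_mono)
    qed
    finally have "exp (real (m n) * ln (I k)) \<le> exp (c * real n * (J + \<gamma> k) - ln (I k))"
      by (simp add: mult_ac)
    then show ?thesis
      using I[of k] by (simp add: exp_diff exp_of_nat_mult)
  qed
  have bound: "measure (M n) (?feas n) \<le> K * exp (- (c * D / 2) * real n)" if n: "0 < n" and mn: "0 < m n" for n
  proof -
    have cn: "0 < c * sqrt (real n)" using c n by simp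
    let ?e = "exp (c * real n * (D / 2 + J))"
    have "measure (M n) (?feas n) \<le> exp (- (c * sqrt (real n))\<^sup>2 / 2) *
        (\<integral>\<xi>. decoupled (m n) n \<kappa> (c * sqrt (real n)) \<xi> \<partial>gaussian ({..m n} \<times> {..n}))"
      unfolding measure_spherical_feasible_gaussian[OF assms(4) mn n] by (rule gordon_bound_sphere[OF cn])
    also have "\<dots> \<le> exp (- (c * sqrt (real n))\<^sup>2 / 2) * (exp (c * real n * I_sph c) * (K * ?e))"
    proof (intro mult_left_mono)
      have "(\<integral>\<xi>. decoupled (m n) n \<kappa> (c * sqrt (real n)) \<xi> \<partial>gaussian ({..m n} \<times> {..n})) \<le>
          exp (c * real n * I_sph c) * (exp (- c * real n * (- J)) +
          (\<Sum>k<N. exp (c * real n * (D / 2 - \<gamma> k)) * I k ^ m n))"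
        unfolding N_def I_def \<gamma>_def by (rule integral_decoupled_le[OF c D n])
      also have "\<dots> \<le> exp (c * real n * I_sph c) * (?e + (\<Sum>k<N. ?e * (1 / I k)))"
      proof (intro mult_left_mono add_mono sum_mono)
        show "exp (- c * real n * (- J)) \<le> ?e"
          using c D by (simp add: algebra_simps)
        fix k
        have "exp (c * real n * (D / 2 - \<gamma> k)) * I k ^ m n \<le>
            exp (c * real n * (D / 2 - \<gamma> k)) * (exp (c * real n * (J + \<gamma> k)) / I k)"
          by (intro mult_left_mono pow) simp
        also have "\<dots> = ?e * (1 / I k)"
          by (simp add: exp_add[symmetric] algebra_simps)
        finally show "exp (c * real n * (D / 2 - \<gamma> k)) * I k ^ m n \<le> ?e * (1 / I k)" .
      qed simp
      also have "?e + (\<Sum>k<N. ?e * (1 / I k)) = K * ?e"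
        unfolding K_def sum_distrib_left[symmetric] by (simp add: algebra_simps)
      finally show "(\<integral>\<xi>. decoupled (m n) n \<kappa> (c * sqrt (real n)) \<xi> \<partial>gaussian ({..m n} \<times> {..n})) \<le>
          exp (c * real n * I_sph c) * (K * ?e)" .
    qed simp
    also have "\<dots> = K * exp (- (c * sqrt (real n))\<^sup>2 / 2 + c * real n * I_sph c + c * real n * (D / 2 + J))"
      unfolding exp_add by (simp only: mult_ac)
    also have "- (c * sqrt (real n))\<^sup>2 / 2 + c * real n * I_sph c + c * real n * (D / 2 + J) = - (c * D / 2) * real n"
      by (simp add: D_def power_mult_distrib power2_eq_square field_simps)
    finally show ?thesis .
  qed
  have abs: "\<bar>1 - measure (M n) (space (M n) - ?feas n)\<bar> = measure (M n) (?feas n)" for n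
    using prob_space.prob_compl[OF prob feas_sets[of n]] by simp
  have "eventually (\<lambda>n. \<bar>1 - measure (M n) (space (M n) - ?feas n)\<bar> \<le> K * exp (- (c * D / 2) * real n)) sequentially"
    \<comment> \<open>From here on \<open>\<alpha> * n \<ge> 1\<close>, so \<open>m n > 0\<close> as
      \<open>bound\<close> requires.\<close>
    using eventually_ge_at_top[of "Suc (nat \<lceil>1 / \<alpha>\<rceil>)"]
  proof eventually_elim
    case (elim n)
    have "1 / \<alpha> \<le> real n"
      using elim by linarith
    then have "1 \<le> \<alpha> * real n"
      using assms(2) by (simp add: field_simps)
    then have "0 < m n"
      using assms(3)[of n] by (cases "m n") auto
    then show ?case
      unfolding abs using elim by (intro bound) auto
  qed
  moreover have "0 < c * D / 2" using c D by simp
  ultimately show ?thesis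
    unfolding with_overwhelming_probability_def compl using K feas_sets
    by (intro conjI allI exI[of _ K] exI[of _ "c * D / 2"]) auto
qed

end
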